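(* Let $(S,T)$ be a connected bordered triangulated surface with edge set $E$, and let $h\in\mathbb{R}$. Then the following statements hold. (a) If $d_1,d_2:E\to\mathbb{R}_{+}$ are two Euclidean polyhedral metrics on $(S,T)$ with the same boundary value, and either $d_1,d_2$ have the same $\phi_h$-curvature on every interior edge or $d_1,d_2$ have the same $\psi_h$-curvature on every interior edge, then $d_1=d_2$. (b) If $d_1,d_2:E\to\mathbb{R}_{+}$ are two hyperbolic polyhedral metrics on $(S,T)$ with the same boundary value and the same $\psi_h$-curvature on every interior edge, then $d_1=d_2$. (c) If $d_1,d_2:E\to\mathbb{R}_{+}$ are two spherical polyhedral metrics on $(S,T)$ with the same boundary value and the same $\phi_h$-curvature on every interior edge, then $d_1=d_2$.
   Context: A bordered triangulated surface $(S,T)$ is a compact surface $S$ with non-empty boundary together with a (finite) triangulation $T$; $E$ is its set of edges. An edge is a boundary edge if it belongs to the boundary of $S$, and an interior edge otherwise; $E_{\partial}$ is the set of boundary edges. A Euclidean (resp. hyperbolic, spherical) polyhedral metric on $(S,T)$ is a function $d:E\to\mathbb{R}_{+}$ such that for every triangle of $T$ with edges $e_1,e_2,e_3$ the numbers $d(e_1),d(e_2),d(e_3)$ are the edge lengths of a non-degenerate triangle in the Euclidean plane (resp. hyperbolic plane, unit sphere). That is, the strict triangle inequalities hold and, in the spherical case, moreover all lengths lie in $(0,\pi)$ and $d(e_1)+d(e_2)+d(e_3)<2\pi$. The metric $d$ makes each triangle of $T$ isometric to the corresponding geometric triangle. "Determined up to isometry" means that the function $d$ is determined. The boundary value of $d$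 is the restriction $d|_{E_{\partial}}$. Let $e$ be an interior edge. In the two triangles adjacent to $e$, let $a,a'$ be the inner angles facing $e$, let $b,c$ be the inner angles adjacent to $e$ in the triangle containing $a$, and let $b',c'$ be the inner angles adjacent to $e$ in the triangle containing $a'$. For $h\in\mathbb{R}$ define $$\phi_h(e)=\int_a^{\pi/2}\sin^h t\,dt+\int_{a'}^{\pi/2}\sin^h t\,dt,$$ $$\psi_h(e)=\int_0^{(b+c-a)/2}\cos^h t\,dt+\int_0^{(b'+c'-a')/2}\cos^h t\,dt.$$ *)

theory Defs
  imports "HOL-Analysis.Analysis"
begin

section \<open>Compact surfaces with boundary and their triangulations\<close>

text \<open>Charts of a topological 2-manifold with boundary take values in relatively open subsets of
  the closed upper half-plane.\<close>

definition half_plane_chart :: "'s topology \<Rightarrow> 's set \<Rightarrow> ('s \<Rightarrow> complex) \<Rightarrow> bool" where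
  "half_plane_chart X U \<kappa> \<longleftrightarrow> openin X U \<and>
     (\<exists>V. openin (top_of_set {z. 0 \<le> Im z}) V \<and>
          homeomorphic_map (subtopology X U) (top_of_set V) \<kappa>)"

definition compact_surface :: "'s topology \<Rightarrow> bool" where
  "compact_surface X \<longleftrightarrow> compact_space X \<and> Hausdorff_space X \<and> second_countable X \<and>
     (\<forall>p \<in> topspace X. \<exists>U \<kappa>. p \<in> U \<and> half_plane_chart X U \<kappa>)"

definition surface_boundary :: "'s topology \<Rightarrow> 's set" where
  "surface_boundary X = {p. \<exists>U \<kappa>. p \<in> U \<and> half_plane_chart X U \<kappa> \<and> Im (\<kappa> p) = 0}"

definition triangles :: "'v::euclidean_space set set \<Rightarrow> 'v set set" where
  "triangles K = {t \<in> K. 2 simplex t}"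

definition edges :: "'v::euclidean_space set set \<Rightarrow> 'v set set" where
  "edges K = {e \<in> K. 1 simplex e}"

text \<open>A triangulation of \<open>X\<close> is a finite simplicial complex \<open>K\<close> together with a homeomorphism
  \<open>f\<close> from its underlying space onto \<open>X\<close>; the triangles and edges of the triangulation are the
  images under \<open>f\<close> of those of \<open>K\<close>. The complex is 2-dimensional, every simplex being a face of a
  triangle (as must be the case when \<open>X\<close> is a surface).\<close>

definition triangulation_of :: "'s topology \<Rightarrow> 'v::euclidean_space set set \<Rightarrow> ('v \<Rightarrow> 's) \<Rightarrow> bool" where
  "triangulation_of X K f \<longleftrightarrow> simplicial_complex K \<and> (\<forall>c \<in> K. \<exists>t \<in> triangles K. c \<subseteq> t) \<and>
     homeomorphic_map (top_of_set (\<Union>K)) X f"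

definition bordered_triangulated_surface ::
    "'s topology \<Rightarrow> 'v::euclidean_space set set \<Rightarrow> ('v \<Rightarrow> 's) \<Rightarrow> bool" where
  "bordered_triangulated_surface X K f \<longleftrightarrow>
     compact_surface X \<and> surface_boundary X \<noteq> {} \<and> triangulation_of X K f"

definition boundary_edges :: "'s topology \<Rightarrow> 'v::euclidean_space set set \<Rightarrow> ('v \<Rightarrow> 's) \<Rightarrow> 'v set set" where
  "boundary_edges X K f = {e \<in> edges K. f ` e \<subseteq> surface_boundary X}"

definition interior_edges :: "'s topology \<Rightarrow> 'v::euclidean_space set set \<Rightarrow> ('v \<Rightarrow> 's) \<Rightarrow> 'v set set" where
  "interior_edges X K f = edges K - boundary_edges X K f"

definition sides :: "'v::euclidean_space set set \<Rightarrow> 'v set \<Rightarrow> 'v set set" where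
  "sides K t = {e \<in> edges K. e \<subseteq> t}"

section \<open>Polyhedral metrics\<close>

datatype geometry = Euclidean | Hyperbolic | Spherical

text \<open>\<open>x\<close>, \<open>y\<close>, \<open>z\<close> are the edge lengths of a non-degenerate triangle in the Euclidean plane, the
  hyperbolic plane (of curvature -1), or the unit sphere.\<close>

fun triangle_lengths :: "geometry \<Rightarrow> real \<Rightarrow> real \<Rightarrow> real \<Rightarrow> bool" where
  "triangle_lengths Euclidean x y z \<longleftrightarrow>
     0 < x \<and> 0 < y \<and> 0 < z \<and> x < y + z \<and> y < z + x \<and> z < x + y"
| "triangle_lengths Hyperbolic x y z \<longleftrightarrow>
     0 < x \<and> 0 < y \<and> 0 < z \<and> x < y + z \<and> y < z + x \<and> z < x + y"
| "triangle_lengths Spherical x y z \<longleftrightarrow>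
     0 < x \<and> 0 < y \<and> 0 < z \<and> x < y + z \<and> y < z + x \<and> z < x + y \<and>
     x < pi \<and> y < pi \<and> z < pi \<and> x + y + z < 2 * pi"

text \<open>The inner angle facing the edge of length \<open>x\<close> in the geometric triangle with edge lengths
  \<open>x\<close>, \<open>y\<close>, \<open>z\<close>, by the law of cosines of the respective geometry.\<close>

fun triangle_angle :: "geometry \<Rightarrow> real \<Rightarrow> real \<Rightarrow> real \<Rightarrow> real" where
  "triangle_angle Euclidean x y z = arccos ((y\<^sup>2 + z\<^sup>2 - x\<^sup>2) / (2 * y * z))"
| "triangle_angle Hyperbolic x y z = arccos ((cosh y * cosh z - cosh x) / (sinh y * sinh z))"
| "triangle_angle Spherical x y z = arccos ((cos x - cos y * cos z) / (sin y * sin z))"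

definition polyhedral_metric ::
    "geometry \<Rightarrow> 'v::euclidean_space set set \<Rightarrow> ('v set \<Rightarrow> real) \<Rightarrow> bool" where
  "polyhedral_metric G K d \<longleftrightarrow> (\<forall>e \<in> edges K. 0 < d e) \<and>
     (\<forall>t \<in> triangles K. \<forall>e1 e2 e3. sides K t = {e1, e2, e3} \<and> distinct [e1, e2, e3] \<longrightarrow>
        triangle_lengths G (d e1) (d e2) (d e3))"

text \<open>The inner angle of the triangle \<open>t\<close> facing its side \<open>e\<close>. Uniqueness of the described value:
  \<open>triangle_angle\<close> is symmetric in its last two arguments.\<close>

definition facing_angle ::
    "geometry \<Rightarrow> 'v::euclidean_space set set \<Rightarrow> ('v set \<Rightarrow> real) \<Rightarrow> 'v set \<Rightarrow> 'v set \<Rightarrow> real" where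
  "facing_angle G K d t e = (THE \<theta>. \<exists>e1 e2. sides K t = {e, e1, e2} \<and> distinct [e, e1, e2] \<and>
     \<theta> = triangle_angle G (d e) (d e1) (d e2))"

section \<open>Curvatures\<close>

text \<open>In both definitions the sum has exactly two terms when \<open>e\<close> is an interior edge: one for each
  adjacent triangle. The interval integral is oriented, so the lower limit may exceed the upper
  one; on the range of integration \<open>sin\<close>, respectively \<open>cos\<close>, is positive. In a triangle, the two
  angles adjacent to \<open>e\<close> are the ones facing the other two sides.\<close>

definition phi_curvature ::
    "geometry \<Rightarrow> real \<Rightarrow> 'v::euclidean_space set set \<Rightarrow> ('v set \<Rightarrow> real) \<Rightarrow> 'v set \<Rightarrow> real" where
  "phi_curvature G h K d e =
     (\<Sum>t | t \<in> triangles K \<and> e \<in> sides K t.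
        LBINT x = ereal (facing_angle G K d t e)..ereal (pi / 2). sin x powr h)"

definition psi_curvature ::
    "geometry \<Rightarrow> real \<Rightarrow> 'v::euclidean_space set set \<Rightarrow> ('v set \<Rightarrow> real) \<Rightarrow> 'v set \<Rightarrow> real" where
  "psi_curvature G h K d e =
     (\<Sum>t | t \<in> triangles K \<and> e \<in> sides K t.
        LBINT x = 0..ereal (((\<Sum>e' \<in> sides K t - {e}. facing_angle G K d t e')
                             - facing_angle G K d t e) / 2). cos x powr h)"

end

theory Submission
  imports Defs
begin

text \<open>
  Write \<open>\<sigma>(l)\<close> for \<open>l\<close>, \<open>tanh (l/2)\<close> and \<open>sin l\<close> in Euclidean, hyperbolic and spherical geometry. Attach to a
  side of a triangle the angle \<open>a\<close> facing it, except that in hyperbolic geometry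
  \<open>a = (\<pi> + \<theta>\<^sub>1 - \<theta>\<^sub>2 - \<theta>\<^sub>3) / 2\<close>, where \<open>\<theta>\<^sub>1\<close> is the facing angle. Then \<open>sin a\<^sub>i = c \<sigma>(l\<^sub>i)\<close> for the three sides of a
  triangle in all geometries. Let \<open>U' = \<sigma>\<^bsup>-h-1\<^esup>\<close> and \<open>F' = sin\<^sup>h\<close>. Up to constants, the curvature of an
  edge is the sum of \<open>-F(a)\<close> over the triangles at the edge.

  The core is an inequality for two triangles with sides \<open>l\<^sub>i\<close> and \<open>m\<^sub>i\<close>:
  \<open>\<Sum> (U(m\<^sub>i) - U(l\<^sub>i)) (F(a\<^sub>i(m)) - F(a\<^sub>i(l))) \<ge> 0\<close>, with equality only if the angles agree. Take the sum of these
  inequalities over all triangles for the two metrics. Regrouped by edges, every term vanishes: at a boundary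
  edge because the lengths agree, at an interior edge because the curvatures do. So equality holds in every
  triangle and the two metrics have the same angles (\<open>angles_equal\<close>). Spherical and hyperbolic triangles are
  determined by their angles. Euclidean ones are determined up to scale; the scale is the same on both
  sides of an edge, hence globally the same (\<open>triangles_strongly_connected\<close>), and it is \<open>1\<close> because
  there is a boundary edge (\<open>exists_boundary_edge\<close>). These two topological facts rest on invariance
  of domain and on the connectedness of a punctured half-disc.

  The inequality (\<open>pair_inequality\<close>) follows by differentiating \<open>\<Sum> v\<^sub>i F(a\<^sub>i)\<close> with
  \<open>v\<^sub>i = U(m\<^sub>i) - U(l\<^sub>i)\<close> along the path from \<open>l\<close> to \<open>m\<close> on which each \<open>U(l\<^sub>i)\<close> is linear. By the law of
  sines the derivative is \<open>c\<^sup>h \<Sum> (l\<^sub>i' / \<sigma>(l\<^sub>i)) a\<^sub>i'\<close>, and for each geometry one checks that this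
  quadratic form in the \<open>l\<^sub>i'\<close> is nonnegative, its kernel consisting of variations without change of the
  angles. The path need not stay in the space of triangles. If \<open>h > -1\<close>, then \<open>F\<close> is continuous up to the ends of
  \<open>[0, \<pi>]\<close>, and the angles are extended continuously to degenerate triangles. These have only finitely
  many systems of angles, so that monotonicity survives
  (\<open>nondecreasing_if_deriv_nonneg_off_finite\<close>). If \<open>h \<le> -1\<close>, the Euclidean and hyperbolic
  triangles form a convex set in the coordinates \<open>U\<close> (\<open>triangle_inequality_along_straight_path\<close>), and
  polar duality reduces the spherical case to the exponent \<open>-1 - h\<close>.\<close>

section \<open>Monotone and concave functions, primitives of powers of the sine\<close>

text \<open>If \<open>g\<close> decreased from \<open>a\<close> to \<open>b\<close>, it would have to pass through a band of values that avoids the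
  finite set \<open>Y\<close>; but inside such a band the derivative is known to be nonnegative. The lemma is
  made for sums of functions of the angles of a moving triangle: nothing is known about their
  derivative while the triangle is degenerate, but their values are then limited to a finite set.\<close>

lemma nondecreasing_if_deriv_nonneg_off_finite:
  fixes g :: "real \<Rightarrow> real"
  assumes cont: "continuous_on {a..b} g" and "finite Y" and "a \<le> b"
    and der: "\<And>s. a < s \<Longrightarrow> s < b \<Longrightarrow> g s \<notin> Y \<Longrightarrow> \<exists>D\<ge>0. (g has_real_derivative D) (at s)"
  shows "g a \<le> g b"
proof (rule ccontr)
  assume "\<not> g a \<le> g b"
  then have "infinite {g b<..<g a}" by (simp add: infinite_Ioo)
  then have "infinite ({g b<..<g a} - Y)" using \<open>finite Y\<close> by simp
  then obtain r where r: "r \<in> {g b<..<g a} - Y"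
    by (metis finite.emptyI ex_in_conv)
  have "open ({g b<..<g a} - Y)"
    using \<open>finite Y\<close> by (simp add: finite_imp_closed open_Diff)
  with r obtain e where e: "e > 0" "cball r e \<subseteq> {g b<..<g a} - Y"
    using open_contains_cball by blast
  define lo hi where "lo = r - e" and "hi = r + e"
  have lohi: "lo < hi" "g b < lo" "hi < g a" and noY: "\<And>y. lo \<le> y \<Longrightarrow> y \<le> hi \<Longrightarrow> y \<notin> Y"
    using e by (auto simp: lo_def hi_def subset_iff dist_real_def abs_le_iff dest: spec[of _ "r - e"] spec[of _ "r + e"])
  have closed: "closed {s \<in> {a..b}. hi \<le> g s}"
    by (intro continuous_on_closed_Collect_le continuous_intros cont)
  have "bounded {s \<in> {a..b}. hi \<le> g s}"
    by (rule bounded_subset[of "{a..b}"]) auto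
  with closed have "compact {s \<in> {a..b}. hi \<le> g s}" by (simp add: compact_eq_bounded_closed)
  moreover have "{s \<in> {a..b}. hi \<le> g s} \<noteq> {}" using lohi \<open>a \<le> b\<close> by force
  ultimately have "\<exists>c\<in>{s \<in> {a..b}. hi \<le> g s}. \<forall>s\<in>{s \<in> {a..b}. hi \<le> g s}. s \<le> c"
    by (rule compact_attains_sup)
  then obtain c where c: "c \<in> {s \<in> {a..b}. hi \<le> g s}"
      and cmax: "\<And>s. s \<in> {s \<in> {a..b}. hi \<le> g s} \<Longrightarrow> s \<le> c"
    by (elim bexE) (erule that, erule bspec)
  have "continuous_on {c..b} g" using cont by (rule continuous_on_subset) (use c in auto)
  then have closed: "closed {s \<in> {c..b}. g s \<le> lo}"
    by (intro continuous_on_closed_Collect_le continuous_intros)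
  have "bounded {s \<in> {c..b}. g s \<le> lo}"
    by (rule bounded_subset[of "{c..b}"]) auto
  with closed have "compact {s \<in> {c..b}. g s \<le> lo}" by (simp add: compact_eq_bounded_closed)
  moreover have "{s \<in> {c..b}. g s \<le> lo} \<noteq> {}" using lohi c by force
  ultimately have "\<exists>d\<in>{s \<in> {c..b}. g s \<le> lo}. \<forall>s\<in>{s \<in> {c..b}. g s \<le> lo}. d \<le> s"
    by (rule compact_attains_inf)
  then obtain d where d: "d \<in> {s \<in> {c..b}. g s \<le> lo}"
      and dmin: "\<And>s. s \<in> {s \<in> {c..b}. g s \<le> lo} \<Longrightarrow> d \<le> s"
    by (elim bexE) (erule that, erule bspec)
  have "g c \<le> g d"
  proof (rule DERIV_nonneg_imp_increasing_open[where f = g])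
    show "c \<le> d" using d by auto
    show "continuous_on {c..d} g" using cont by (rule continuous_on_subset) (use c d in auto)
    fix s assume s: "c < s" "s < d"
    have "\<not> hi \<le> g s" using cmax[of s] s c d by auto
    moreover have "\<not> g s \<le> lo" using dmin[of s] s c d by auto
    ultimately have "g s \<notin> Y" using noY by auto
    then show "\<exists>y. (g has_real_derivative y) (at s) \<and> 0 \<le> y"
      using der[of s] s c d by auto
  qed
  then show False using c d lohi by auto
qed

lemma constant_if_deriv_zero_off_finite:
  fixes g :: "real \<Rightarrow> real"
  assumes cont: "continuous_on {a..b} g" and fin: "finite Y" and "a \<le> b"
    and der: "\<And>s. a < s \<Longrightarrow> s < b \<Longrightarrow> g s \<notin> Y \<Longrightarrow> (g has_real_derivative 0) (at s)"
  shows "g a = g b"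
proof (rule antisym)
  show "g a \<le> g b"
    by (rule nondecreasing_if_deriv_nonneg_off_finite[OF cont fin \<open>a \<le> b\<close>]) (use der in auto)
  have "- g a \<le> - g b"
  proof (rule nondecreasing_if_deriv_nonneg_off_finite[where g="\<lambda>s. - g s" and Y="uminus ` Y"])
    fix s assume s: "a < s" "s < b" "- g s \<notin> uminus ` Y"
    then have "((\<lambda>s. - g s) has_real_derivative - 0) (at s)"
      by (intro DERIV_minus der) auto
    then show "\<exists>D\<ge>0. ((\<lambda>s. - g s) has_real_derivative D) (at s)" by auto
  qed (use cont fin \<open>a \<le> b\<close> in \<open>auto intro: continuous_intros\<close>)
  then show "g b \<le> g a" by simp
qed

text \<open>Concavity is only required of the open interval, because the paths below are only known to be
  differentiable there.\<close>

lemma positive_between_if_concave: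
  fixes g :: "real \<Rightarrow> real"
  assumes cont: "continuous_on {0..1} g" and "0 < g 0" "0 < g 1" and s: "0 \<le> s" "s \<le> 1"
    and d1: "\<And>s. 0 < s \<Longrightarrow> s < 1 \<Longrightarrow> (g has_real_derivative g' s) (at s)"
    and d2: "\<And>s. 0 < s \<Longrightarrow> s < 1 \<Longrightarrow> \<exists>D\<le>0. (g' has_real_derivative D) (at s)"
  shows "0 < g s"
proof (rule ccontr)
  assume neg: "\<not> 0 < g s"
  then have s: "0 < s" "s < 1" using assms by (auto simp: less_le)
  obtain p where p: "0 < p" "p < s" "g s - g 0 = (s - 0) * g' p"
    using MVT[of 0 s g] s cont d1
    by (smt (verit, ccfv_SIG) atLeastatMost_subset_iff continuous_on_subset real_differentiable_def DERIV_unique)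
  obtain q where q: "s < q" "q < 1" "g 1 - g s = (1 - s) * g' q"
    using MVT[of s 1 g] s cont d1
    by (smt (verit, ccfv_SIG) atLeastatMost_subset_iff continuous_on_subset real_differentiable_def DERIV_unique)
  have "g' q \<le> g' p"
  proof (rule DERIV_nonpos_imp_nonincreasing[where f = g'])
    fix x assume "p \<le> x" "x \<le> q"
    then show "\<exists>y. (g' has_real_derivative y) (at x) \<and> y \<le> 0" using d2[of x] p q by auto
  qed (use p q in auto)
  moreover have "s * g' p < 0" using p neg assms by simp
  then have "g' p < 0" using s by (simp add: mult_less_0_iff)
  moreover have "0 < (1 - s) * g' q" using q neg assms by simp
  then have "0 < g' q" using s by (simp add: zero_less_mult_iff)
  ultimately show False by simp
qed

lemma concave_on_sin: "concave_on {0..pi} sin"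
  by (rule f''_le0_imp_concave[where f' = cos and f'' = "\<lambda>x. - sin x"])
     (auto intro!: derivative_eq_intros sin_ge_zero)

lemma sin_ge_half_distance_to_ends:
  assumes "0 \<le> t" "t \<le> pi" shows "min t (pi - t) / 2 \<le> sin t"
proof -
  have jordan: "u / 2 \<le> sin u" if u: "0 \<le> u" "u \<le> pi / 2" for u :: real
  proof -
    have "(1 - 2*u/pi) * sin 0 + (2*u/pi) * sin (pi/2) \<le> sin ((1 - 2*u/pi) *\<^sub>R 0 + (2*u/pi) *\<^sub>R (pi/2))"
    proof (rule concave_onD[OF concave_on_sin])
      show "0 \<le> 2*u/pi" "2*u/pi \<le> 1" using u by simp_all
    qed auto
    then have "2*u/pi \<le> sin u" by simp
    moreover have "u/2 \<le> 2*u/pi"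
    proof -
      have "u * pi \<le> u * 4" using u pi_less_4 by (intro mult_left_mono) auto
      then show ?thesis by (simp add: pos_le_divide_eq)
    qed
    ultimately show ?thesis by simp
  qed
  show ?thesis
    using jordan[of t] jordan[of "pi - t"] assms by (cases "t \<le> pi/2") (auto simp: min_def)
qed

lemma sin_powr_integrable:
  assumes h: "h > (-1::real)"
  shows "(\<lambda>t. sin t powr h) integrable_on {0..pi}"
proof (rule measurable_bounded_by_integrable_imp_integrable)
  have i1: "(\<lambda>t. t powr h) integrable_on {0..pi}"
    using integrable_on_powr_from_0[OF h] pi_ge_zero by blast
  then have "(\<lambda>t. (pi - t) powr h) integrable_on {0..pi}"
    using integrable_affinity[of "\<lambda>t. t powr h" 0 pi "-1" pi] by (simp add: image_affinity_atLeastAtMost)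
  with i1 show "(\<lambda>t. 1 + 2 powr (-h) * (t powr h + (pi - t) powr h)) integrable_on {0..pi}"
    by (intro integrable_add integrable_on_mult_right integrable_const_ivl)
  show "(\<lambda>t. sin t powr h) \<in> borel_measurable (lebesgue_on {0..pi})"
    by (intro measurable_restrict_space1) (intro measurable_completion, simp)
  show "{0..pi} \<in> sets lebesgue" by simp
  fix t assume t: "t \<in> {0..pi}"
  show "norm (sin t powr h) \<le> 1 + 2 powr (-h) * (t powr h + (pi - t) powr h)"
  proof (cases "h \<ge> 0 \<or> t = 0 \<or> t = pi")
    case True
    then have "sin t powr h \<le> 1"
      using t by (elim disjE) (simp_all add: powr_le1 sin_ge_zero)
    moreover have "0 \<le> 2 powr (-h) * (t powr h + (pi - t) powr h)" by simp
    ultimately show ?thesis by (simp only: real_norm_def abs_of_nonneg[OF powr_ge_zero])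
  next
    case False
    then have t': "0 < min t (pi - t)" and "h < 0" using t by auto
    have "sin t powr h \<le> (min t (pi - t) / 2) powr h"
      by (rule powr_mono2') (use t t' \<open>h < 0\<close> sin_ge_half_distance_to_ends[of t] in auto)
    also have "\<dots> = 2 powr (-h) * (min t (pi - t)) powr h"
      using t' by (simp add: powr_divide powr_minus divide_simps)
    also have "\<dots> \<le> 2 powr (-h) * (t powr h + (pi - t) powr h)"
      by (intro mult_left_mono) (auto simp: min_def)
    finally show ?thesis by simp
  qed
qed

text \<open>For \<open>h > -1\<close> the singularities of \<open>sin\<^sup>h\<close> at \<open>0\<close> and \<open>\<pi>\<close> are integrable. A primitive
  that is continuous on the whole line can be composed with the expression \<open>(\<pi> + \<theta>\<^sub>1 - \<theta>\<^sub>2 - \<theta>\<^sub>3) / 2\<close> of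
  the hyperbolic case without first locating its value at degenerate triangles.\<close>

lemma sin_powr_primitive_continuous:
  assumes h: "h > (-1::real)"
  obtains F where "continuous_on UNIV F"
    and "\<And>x. 0 < x \<Longrightarrow> x < pi \<Longrightarrow> (F has_real_derivative sin x powr h) (at x)"
proof
  define F0 where "F0 = (\<lambda>x. integral {0..x} (\<lambda>t. sin t powr h))"
  define F where "F = (\<lambda>x. F0 (max 0 (min pi x)))"
  have c0: "continuous_on {0..pi} F0"
    unfolding F0_def by (rule indefinite_integral_continuous_1[OF sin_powr_integrable[OF h]])
  show "continuous_on UNIV F"
    unfolding F_def by (rule continuous_on_compose2[OF c0]) (auto intro!: continuous_intros)
  fix x :: real assume x: "0 < x" "x < pi"
  have "(F0 has_vector_derivative sin x powr h) (at x within {0..pi})"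
    unfolding F0_def using x sin_gt_zero[OF x]
    by (intro integral_has_vector_derivative_continuous_at[where S="{}", simplified] sin_powr_integrable[OF h] continuous_intros) auto
  then have "(F0 has_real_derivative sin x powr h) (at x)"
    using x by (simp add: has_real_derivative_iff_has_vector_derivative at_within_Icc_at)
  moreover have "\<forall>\<^sub>F y in nhds x. F0 y = F y"
    using eventually_nhds_in_open[of "{0<..<pi}" x] x
    by (auto elim!: eventually_mono simp: F_def)
  ultimately show "(F has_real_derivative sin x powr h) (at x)"
    by (metis (mono_tags, lifting) DERIV_cong_ev)
qed

text \<open>The path from \<open>l\<close> to \<open>m\<close> that is straight in the coordinate \<open>U\<close>; it is found by inverting \<open>U\<close>.\<close>

lemma path_with_prescribed_speed:
  fixes U w :: "real \<Rightarrow> real"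
  assumes dU: "\<And>x. x \<in> {min l m..max l m} \<Longrightarrow> (U has_real_derivative w x) (at x)"
    and w: "\<And>x. x \<in> {min l m..max l m} \<Longrightarrow> 0 < w x"
  obtains p where "p 0 = l" "p 1 = m" "continuous_on {0..1} p"
    "\<And>s. s \<in> {0..1} \<Longrightarrow> p s \<in> {min l m..max l m}"
    "\<And>s. 0 < s \<Longrightarrow> s < 1 \<Longrightarrow> (p has_real_derivative (U m - U l) / w (p s)) (at s)"
proof -
  let ?J = "{min l m..max l m}"
  define u where "u s = U l + s * (U m - U l)" for s
  have mono: "U x < U y" if "x \<in> ?J" "y \<in> ?J" "x < y" for x y
  proof (rule DERIV_pos_imp_increasing[OF \<open>x < y\<close>])
    fix z assume "x \<le> z" "z \<le> y"
    then have "z \<in> ?J" using that by auto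
    then show "\<exists>d. (U has_real_derivative d) (at z) \<and> 0 < d" using dU w by blast
  qed
  have inj: "inj_on U ?J"
  proof (rule inj_onI, rule ccontr)
    fix x y assume "x \<in> ?J" "y \<in> ?J" "U x = U y" "x \<noteq> y"
    then show False using mono[of x y] mono[of y x] by linarith
  qed
  have contU: "continuous_on ?J U"
    using dU by (meson DERIV_isCont continuous_at_imp_continuous_on)
  have contI: "continuous_on (U ` ?J) (inv_into ?J U)"
    by (rule continuous_on_inv[OF contU]) (auto simp: inv_into_f_f[OF inj])
  have img: "u s \<in> U ` ?J" if s: "s \<in> {0..1}" for s
  proof -
    have "u s \<in> closed_segment (U l) (U m)"
      using s unfolding in_segment u_def by (intro exI[of _ s]) (auto simp: algebra_simps)
    moreover have "closed_segment (U l) (U m) \<subseteq> U ` ?J"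
    proof (rule closed_segment_subset)
      have "connected (U ` ?J)" by (intro connected_continuous_image contU) auto
      then show "convex (U ` ?J)" by (simp add: is_interval_connected_1 is_interval_convex_1[symmetric])
    qed auto
    ultimately show ?thesis by blast
  qed
  define p where "p = (\<lambda>s. inv_into ?J U (u s))"
  have pJ: "p s \<in> ?J" and Up: "U (p s) = u s" if "s \<in> {0..1}" for s
    unfolding p_def using img[OF that] by (auto intro: inv_into_into f_inv_into_f simp del: atLeastAtMost_iff)
  have contp: "continuous_on {0..1} p"
    unfolding p_def u_def
    by (rule continuous_on_compose2[OF contI]) (use img in \<open>auto simp: u_def intro!: continuous_intros\<close>)
  show ?thesis
  proof
    show "p 0 = l" "p 1 = m" by (simp_all add: p_def u_def inv_into_f_f[OF inj])
    show "continuous_on {0..1} p" by (rule contp)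
    show "p s \<in> ?J" if "s \<in> {0..1}" for s by (rule pJ[OF that])
    fix s :: real assume s: "0 < s" "s < 1"
    show "(p has_real_derivative (U m - U l) / w (p s)) (at s)"
    proof (cases "U m = U l")
      case True
      then have "p s = l" for s by (simp add: p_def u_def inv_into_f_f[OF inj])
      then have "p = (\<lambda>_. l)" by auto
      then show ?thesis using True by simp
    next
      case False
      define V where "V x = (U x - U l) / (U m - U l)" for x
      have "(p has_real_derivative inverse (w (p s) / (U m - U l))) (at s)"
      proof (rule DERIV_inverse_function[where f = V and a = 0 and b = 1])
        show "(V has_real_derivative w (p s) / (U m - U l)) (at (p s))"
          unfolding V_def using False s by (auto intro!: derivative_eq_intros dU pJ simp del: atLeastAtMost_iff, simp)
        show "w (p s) / (U m - U l) \<noteq> 0" using False w[OF pJ, of s] s by auto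
        show "V (p y) = y" if "0 < y" "y < 1" for y
          unfolding V_def using Up[of y] that False by (simp add: u_def)
        show "isCont p s"
          using contp s by (simp add: continuous_on_interior)
      qed (use s in auto)
      then show ?thesis by (simp add: inverse_eq_divide)
    qed
  qed
qed

section \<open>The pair inequality in an abstract geometry\<close>

text \<open>The predicate \<open>nd\<close> holds at the times when the moving triangle is nondegenerate. At all other times
  its angles lie in \<open>Y\<close>, so the weighted sum of the \<open>F (a i s)\<close> lies in a finite set too, and degenerate
  times do no harm to its monotonicity. If the sum has the same value at both ends, it is constant,
  so its derivative vanishes and with it, by \<open>rigid\<close>, the derivative of every angle; for the angles,
  too, the degenerate times only contribute the finitely many values in \<open>Y\<close>.\<close>

lemma weighted_angle_sum_nondecreasing:
  fixes a :: "nat \<Rightarrow> real \<Rightarrow> real" and D :: "real \<Rightarrow> nat \<Rightarrow> real" and v :: "nat \<Rightarrow> real" and F F' :: "real \<Rightarrow> real"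
  assumes N: "finite N" and Y: "finite Y"
    and cont_a: "\<And>i. i \<in> N \<Longrightarrow> continuous_on {0..1} (a i)"
    and cont_F: "\<And>i. i \<in> N \<Longrightarrow> continuous_on {0..1} (\<lambda>s. F (a i s))"
    and deg: "\<And>s i. s \<in> {0<..<1} \<Longrightarrow> \<not> nd s \<Longrightarrow> i \<in> N \<Longrightarrow> a i s \<in> Y"
    and dF: "\<And>s i. s \<in> {0<..<1} \<Longrightarrow> nd s \<Longrightarrow> i \<in> N \<Longrightarrow> (F has_real_derivative F' (a i s)) (at (a i s))"
    and da: "\<And>s i. s \<in> {0<..<1} \<Longrightarrow> nd s \<Longrightarrow> i \<in> N \<Longrightarrow> (a i has_real_derivative D s i) (at s)"
    and nonneg: "\<And>s. s \<in> {0<..<1} \<Longrightarrow> nd s \<Longrightarrow> 0 \<le> (\<Sum>i\<in>N. v i * (F' (a i s) * D s i))"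
    and rigid: "\<And>s i. s \<in> {0<..<1} \<Longrightarrow> nd s \<Longrightarrow> (\<Sum>i\<in>N. v i * (F' (a i s) * D s i)) = 0 \<Longrightarrow> i \<in> N \<Longrightarrow> D s i = 0"
  shows "(\<Sum>i\<in>N. v i * F (a i 0)) \<le> (\<Sum>i\<in>N. v i * F (a i 1))"
    and "(\<Sum>i\<in>N. v i * F (a i 0)) = (\<Sum>i\<in>N. v i * F (a i 1)) \<Longrightarrow> i \<in> N \<Longrightarrow> a i 0 = a i 1"
proof -
  define g where "g s = (\<Sum>i\<in>N. v i * F (a i s))" for s
  define Z where "Z = (\<lambda>y. \<Sum>i\<in>N. v i * F (y i)) ` (Pi\<^sub>E N (\<lambda>_. Y))"
  have Z: "finite Z" unfolding Z_def by (intro finite_imageI finite_PiE N Y)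
  have degZ: "g s \<in> Z" if "s \<in> {0<..<1}" "\<not> nd s" for s
  proof -
    have "g s = (\<Sum>i\<in>N. v i * F (restrict (\<lambda>i. a i s) N i))"
      unfolding g_def by (intro sum.cong) auto
    moreover have "restrict (\<lambda>i. a i s) N \<in> Pi\<^sub>E N (\<lambda>_. Y)" using deg[OF that] by auto
    ultimately show ?thesis unfolding Z_def by blast
  qed
  have cont_g: "continuous_on {0..1} g"
    unfolding g_def by (intro continuous_intros cont_F)
  have dg: "(g has_real_derivative (\<Sum>i\<in>N. v i * (F' (a i s) * D s i))) (at s)"
    if "s \<in> {0<..<1}" "nd s" for s
    unfolding g_def
    by (rule DERIV_sum, rule DERIV_cmult, rule DERIV_chain2[OF dF da]) (use that in auto)
  have mono: "g s \<le> g t" if "0 \<le> s" "s \<le> t" "t \<le> 1" for s t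
  proof (rule nondecreasing_if_deriv_nonneg_off_finite[OF _ Z \<open>s \<le> t\<close>])
    show "continuous_on {s..t} g" using cont_g by (rule continuous_on_subset) (use that in auto)
    fix r assume r: "s < r" "r < t" "g r \<notin> Z"
    then have "r \<in> {0<..<1}" "nd r" using degZ[of r] that by auto
    then show "\<exists>D\<ge>0. (g has_real_derivative D) (at r)" using dg nonneg by blast
  qed
  show "(\<Sum>i\<in>N. v i * F (a i 0)) \<le> (\<Sum>i\<in>N. v i * F (a i 1))"
    using mono[of 0 1] by (simp add: g_def)
  assume eq: "(\<Sum>i\<in>N. v i * F (a i 0)) = (\<Sum>i\<in>N. v i * F (a i 1))" and i: "i \<in> N"
  then have "g 0 = g 1" by (simp add: g_def)
  then have g_const: "g s = g 0" if "s \<in> {0..1}" for s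
    using mono[of 0 s] mono[of s 1] that by auto
  show "a i 0 = a i 1"
  proof (rule constant_if_deriv_zero_off_finite[OF cont_a[OF i] Y])
    fix s :: real assume s: "0 < s" "s < 1" "a i s \<notin> Y"
    then have nd: "nd s" and s': "s \<in> {0<..<1}" using deg i by auto
    have "\<forall>\<^sub>F r in nhds s. g r = g 0"
      using eventually_nhds_in_open[OF open_greaterThanLessThan s'] by eventually_elim (auto intro: g_const)
    then have "(g has_real_derivative 0) (at s) \<longleftrightarrow> ((\<lambda>_. g 0) has_real_derivative 0) (at s)"
      by (intro DERIV_cong_ev refl)
    then have "(g has_real_derivative 0) (at s)" by simp
    then have "(\<Sum>i\<in>N. v i * (F' (a i s) * D s i)) = 0"
      using DERIV_unique[OF dg[OF s' nd]] by blast
    then show "(a i has_real_derivative 0) (at s)"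
      using da[OF s' nd i] rigid[OF s' nd _ i] by simp
  qed simp
qed

text \<open>The \<open>\<theta>\<^sub>i\<close> are the angles of a moving triangle with sides \<open>l\<^sub>i\<close>, and \<open>z\<^sub>i\<close> stands for \<open>l\<^sub>i' / \<sigma> l\<^sub>i\<close>. As
  \<open>l\<^sub>i'\<close> determines the \<open>\<theta>\<^sub>i'\<close> linearly, this says that a quadratic form in the \<open>l\<^sub>i'\<close> is positive
  semidefinite, and that only variations that preserve all angles lie in its kernel.\<close>

definition positive_variation ::
    "(real \<Rightarrow> real) \<Rightarrow> (real \<Rightarrow> real) \<Rightarrow> (real \<Rightarrow> real) \<Rightarrow> real \<Rightarrow> real \<Rightarrow> real \<Rightarrow> real \<Rightarrow> bool" where
  "positive_variation \<theta>1 \<theta>2 \<theta>3 z1 z2 z3 s \<longleftrightarrow> (\<exists>D1 D2 D3. (\<theta>1 has_real_derivative D1) (at s) \<and>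
     (\<theta>2 has_real_derivative D2) (at s) \<and> (\<theta>3 has_real_derivative D3) (at s) \<and>
     0 \<le> z1 * D1 + z2 * D2 + z3 * D3 \<and> (z1 * D1 + z2 * D2 + z3 * D3 = 0 \<longrightarrow> D1 = 0 \<and> D2 = 0 \<and> D3 = 0))"

text \<open>The common frame of the three geometries. Sides range over \<open>I\<close>; \<open>ang x y z\<close> is the angle (or, in
  hyperbolic geometry, the combination of angles) attached to the side \<open>x\<close>, extended to
  triples of sides that bound no triangle; \<open>nd\<close> singles out the nondegenerate triangles, and \<open>Y\<close> collects
  the angles of the others. The function \<open>\<sigma>\<close> is the one for which the law of sines holds; this law and
  \<open>variation\<close> carry the argument.\<close>

locale triangle_geometry =
  fixes I :: "real set" and \<sigma> :: "real \<Rightarrow> real" and ang :: "real \<Rightarrow> real \<Rightarrow> real \<Rightarrow> real"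
    and nd :: "real \<Rightarrow> real \<Rightarrow> real \<Rightarrow> bool" and Y :: "real set"
  assumes interval_I: "is_interval I"
    and \<sigma>_pos: "x \<in> I \<Longrightarrow> 0 < \<sigma> x"
    and finite_Y: "finite Y"
    and ang_cont: "\<lbrakk>continuous_on {0..1} p; continuous_on {0..1} q; continuous_on {0..1} r;
        p ` {0..1} \<subseteq> I; q ` {0..1} \<subseteq> I; r ` {0..1} \<subseteq> I\<rbrakk> \<Longrightarrow>
        continuous_on {0..1} (\<lambda>s. ang (p s) (q s) (r s))"
    and nd_cyclic: "nd x y z \<Longrightarrow> nd y z x"
    and ang_degenerate: "\<lbrakk>x \<in> I; y \<in> I; z \<in> I; \<not> nd x y z\<rbrakk> \<Longrightarrow> ang x y z \<in> Y"
    and ang_range: "\<lbrakk>x \<in> I; y \<in> I; z \<in> I; nd x y z\<rbrakk> \<Longrightarrow> 0 < ang x y z \<and> ang x y z < pi"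
    and sine_law: "\<lbrakk>x \<in> I; y \<in> I; z \<in> I; nd x y z\<rbrakk> \<Longrightarrow>
        \<exists>c>0. sin (ang x y z) = c * \<sigma> x \<and> sin (ang y z x) = c * \<sigma> y \<and> sin (ang z x y) = c * \<sigma> z"
    and variation: "\<lbrakk>(p has_real_derivative p') (at s); (q has_real_derivative q') (at s); (r has_real_derivative r') (at s);
        p s \<in> I; q s \<in> I; r s \<in> I; nd (p s) (q s) (r s)\<rbrakk> \<Longrightarrow>
        positive_variation (\<lambda>s. ang (p s) (q s) (r s)) (\<lambda>s. ang (q s) (r s) (p s)) (\<lambda>s. ang (r s) (p s) (q s))
          (p' / \<sigma> (p s)) (q' / \<sigma> (q s)) (r' / \<sigma> (r s)) s"
begin

text \<open>Convexity of the set of nondegenerate triangles in the coordinates \<open>U x\<close> with \<open>U' = \<sigma>\<^bsup>-h-1\<^esup>\<close>, spelled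
  out for the paths along which these coordinates change at the constant rates \<open>v i\<close>.\<close>

definition straight_paths_nondegenerate :: "real \<Rightarrow> bool" where
  "straight_paths_nondegenerate h \<longleftrightarrow> (\<forall>x v.
     (\<forall>i. continuous_on {0..1} (x i) \<and> x i ` {0..1} \<subseteq> I) \<and>
     (\<forall>i. \<forall>s\<in>{0<..<1}. (x i has_real_derivative v i / \<sigma> (x i s) powr (-h-1)) (at s)) \<and>
     nd (x 0 0) (x (1::nat) 0) (x 2 0) \<and> nd (x 0 1) (x 1 1) (x 2 1) \<longrightarrow>
     (\<forall>s\<in>{0..1}. nd (x 0 s) (x 1 s) (x 2 s)))"

text \<open>Move from one triangle to the other along the path that is straight in the coordinates \<open>U\<close>, so that
  \<open>l\<^sub>i' = v\<^sub>i \<sigma>(l\<^sub>i)\<^bsup>h+1\<^esup>\<close> with \<open>v\<^sub>i\<close> the difference of the end values of \<open>U\<close>. With \<open>sin a\<^sub>i = c \<sigma>(l\<^sub>i)\<close> the sum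
  \<open>\<Sum> v\<^sub>i F(a\<^sub>i)\<close> has the derivative \<open>\<Sum> v\<^sub>i sin\<^sup>h a\<^sub>i a\<^sub>i' = c\<^sup>h \<Sum> (l\<^sub>i' / \<sigma>(l\<^sub>i)) a\<^sub>i'\<close>: the exponent \<open>h\<close> has
  disappeared from the quadratic form, which is nonnegative by \<open>variation\<close>. The path may run through
  degenerate triangles. This is harmless if \<open>F\<close> extends continuously to their angles, which is the
  case for \<open>h > -1\<close>, and is excluded by assumption otherwise.\<close>

theorem pair_inequality:
  fixes U F :: "real \<Rightarrow> real"
  assumes dU: "\<And>x. x \<in> I \<Longrightarrow> (U has_real_derivative \<sigma> x powr (-h-1)) (at x)"
    and dF: "\<And>t. 0 < t \<Longrightarrow> t < pi \<Longrightarrow> (F has_real_derivative sin t powr h) (at t)"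
    and h: "h > -1 \<or> straight_paths_nondegenerate h"
    and l: "x \<in> I" "y \<in> I" "z \<in> I" "nd x y z"
    and m: "x' \<in> I" "y' \<in> I" "z' \<in> I" "nd x' y' z'"
  defines "S \<equiv> (U x' - U x) * (F (ang x' y' z') - F (ang x y z))
             + (U y' - U y) * (F (ang y' z' x') - F (ang y z x))
             + (U z' - U z) * (F (ang z' x' y') - F (ang z x y))"
  shows "0 \<le> S" and "S = 0 \<Longrightarrow> ang x y z = ang x' y' z' \<and> ang y z x = ang y' z' x' \<and> ang z x y = ang z' x' y'"
proof -
  have seg: "w \<in> I" if "u \<in> I" "u' \<in> I" "w \<in> {min u u'..max u u'}" for u u' w
    using mem_is_interval_1_I[OF interval_I, of "min u u'" "max u u'" w] that
    by (simp add: min_def max_def split: if_splits)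
  have path: "\<exists>p. p 0 = u \<and> p 1 = u' \<and> continuous_on {0..1} p \<and> p ` {0..1} \<subseteq> I \<and>
      (\<forall>s\<in>{0<..<1}. (p has_real_derivative (U u' - U u) / \<sigma> (p s) powr (-h-1)) (at s))"
    if u: "u \<in> I" "u' \<in> I" for u u'
  proof (rule path_with_prescribed_speed[of u u' U "\<lambda>x. \<sigma> x powr (-h-1)"])
    fix w assume "w \<in> {min u u'..max u u'}"
    then have "w \<in> I" using seg u by blast
    then show "(U has_real_derivative \<sigma> w powr (-h-1)) (at w)" "0 < \<sigma> w powr (-h-1)"
      using dU \<sigma>_pos[of w] by auto
  next
    fix p assume p: "p 0 = u" "p 1 = u'" "continuous_on {0..1} p"
      "\<And>s. s \<in> {0..1} \<Longrightarrow> p s \<in> {min u u'..max u u'}"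
      "\<And>s. 0 < s \<Longrightarrow> s < 1 \<Longrightarrow> (p has_real_derivative (U u' - U u) / \<sigma> (p s) powr (-h-1)) (at s)"
    have "p ` {0..1} \<subseteq> I" using seg[OF u p(4)] by blast
    then show ?thesis using p by (intro exI[of _ p]) auto
  qed
  define src dst where "src i = (if i = 0 then x else if i = 1 then y else z)"
    and "dst i = (if i = 0 then x' else if i = 1 then y' else z')" for i :: nat
  have ft: "src i \<in> I" "dst i \<in> I" for i using l m by (auto simp: src_def dst_def)
  define v where "v i = U (dst i) - U (src i)" for i
  have "\<forall>i. \<exists>p. p 0 = src i \<and> p 1 = dst i \<and> continuous_on {0..1} p \<and> p ` {0..1} \<subseteq> I \<and>
      (\<forall>s\<in>{0<..<1}. (p has_real_derivative v i / \<sigma> (p s) powr (-h-1)) (at s))"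
    unfolding v_def by (intro allI path ft)
  then obtain p where p: "\<forall>i. p i 0 = src i \<and> p i 1 = dst i \<and> continuous_on {0..1} (p i) \<and> p i ` {0..1} \<subseteq> I \<and>
      (\<forall>s\<in>{0<..<1}. (p i has_real_derivative v i / \<sigma> (p i s) powr (-h-1)) (at s))"
    by (rule choice[THEN exE])
  then have p0: "p i 0 = src i" and p1: "p i 1 = dst i"
    and contp: "continuous_on {0..1} (p i)" and pI: "p i ` {0..1} \<subseteq> I"
    and dp: "s \<in> {0<..<1} \<Longrightarrow> (p i has_real_derivative v i / \<sigma> (p i s) powr (-h-1)) (at s)" for i s
    by blast+
  define a where "a i s = (if i = 0 then ang (p 0 s) (p 1 s) (p 2 s)
     else if i = 1 then ang (p 1 s) (p 2 s) (p 0 s) else ang (p 2 s) (p 0 s) (p 1 s))" for i :: nat and s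
  have a012: "a 0 = (\<lambda>s. ang (p 0 s) (p 1 s) (p 2 s))" "a 1 = (\<lambda>s. ang (p 1 s) (p 2 s) (p 0 s))"
      "a 2 = (\<lambda>s. ang (p 2 s) (p 0 s) (p 1 s))" by (auto simp: a_def)
  define ndp where "ndp s = nd (p 0 s) (p 1 s) (p 2 s)" for s
  define N :: "nat set" where "N = {0, 1, 2}"
  have pI': "p i s \<in> I" if "s \<in> {0..1}" for i s using pI that by blast
  have rot: "nd x y z \<longleftrightarrow> nd y z x" for x y z using nd_cyclic by blast
  have range: "0 < a i s \<and> a i s < pi" if "s \<in> {0..1}" "ndp s" for i s
    using that(2) rot[of "p 0 s" "p 1 s" "p 2 s"] rot[of "p 1 s" "p 2 s" "p 0 s"] ang_range[OF pI'[OF that(1), of 0] pI'[OF that(1), of 1] pI'[OF that(1), of 2]]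
      ang_range[OF pI'[OF that(1), of 1] pI'[OF that(1), of 2] pI'[OF that(1), of 0]]
      ang_range[OF pI'[OF that(1), of 2] pI'[OF that(1), of 0] pI'[OF that(1), of 1]]
    unfolding a_def ndp_def by (cases "i = 0"; cases "i = 1") simp_all
  have deg: "a i s \<in> Y" if "s \<in> {0..1}" "\<not> ndp s" for i s
    using that(2) rot[of "p 0 s" "p 1 s" "p 2 s"] rot[of "p 1 s" "p 2 s" "p 0 s"] ang_degenerate[OF pI'[OF that(1), of 0] pI'[OF that(1), of 1] pI'[OF that(1), of 2]]
      ang_degenerate[OF pI'[OF that(1), of 1] pI'[OF that(1), of 2] pI'[OF that(1), of 0]]
      ang_degenerate[OF pI'[OF that(1), of 2] pI'[OF that(1), of 0] pI'[OF that(1), of 1]]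
    unfolding a_def ndp_def by (cases "i = 0"; cases "i = 1") simp_all
  have conta: "continuous_on {0..1} (a i)" for i
  proof -
    consider "a i = (\<lambda>s. ang (p 0 s) (p 1 s) (p 2 s))" | "a i = (\<lambda>s. ang (p 1 s) (p 2 s) (p 0 s))"
      | "a i = (\<lambda>s. ang (p 2 s) (p 0 s) (p 1 s))" unfolding a_def by (cases "i = 0"; cases "i = 1") auto
    then show ?thesis by cases (simp_all add: ang_cont contp pI)
  qed
  \<comment> \<open>\<open>G\<close> differs from \<open>F\<close> by a constant on \<open>(0, \<pi>)\<close>, but is continuous along the whole path\<close>
  obtain G where dG: "\<And>t. 0 < t \<Longrightarrow> t < pi \<Longrightarrow> (G has_real_derivative sin t powr h) (at t)"
    and contG: "\<And>i. continuous_on {0..1} (\<lambda>s. G (a i s))"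
    using h
  proof
    assume "h > -1"
    then obtain G where G: "continuous_on UNIV G" "\<And>t. 0 < t \<Longrightarrow> t < pi \<Longrightarrow> (G has_real_derivative sin t powr h) (at t)"
      using sin_powr_primitive_continuous by blast
    then show ?thesis
      using that[of G] continuous_on_compose2[OF G(1) conta] by auto
  next
    assume "straight_paths_nondegenerate h"
    note straight = this[unfolded straight_paths_nondegenerate_def, THEN spec, THEN spec, THEN mp]
    have "\<forall>s\<in>{0..1}. ndp s"
      unfolding ndp_def
    proof (rule straight[of p v], intro conjI allI ballI contp pI dp)
      show "nd (p 0 0) (p 1 0) (p 2 0)" "nd (p 0 1) (p 1 1) (p 2 1)"
        using l m by (simp_all add: p0 p1 src_def dst_def)
    qed
    then have img: "a i ` {0..1} \<subseteq> {0<..<pi}" for i using range by fastforce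
    have "continuous_on {0<..<pi} F"
      by (intro continuous_at_imp_continuous_on ballI, rule DERIV_isCont[OF dF]) auto
    then have "continuous_on {0..1} (\<lambda>s. F (a i s))" for i
      by (rule continuous_on_compose2[OF _ conta img])
    with dF show ?thesis by (rule that)
  qed
  have "((\<lambda>t. F t - G t) has_real_derivative 0) (at t within {0<..<pi})" if "t \<in> {0<..<pi}" for t
    using DERIV_diff[OF dF dG, of t] that by (auto intro: has_field_derivative_at_within)
  then have "\<exists>c. \<forall>t\<in>{0<..<pi}. F t - G t = c"
    by (intro has_field_derivative_zero_constant) auto
  then have FG: "F t - F t' = G t - G t'" if "0 < t" "t < pi" "0 < t'" "t' < pi" for t t'
    using that by (smt (verit) greaterThanLessThan_iff)
  have "\<exists>D. (\<forall>i\<in>N. (a i has_real_derivative D i) (at s)) \<and>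
      0 \<le> (\<Sum>i\<in>N. v i * (sin (a i s) powr h * D i)) \<and>
      ((\<Sum>i\<in>N. v i * (sin (a i s) powr h * D i)) = 0 \<longrightarrow> (\<forall>i\<in>N. D i = 0))"
    if s: "s \<in> {0<..<1}" and nds: "ndp s" for s
  proof -
    have pIs: "p i s \<in> I" for i using pI' s by auto
    obtain c where c: "c > 0" "sin (a 0 s) = c * \<sigma> (p 0 s)" "sin (a 1 s) = c * \<sigma> (p 1 s)"
        "sin (a 2 s) = c * \<sigma> (p 2 s)"
      using sine_law[OF pIs pIs pIs nds[unfolded ndp_def]] unfolding a012 by blast
    define p' where "p' i = v i / \<sigma> (p i s) powr (-h-1)" for i
    obtain D1 D2 D3 where D: "(a 0 has_real_derivative D1) (at s)" "(a 1 has_real_derivative D2) (at s)"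
        "(a 2 has_real_derivative D3) (at s)"
        "0 \<le> p' 0 / \<sigma> (p 0 s) * D1 + p' 1 / \<sigma> (p 1 s) * D2 + p' 2 / \<sigma> (p 2 s) * D3"
        "p' 0 / \<sigma> (p 0 s) * D1 + p' 1 / \<sigma> (p 1 s) * D2 + p' 2 / \<sigma> (p 2 s) * D3 = 0 \<Longrightarrow>
          D1 = 0 \<and> D2 = 0 \<and> D3 = 0"
      using variation[OF dp[OF s, of 0] dp[OF s, of 1] dp[OF s, of 2] pIs pIs pIs nds[unfolded ndp_def]]
      unfolding a012 p'_def positive_variation_def by blast
    have v: "v i * ((c * \<sigma> (p i s)) powr h * E) = c powr h * (p' i / \<sigma> (p i s) * E)" for i E
    proof -
      have pos: "\<sigma> (p i s) > 0" using \<sigma>_pos pIs by blast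
      have "\<sigma> (p i s) powr h = 1 / \<sigma> (p i s) powr (-h-1) / \<sigma> (p i s)"
        using pos by (simp add: powr_diff powr_minus divide_simps)
      then show ?thesis
        using pos c(1) by (simp add: p'_def powr_mult)
    qed
    define D where "D i = (if i = 0 then D1 else if i = 1 then D2 else D3)" for i :: nat
    have sum: "(\<Sum>i\<in>N. v i * (sin (a i s) powr h * D i)) =
        c powr h * (p' 0 / \<sigma> (p 0 s) * D1 + p' 1 / \<sigma> (p 1 s) * D2 + p' 2 / \<sigma> (p 2 s) * D3)"
      by (simp add: N_def c v D_def distrib_left del: One_nat_def)
    have cpos: "c powr h > 0" using c by simp
    have "\<forall>i\<in>N. (a i has_real_derivative D i) (at s)"
      using D(1-3) by (simp add: D_def N_def)
    moreover have "0 \<le> (\<Sum>i\<in>N. v i * (sin (a i s) powr h * D i))"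
      unfolding sum using cpos D(4) by (intro mult_nonneg_nonneg) simp_all
    moreover have "\<forall>i\<in>N. D i = 0" if "(\<Sum>i\<in>N. v i * (sin (a i s) powr h * D i)) = 0"
      using that cpos D(5) unfolding sum by (simp add: D_def)
    ultimately show ?thesis by blast
  qed
  then have "\<forall>s. \<exists>D. s \<in> {0<..<1} \<longrightarrow> ndp s \<longrightarrow> (\<forall>i\<in>N. (a i has_real_derivative D i) (at s)) \<and>
      0 \<le> (\<Sum>i\<in>N. v i * (sin (a i s) powr h * D i)) \<and>
      ((\<Sum>i\<in>N. v i * (sin (a i s) powr h * D i)) = 0 \<longrightarrow> (\<forall>i\<in>N. D i = 0))" by blast
  then obtain D where "\<forall>s. s \<in> {0<..<1} \<longrightarrow> ndp s \<longrightarrow> (\<forall>i\<in>N. (a i has_real_derivative D s i) (at s)) \<and>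
      0 \<le> (\<Sum>i\<in>N. v i * (sin (a i s) powr h * D s i)) \<and>
      ((\<Sum>i\<in>N. v i * (sin (a i s) powr h * D s i)) = 0 \<longrightarrow> (\<forall>i\<in>N. D s i = 0))"
    by (rule choice[THEN exE])
  then have D: "s \<in> {0<..<1} \<Longrightarrow> ndp s \<Longrightarrow> i \<in> N \<Longrightarrow> (a i has_real_derivative D s i) (at s)"
     "s \<in> {0<..<1} \<Longrightarrow> ndp s \<Longrightarrow> 0 \<le> (\<Sum>i\<in>N. v i * (sin (a i s) powr h * D s i))"
     "s \<in> {0<..<1} \<Longrightarrow> ndp s \<Longrightarrow> (\<Sum>i\<in>N. v i * (sin (a i s) powr h * D s i)) = 0 \<Longrightarrow> i \<in> N \<Longrightarrow> D s i = 0" for s i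
    by blast+
  note mono = weighted_angle_sum_nondecreasing[where N=N and Y=Y and a=a and F=G and nd=ndp
      and F'="\<lambda>t. sin t powr h" and D=D and v=v]
  have dGa: "(G has_real_derivative sin (a i s) powr h) (at (a i s))" if "s \<in> {0<..<1}" "ndp s" for i s
    using range[of s i] that by (intro dG) auto
  have fN: "finite N" by (simp add: N_def)
  have degN: "\<And>s i. s \<in> {0<..<1} \<Longrightarrow> \<not> ndp s \<Longrightarrow> i \<in> N \<Longrightarrow> a i s \<in> Y" using deg by auto
  have nd01: "ndp 0" "ndp 1" using l m by (auto simp: ndp_def p0 p1 src_def dst_def)
  have ends: "a 0 0 = ang x y z" "a 1 0 = ang y z x" "a 2 0 = ang z x y"
     "a 0 1 = ang x' y' z'" "a 1 1 = ang y' z' x'" "a 2 1 = ang z' x' y'"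
    by (simp_all add: a_def p0 p1 src_def dst_def)
  have diff: "F (a i 1) - F (a i 0) = G (a i 1) - G (a i 0)" for i
    using range[of 0 i] range[of 1 i] nd01 by (intro FG) auto
  have S: "S = (\<Sum>i\<in>N. v i * G (a i 1)) - (\<Sum>i\<in>N. v i * G (a i 0))"
    unfolding S_def diff[of 0, unfolded ends] diff[of 1, unfolded ends] diff[of 2, unfolded ends]
    by (simp add: N_def v_def ends src_def dst_def algebra_simps del: One_nat_def)
  have "(\<Sum>i\<in>N. v i * G (a i 0)) \<le> (\<Sum>i\<in>N. v i * G (a i 1))"
    by (rule mono(1)[OF fN finite_Y conta contG degN dGa D]) assumption+
  then show "0 \<le> S" unfolding S by linarith
  assume "S = 0"
  then have eq: "(\<Sum>i\<in>N. v i * G (a i 0)) = (\<Sum>i\<in>N. v i * G (a i 1))" unfolding S by linarith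
  have "a i 0 = a i 1" if "i \<in> N" for i
    by (rule mono(2)[OF fN finite_Y conta contG degN dGa D eq that]) assumption+
  then show "ang x y z = ang x' y' z' \<and> ang y z x = ang y' z' x' \<and> ang z x y = ang z' x' y'"
    unfolding ends[symmetric] by (simp add: N_def del: One_nat_def)
qed

definition pair_rigid :: "(real \<Rightarrow> real) \<Rightarrow> (real \<Rightarrow> real) \<Rightarrow> bool" where
  "pair_rigid U F \<longleftrightarrow> (\<forall>x y z x' y' z'.
     x \<in> I \<and> y \<in> I \<and> z \<in> I \<and> nd x y z \<and> x' \<in> I \<and> y' \<in> I \<and> z' \<in> I \<and> nd x' y' z' \<longrightarrow>
     (let S = (U x' - U x) * (F (ang x' y' z') - F (ang x y z))
             + (U y' - U y) * (F (ang y' z' x') - F (ang y z x))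
             + (U z' - U z) * (F (ang z' x' y') - F (ang z x y))
      in 0 \<le> S \<and> (S = 0 \<longrightarrow> ang x y z = ang x' y' z' \<and> ang y z x = ang y' z' x' \<and> ang z x y = ang z' x' y')))"

lemma pair_rigidI:
  assumes dU: "\<And>x. x \<in> I \<Longrightarrow> (U has_real_derivative \<sigma> x powr (-h-1)) (at x)"
    and dF: "\<And>t. 0 < t \<Longrightarrow> t < pi \<Longrightarrow> (F has_real_derivative sin t powr h) (at t)"
    and h: "h > -1 \<or> straight_paths_nondegenerate h"
  shows "pair_rigid U F"
  unfolding pair_rigid_def Let_def
proof (intro allI impI, elim conjE)
  fix x y z x' y' z'
  assume l: "x \<in> I" "y \<in> I" "z \<in> I" "nd x y z" and m: "x' \<in> I" "y' \<in> I" "z' \<in> I" "nd x' y' z'"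
  note P = pair_inequality[OF dU dF h l m]
  show "0 \<le> (U x' - U x) * (F (ang x' y' z') - F (ang x y z))
             + (U y' - U y) * (F (ang y' z' x') - F (ang y z x))
             + (U z' - U z) * (F (ang z' x' y') - F (ang z x y)) \<and>
    ((U x' - U x) * (F (ang x' y' z') - F (ang x y z))
             + (U y' - U y) * (F (ang y' z' x') - F (ang y z x))
             + (U z' - U z) * (F (ang z' x' y') - F (ang z x y)) = 0 \<longrightarrow>
     ang x y z = ang x' y' z' \<and> ang y z x = ang y' z' x' \<and> ang z x y = ang z' x' y')"
    by (intro conjI[OF P(1)] impI P(2))
qed

end

section \<open>Angles extended to degenerate triangles\<close>

text \<open>The law of cosines yields a value outside \<open>[-1, 1]\<close> when the sides violate a triangle inequality.
  Clamping assigns the angles \<open>0\<close> and \<open>\<pi>\<close> to such sides and keeps the angles continuous.\<close>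

definition carc :: "real \<Rightarrow> real" where
  "carc u = arccos (max (-1) (min 1 u))"

lemma carc_eq_arccos: "\<bar>u\<bar> \<le> 1 \<Longrightarrow> carc u = arccos u"
  by (auto simp: carc_def abs_le_iff)

lemma carc_bounds: "\<bar>u\<bar> < 1 \<Longrightarrow> 0 < carc u \<and> carc u < pi"
  using arccos_lt_bounded[of u] by (auto simp: carc_eq_arccos abs_less_iff)

lemma cos_carc: "\<bar>u\<bar> \<le> 1 \<Longrightarrow> cos (carc u) = u"
  by (simp add: carc_eq_arccos cos_arccos_abs)

lemma sin_carc: "\<bar>u\<bar> \<le> 1 \<Longrightarrow> sin (carc u) = sqrt (1 - u\<^sup>2)"
  by (simp add: carc_eq_arccos sin_arccos_abs)

lemma carc_degenerate: "\<not> \<bar>u\<bar> < 1 \<Longrightarrow> carc u \<in> {0, pi}"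
  by (auto simp: carc_def abs_less_iff min_def max_def)

lemma continuous_on_carc: "continuous_on S f \<Longrightarrow> continuous_on S (\<lambda>x. carc (f x))"
  unfolding carc_def by (intro continuous_intros) auto

lemma DERIV_carc:
  assumes "(f has_real_derivative D) (at s)" and "\<bar>f s\<bar> < 1"
  shows "((\<lambda>s. carc (f s)) has_real_derivative - D / sin (carc (f s))) (at s)"
proof -
  have "(arccos has_real_derivative inverse (- sqrt (1 - (f s)\<^sup>2))) (at (f s))"
    using assms(2) by (intro DERIV_arccos) auto
  moreover have "\<forall>\<^sub>F u in nhds (f s). carc u = arccos u"
    using eventually_nhds_in_open[of "{-1<..<1}" "f s"] assms(2)
    by (auto elim!: eventually_mono intro!: carc_eq_arccos simp: abs_less_iff)
  ultimately have "(carc has_real_derivative inverse (- sqrt (1 - (f s)\<^sup>2))) (at (f s))"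
    using DERIV_cong_ev[of "f s" "f s" carc arccos] by blast
  from DERIV_chain2[OF this assms(1)] show ?thesis
    using assms(2) by (simp add: sin_carc divide_inverse mult.commute)
qed

lemma abs_quotient_less_1:
  fixes n d :: real
  assumes "0 < d"
  shows "\<bar>n / d\<bar> < 1 \<longleftrightarrow> 0 < d\<^sup>2 - n\<^sup>2" and "\<bar>n / d\<bar> < 1 \<Longrightarrow> sqrt (1 - (n/d)\<^sup>2) = sqrt (d\<^sup>2 - n\<^sup>2) / d"
proof -
  have "\<bar>n / d\<bar> < 1 \<longleftrightarrow> \<bar>n\<bar> < \<bar>d\<bar>" using assms by (simp add: abs_divide)
  also have "\<dots> \<longleftrightarrow> 0 < d\<^sup>2 - n\<^sup>2" using abs_le_square_iff[of d n] by linarith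
  finally show "\<bar>n / d\<bar> < 1 \<longleftrightarrow> 0 < d\<^sup>2 - n\<^sup>2" .
  have "1 - (n/d)\<^sup>2 = (d\<^sup>2 - n\<^sup>2) / d\<^sup>2" using assms by (simp add: power_divide diff_divide_distrib)
  then show "sqrt (1 - (n/d)\<^sup>2) = sqrt (d\<^sup>2 - n\<^sup>2) / d" using assms by (simp add: real_sqrt_divide)
qed

section \<open>Variation of the angles: Euclidean triangles\<close>

text \<open>The quadratic form of the matrix with diagonal entries \<open>1\<close> and off-diagonal entries \<open>-c\<^sub>i\<close>, whose
  determinant is the quantity in \<open>gram\<close>: split off the square of the first linear form, then complete
  the square in the remaining binary form after multiplying it by \<open>1 - c3\<^sup>2\<close>.\<close>

lemma angle_form_nonneg:
  fixes c1 c2 c3 X Y Z :: real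
  assumes "\<bar>c2\<bar> < 1" "\<bar>c3\<bar> < 1" and gram: "0 \<le> 1 - c1\<^sup>2 - c2\<^sup>2 - c3\<^sup>2 - 2*c1*c2*c3"
  defines "Q \<equiv> X*(X - c3*Y - c2*Z) + Y*(Y - c1*Z - c3*X) + Z*(Z - c2*X - c1*Y)"
  shows "0 \<le> Q" and "Q = 0 \<Longrightarrow> X - c3*Y - c2*Z = 0"
proof -
  have s: "0 < 1 - c3\<^sup>2" using assms(2) by (simp add: abs_square_less_1)
  define k where "k = c1 + c2*c3"
  have "Q = (X - c3*Y - c2*Z)\<^sup>2 + ((1 - c3\<^sup>2)*Y\<^sup>2 + (1 - c2\<^sup>2)*Z\<^sup>2 - 2*k*Y*Z)"
    unfolding Q_def k_def by algebra
  moreover have "0 \<le> (1 - c3\<^sup>2)*Y\<^sup>2 + (1 - c2\<^sup>2)*Z\<^sup>2 - 2*k*Y*Z" (is "0 \<le> ?R")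
  proof -
    have "(1 - c3\<^sup>2) * ?R = ((1 - c3\<^sup>2)*Y - k*Z)\<^sup>2 + (1 - c1\<^sup>2 - c2\<^sup>2 - c3\<^sup>2 - 2*c1*c2*c3) * Z\<^sup>2"
      unfolding k_def by algebra
    also have "\<dots> \<ge> 0" using gram by simp
    finally show ?thesis using s by (simp add: zero_le_mult_iff)
  qed
  ultimately show "0 \<le> Q" "Q = 0 \<Longrightarrow> X - c3*Y - c2*Z = 0"
    by (auto simp: add_nonneg_eq_0_iff)
qed

text \<open>In Euclidean and in spherical geometry alike, the angle facing \<open>x\<close> varies as
  \<open>A \<theta>\<^sub>1' = \<sigma>(x) (x' - cos \<theta>\<^sub>3 y' - cos \<theta>\<^sub>2 z')\<close> with the same \<open>A\<close> for all three angles.\<close>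

lemma variation_from_angle_form:
  fixes \<theta>1 \<theta>2 \<theta>3 :: "real \<Rightarrow> real"
  assumes D: "(\<theta>1 has_real_derivative \<sigma>1 * (X - c3*Y - c2*Z) / A) (at s)"
     "(\<theta>2 has_real_derivative \<sigma>2 * (Y - c1*Z - c3*X) / A) (at s)"
     "(\<theta>3 has_real_derivative \<sigma>3 * (Z - c2*X - c1*Y) / A) (at s)"
    and pos: "0 < \<sigma>1" "0 < \<sigma>2" "0 < \<sigma>3" "0 < A"
    and c: "\<bar>c1\<bar> < 1" "\<bar>c2\<bar> < 1" "\<bar>c3\<bar> < 1" "0 \<le> 1 - c1\<^sup>2 - c2\<^sup>2 - c3\<^sup>2 - 2*c1*c2*c3"
  shows "positive_variation \<theta>1 \<theta>2 \<theta>3 (X / \<sigma>1) (Y / \<sigma>2) (Z / \<sigma>3) s"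
  unfolding positive_variation_def
proof (intro exI conjI D impI)
  let ?Q = "X*(X - c3*Y - c2*Z) + Y*(Y - c1*Z - c3*X) + Z*(Z - c2*X - c1*Y)"
  have eq: "X / \<sigma>1 * (\<sigma>1 * (X - c3*Y - c2*Z) / A) + Y / \<sigma>2 * (\<sigma>2 * (Y - c1*Z - c3*X) / A) +
      Z / \<sigma>3 * (\<sigma>3 * (Z - c2*X - c1*Y) / A) = ?Q / A" (is "?L = _")
    using pos by (simp add: add_divide_distrib)
  have cyc: "0 \<le> 1 - c2\<^sup>2 - c3\<^sup>2 - c1\<^sup>2 - 2*c2*c3*c1" "0 \<le> 1 - c3\<^sup>2 - c1\<^sup>2 - c2\<^sup>2 - 2*c3*c1*c2"
    using c(4) by (simp_all add: algebra_simps)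
  note q1 = angle_form_nonneg[OF c(2,3,4), of X Y Z] and q2 = angle_form_nonneg[OF c(3,1) cyc(1), of Y Z X]
    and q3 = angle_form_nonneg[OF c(1,2) cyc(2), of Z X Y]
  show "0 \<le> ?L" unfolding eq using q1(1) pos by simp
  assume "?L = 0"
  then have Q: "?Q = 0" unfolding eq using pos by simp
  show "\<sigma>1 * (X - c3*Y - c2*Z) / A = 0" using q1(2) Q by simp
  show "\<sigma>2 * (Y - c1*Z - c3*X) / A = 0" using q2(2) Q by (simp add: algebra_simps)
  show "\<sigma>3 * (Z - c2*X - c1*Y) / A = 0" using q3(2) Q by (simp add: algebra_simps)
qed (rule D)+

definition euc_cos :: "real \<Rightarrow> real \<Rightarrow> real \<Rightarrow> real" where
  "euc_cos x y z = (y\<^sup>2 + z\<^sup>2 - x\<^sup>2) / (2 * y * z)"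

text \<open>Sixteen times the squared area, by Heron's formula. Being symmetric, it decides for the three angles
  at once whether they are degenerate.\<close>

definition euc_gram :: "real \<Rightarrow> real \<Rightarrow> real \<Rightarrow> real" where
  "euc_gram x y z = 2*x\<^sup>2*y\<^sup>2 + 2*y\<^sup>2*z\<^sup>2 + 2*z\<^sup>2*x\<^sup>2 - x^4 - y^4 - z^4"

lemma euc_gram_cyclic: "euc_gram y z x = euc_gram x y z"
  by (simp add: euc_gram_def algebra_simps)

lemma euc_cos_less_1: "0 < y \<Longrightarrow> 0 < z \<Longrightarrow> \<bar>euc_cos x y z\<bar> < 1 \<longleftrightarrow> 0 < euc_gram x y z"
  unfolding euc_cos_def
  by (subst abs_quotient_less_1) (auto simp: euc_gram_def algebra_simps power2_eq_square power4_eq_xxxx)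

lemma euc_sin:
  assumes "0 < x" "0 < y" "0 < z" "0 < euc_gram x y z"
  shows "sin (carc (euc_cos x y z)) = sqrt (euc_gram x y z) / (2 * x * y * z) * x"
proof -
  have "\<bar>euc_cos x y z\<bar> < 1" using assms euc_cos_less_1 by simp
  then show ?thesis
    using abs_quotient_less_1(2)[of "2*y*z" "y\<^sup>2 + z\<^sup>2 - x\<^sup>2"] assms
    by (simp add: sin_carc euc_cos_def euc_gram_def algebra_simps power2_eq_square power4_eq_xxxx)
qed

lemma euc_angle_derivative:
  assumes d: "(p has_real_derivative X) (at s)" "(q has_real_derivative Y) (at s)" "(r has_real_derivative Z) (at s)"
    and pos: "0 < p s" "0 < q s" "0 < r s" and nd: "0 < euc_gram (p s) (q s) (r s)"
  shows "((\<lambda>s. carc (euc_cos (p s) (q s) (r s))) has_real_derivative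
     p s * (X - euc_cos (r s) (p s) (q s) * Y - euc_cos (q s) (r s) (p s) * Z)
       / (sqrt (euc_gram (p s) (q s) (r s)) / 2)) (at s)"
proof -
  define x y z where "x = p s" "y = q s" "z = r s"
  note pos' = pos[folded x_y_z_def]
  define u' where "u' = ((2*y*Y + 2*z*Z - 2*x*X) * (2*y*z) - (y\<^sup>2 + z\<^sup>2 - x\<^sup>2) * (2*Y*z + 2*y*Z)) / ((2*y*z) * (2*y*z))"
  have "((\<lambda>s. euc_cos (p s) (q s) (r s)) has_real_derivative u') (at s)"
    unfolding euc_cos_def u'_def x_y_z_def using pos
    by (auto intro!: derivative_eq_intros d simp: algebra_simps)
  from DERIV_carc[OF this] have "((\<lambda>s. carc (euc_cos (p s) (q s) (r s))) has_real_derivative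
      - u' / sin (carc (euc_cos x y z))) (at s)"
    using nd pos by (simp add: euc_cos_less_1 x_y_z_def)
  moreover have "- u' / sin (carc (euc_cos x y z)) = x * (X - euc_cos z x y * Y - euc_cos y z x * Z)
       / (sqrt (euc_gram x y z) / 2)"
  proof -
    define A where "A = sqrt (euc_gram x y z)"
    have A: "A > 0" using nd by (simp add: A_def x_y_z_def)
    have u': "- u' * (y * z) = x * (X - euc_cos z x y * Y - euc_cos y z x * Z)"
      using pos' unfolding u'_def euc_cos_def by (simp add: divide_simps) algebra
    have "sin (carc (euc_cos x y z)) = A / (2 * y * z)"
      using euc_sin[of x y z] nd pos' unfolding A_def x_y_z_def by simp
    then show ?thesis unfolding A_def[symmetric] u'[symmetric] using pos' by simp
  qed
  ultimately show ?thesis by (simp add: x_y_z_def)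
qed

interpretation euclidean: triangle_geometry "{0<..}" "\<lambda>x. x" "\<lambda>x y z. carc (euc_cos x y z)"
    "\<lambda>x y z. 0 < euc_gram x y z" "{0, pi}"
proof
  show "is_interval {0::real<..}" by (auto simp: is_interval_1)
  show "continuous_on {0..1} (\<lambda>s. carc (euc_cos (p s) (q s) (r s)))"
    if "continuous_on {0..1} p" "continuous_on {0..1} q" "continuous_on {0..1} r"
      "p ` {0..1} \<subseteq> {0<..}" "q ` {0..1} \<subseteq> {0<..}" "r ` {0..1} \<subseteq> {0<..}" for p q r :: "real \<Rightarrow> real"
    unfolding euc_cos_def using that by (intro continuous_on_carc continuous_intros) force+
  show "0 < euc_gram y z x" if "0 < euc_gram x y z" for x y z using that euc_gram_cyclic by simp
next
  fix x y z :: real assume xyz: "x \<in> {0<..}" "y \<in> {0<..}" "z \<in> {0<..}"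
  show "carc (euc_cos x y z) \<in> {0, pi}" if "\<not> 0 < euc_gram x y z"
    using that xyz by (intro carc_degenerate) (simp add: euc_cos_less_1)
  assume nd: "0 < euc_gram x y z"
  show "0 < carc (euc_cos x y z) \<and> carc (euc_cos x y z) < pi"
    using nd xyz by (intro carc_bounds) (simp add: euc_cos_less_1)
  show "\<exists>c>0. sin (carc (euc_cos x y z)) = c * x \<and> sin (carc (euc_cos y z x)) = c * y \<and> sin (carc (euc_cos z x y)) = c * z"
    using nd xyz euc_gram_cyclic[of x y z] euc_gram_cyclic[of y z x]
    by (intro exI[of _ "sqrt (euc_gram x y z) / (2 * x * y * z)"]) (auto simp: euc_sin mult_ac)
next
  fix p q r :: "real \<Rightarrow> real" and s X Y Z :: real
  assume d: "(p has_real_derivative X) (at s)" "(q has_real_derivative Y) (at s)" "(r has_real_derivative Z) (at s)"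
    and I: "p s \<in> {0<..}" "q s \<in> {0<..}" "r s \<in> {0<..}" and nd: "0 < euc_gram (p s) (q s) (r s)"
  let ?x = "p s" and ?y = "q s" and ?z = "r s"
  have pos: "0 < p s" "0 < q s" "0 < r s" using I by auto
  have nd': "0 < euc_gram ?y ?z ?x" "0 < euc_gram ?z ?x ?y" and g: "euc_gram ?y ?z ?x = euc_gram ?x ?y ?z" "euc_gram ?z ?x ?y = euc_gram ?x ?y ?z"
    using nd euc_gram_cyclic[of ?x ?y ?z] euc_gram_cyclic[of ?y ?z ?x] by auto
  have gram0: "1 - (euc_cos ?x ?y ?z)\<^sup>2 - (euc_cos ?y ?z ?x)\<^sup>2 - (euc_cos ?z ?x ?y)\<^sup>2
      - 2 * euc_cos ?x ?y ?z * euc_cos ?y ?z ?x * euc_cos ?z ?x ?y = 0"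
    using pos unfolding euc_cos_def by (simp add: divide_simps) algebra
  show "positive_variation (\<lambda>s. carc (euc_cos (p s) (q s) (r s))) (\<lambda>s. carc (euc_cos (q s) (r s) (p s)))
     (\<lambda>s. carc (euc_cos (r s) (p s) (q s))) (X / p s) (Y / q s) (Z / r s) s"
    by (rule variation_from_angle_form[OF euc_angle_derivative[OF d pos nd]
         euc_angle_derivative[OF d(2,3,1) pos(2,3,1) nd'(1), unfolded g] euc_angle_derivative[OF d(3,1,2) pos(3,1,2) nd'(2), unfolded g] pos])
       (use nd nd' pos gram0 in \<open>simp_all add: euc_cos_less_1\<close>)
qed auto

section \<open>Variation of the angles: spherical triangles\<close>

text \<open>The determinant of the matrix with diagonal entries \<open>1\<close> and off-diagonal entries \<open>a\<close>, \<open>b\<close>, \<open>c\<close>. With the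
  cosines (hyperbolic cosines) of the sides for entries it takes over the role of Heron's formula in
  spherical (hyperbolic) geometry.\<close>

definition gram :: "real \<Rightarrow> real \<Rightarrow> real \<Rightarrow> real" where
  "gram a b c = 1 + 2*a*b*c - a\<^sup>2 - b\<^sup>2 - c\<^sup>2"

lemma gram_cyclic: "gram b c a = gram a b c"
  by (simp add: gram_def algebra_simps)

definition sph_cos :: "real \<Rightarrow> real \<Rightarrow> real \<Rightarrow> real" where
  "sph_cos x y z = (cos x - cos y * cos z) / (sin y * sin z)"

definition sph_gram :: "real \<Rightarrow> real \<Rightarrow> real \<Rightarrow> real" where
  "sph_gram x y z = gram (cos x) (cos y) (cos z)"

lemma sph_gram_cyclic: "sph_gram y z x = sph_gram x y z"
  by (simp add: sph_gram_def gram_cyclic)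

lemma sph_gram_eq: "(sin y * sin z)\<^sup>2 - (cos x - cos y * cos z)\<^sup>2 = sph_gram x y z"
  unfolding power_mult_distrib sin_squared_eq sph_gram_def gram_def by algebra

lemma sph_cos_less_1: "0 < sin y \<Longrightarrow> 0 < sin z \<Longrightarrow> \<bar>sph_cos x y z\<bar> < 1 \<longleftrightarrow> 0 < sph_gram x y z"
  unfolding sph_cos_def
  by (subst abs_quotient_less_1) (auto simp: sph_gram_eq)

lemma sph_sin:
  assumes "0 < sin y" "0 < sin z" "0 < sph_gram x y z"
  shows "sin (carc (sph_cos x y z)) = sqrt (sph_gram x y z) / (sin y * sin z)"
proof -
  have "\<bar>sph_cos x y z\<bar> < 1" using assms sph_cos_less_1 by simp
  then show ?thesis
    using abs_quotient_less_1(2)[of "sin y * sin z" "cos x - cos y * cos z"] assms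
    by (simp add: sin_carc sph_cos_def sph_gram_eq)
qed

lemma sph_dual_cosine_law:
  assumes pos: "0 < sin x" "0 < sin y" "0 < sin z" and nd: "0 < sph_gram x y z"
  shows "sph_cos x y z + sph_cos y z x * sph_cos z x y =
    cos x * sin (carc (sph_cos y z x)) * sin (carc (sph_cos z x y))"
proof -
  have g: "sph_gram y z x = sph_gram x y z" "sph_gram z x y = sph_gram x y z"
    using sph_gram_cyclic by metis+
  define A where "A = sqrt (sph_gram x y z)"
  have A: "A * A = sph_gram x y z" using nd by (simp add: A_def)
  have eq: "sph_cos x y z + sph_cos y z x * sph_cos z x y =
      ((cos x - cos y * cos z) * (sin x)\<^sup>2 + (cos y - cos z * cos x) * (cos z - cos x * cos y)) / ((sin x)\<^sup>2 * sin y * sin z)"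
    using pos unfolding sph_cos_def by (simp add: divide_simps power2_eq_square)
  have num: "(cos x - cos y * cos z) * (sin x)\<^sup>2 + (cos y - cos z * cos x) * (cos z - cos x * cos y) = cos x * (A * A)"
    unfolding A sin_squared_eq sph_gram_def gram_def by algebra
  have sines: "sin (carc (sph_cos y z x)) = A / (sin z * sin x)" "sin (carc (sph_cos z x y)) = A / (sin x * sin y)"
    using sph_sin[of z x y] sph_sin[of x y z] pos nd by (simp_all add: sph_sin g A_def)
  show ?thesis unfolding eq num sines by (simp add: power2_eq_square mult_ac)
qed

text \<open>The cosines of the angles are, up to sign, the cosines of the sides of the polar triangle. This is its
  Gram determinant.\<close>

lemma sph_angle_gram:
  assumes pos: "0 < sin x" "0 < sin y" "0 < sin z"
  defines "c1 \<equiv> sph_cos x y z" and "c2 \<equiv> sph_cos y z x" and "c3 \<equiv> sph_cos z x y"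
  shows "(1 - c1\<^sup>2 - c2\<^sup>2 - c3\<^sup>2 - 2*c1*c2*c3) * (sin x * sin y * sin z)\<^sup>2 = (sph_gram x y z)\<^sup>2"
proof -
  have c: "c1 * sin y * sin z = cos x - cos y * cos z" "c2 * sin z * sin x = cos y - cos z * cos x"
    "c3 * sin x * sin y = cos z - cos x * cos y"
    using pos by (simp_all add: c1_def c2_def c3_def sph_cos_def)
  have "(1 - c1\<^sup>2 - c2\<^sup>2 - c3\<^sup>2 - 2*c1*c2*c3) * (sin x * sin y * sin z)\<^sup>2
      = (sin x)\<^sup>2 * (sin y)\<^sup>2 * (sin z)\<^sup>2 - (sin x)\<^sup>2 * (c1 * sin y * sin z)\<^sup>2 - (sin y)\<^sup>2 * (c2 * sin z * sin x)\<^sup>2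
        - (sin z)\<^sup>2 * (c3 * sin x * sin y)\<^sup>2 - 2 * (c1 * sin y * sin z) * (c2 * sin z * sin x) * (c3 * sin x * sin y)"
    by algebra
  also have "\<dots> = (sph_gram x y z)\<^sup>2"
    unfolding c sin_squared_eq sph_gram_def gram_def by algebra
  finally show ?thesis .
qed

lemma sph_angle_derivative:
  assumes d: "(p has_real_derivative X) (at s)" "(q has_real_derivative Y) (at s)" "(r has_real_derivative Z) (at s)"
    and pos: "0 < sin (p s)" "0 < sin (q s)" "0 < sin (r s)" and nd: "0 < sph_gram (p s) (q s) (r s)"
  shows "((\<lambda>s. carc (sph_cos (p s) (q s) (r s))) has_real_derivative
     sin (p s) * (X - sph_cos (r s) (p s) (q s) * Y - sph_cos (q s) (r s) (p s) * Z)
       / sqrt (sph_gram (p s) (q s) (r s))) (at s)"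
proof -
  define x y z where "x = p s" "y = q s" "z = r s"
  note pos' = pos[folded x_y_z_def]
  define u' where "u' = ((- sin x * X + sin y * Y * cos z + cos y * sin z * Z) * (sin y * sin z)
      - (cos x - cos y * cos z) * (cos y * Y * sin z + sin y * cos z * Z)) / ((sin y * sin z) * (sin y * sin z))"
  have "((\<lambda>s. sph_cos (p s) (q s) (r s)) has_real_derivative u') (at s)"
    unfolding sph_cos_def u'_def x_y_z_def using pos
    by (auto intro!: derivative_eq_intros d simp: algebra_simps)
  from DERIV_carc[OF this] have "((\<lambda>s. carc (sph_cos (p s) (q s) (r s))) has_real_derivative
      - u' / sin (carc (sph_cos x y z))) (at s)"
    using nd pos by (simp add: sph_cos_less_1 x_y_z_def)
  moreover have "- u' / sin (carc (sph_cos x y z)) = sin x * (X - sph_cos z x y * Y - sph_cos y z x * Z)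
       / sqrt (sph_gram x y z)"
  proof -
    \<comment> \<open>\<open>a\<close>, \<open>b\<close>, \<open>c\<close> are the cosines and \<open>e\<close>, \<open>f\<close>, \<open>g\<close> the sines of the sides\<close>
    have alg: "- ((((- e)*X + f*Y*c + b*g*Z) * (f*g) - (a - b*c) * (b*Y*g + f*c*Z)) / ((f*g)*(f*g))) * (f*g)
        = e * (X - (c - a*b)/(e*f)*Y - (b - c*a)/(g*e)*Z)"
      if "e \<noteq> 0" "f \<noteq> 0" "g \<noteq> 0" "f\<^sup>2 = 1 - b\<^sup>2" "g\<^sup>2 = 1 - c\<^sup>2" for e f g a b c :: real
      using that by (simp add: divide_simps) algebra
    have u': "- u' * (sin y * sin z) = sin x * (X - sph_cos z x y * Y - sph_cos y z x * Z)"
      unfolding u'_def sph_cos_def by (rule alg) (use pos' in \<open>auto simp: sin_squared_eq\<close>)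
    have "sin (carc (sph_cos x y z)) = sqrt (sph_gram x y z) / (sin y * sin z)"
      using sph_sin nd pos' unfolding x_y_z_def by blast
    then show ?thesis unfolding u'[symmetric] using pos' by simp
  qed
  ultimately show ?thesis by (simp add: x_y_z_def)
qed

interpretation spherical: triangle_geometry "{0<..<pi}" sin "\<lambda>x y z. carc (sph_cos x y z)"
    "\<lambda>x y z. 0 < sph_gram x y z" "{0, pi}"
proof
  show "is_interval {0<..<pi}" by (auto simp: is_interval_1)
  show "0 < sin x" if "x \<in> {0<..<pi}" for x using that by (auto intro: sin_gt_zero)
  show "continuous_on {0..1} (\<lambda>s. carc (sph_cos (p s) (q s) (r s)))"
    if "continuous_on {0..1} p" "continuous_on {0..1} q" "continuous_on {0..1} r"
      "p ` {0..1} \<subseteq> {0<..<pi}" "q ` {0..1} \<subseteq> {0<..<pi}" "r ` {0..1} \<subseteq> {0<..<pi}" for p q r :: "real \<Rightarrow> real"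
  proof -
    have nz: "sin (q s) * sin (r s) \<noteq> 0" if "s \<in> {0..1}" for s
      using that \<open>q ` {0..1} \<subseteq> {0<..<pi}\<close> \<open>r ` {0..1} \<subseteq> {0<..<pi}\<close> sin_gt_zero[of "q s"] sin_gt_zero[of "r s"] by force
    show ?thesis
      unfolding sph_cos_def using that nz by (intro continuous_on_carc continuous_intros) auto
  qed
  show "0 < sph_gram y z x" if "0 < sph_gram x y z" for x y z using that sph_gram_cyclic by simp
next
  fix x y z :: real assume "x \<in> {0<..<pi}" "y \<in> {0<..<pi}" "z \<in> {0<..<pi}"
  then have xyz: "0 < sin x" "0 < sin y" "0 < sin z" by (auto intro: sin_gt_zero)
  show "carc (sph_cos x y z) \<in> {0, pi}" if "\<not> 0 < sph_gram x y z"
    using that xyz by (intro carc_degenerate) (simp add: sph_cos_less_1)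
  assume nd: "0 < sph_gram x y z"
  show "0 < carc (sph_cos x y z) \<and> carc (sph_cos x y z) < pi"
    using nd xyz by (intro carc_bounds) (simp add: sph_cos_less_1)
  show "\<exists>c>0. sin (carc (sph_cos x y z)) = c * sin x \<and> sin (carc (sph_cos y z x)) = c * sin y \<and> sin (carc (sph_cos z x y)) = c * sin z"
    using nd xyz sph_gram_cyclic[of x y z] sph_gram_cyclic[of y z x]
    by (intro exI[of _ "sqrt (sph_gram x y z) / (sin x * sin y * sin z)"]) (auto simp: sph_sin mult_ac)
next
  fix p q r :: "real \<Rightarrow> real" and s X Y Z :: real
  assume d: "(p has_real_derivative X) (at s)" "(q has_real_derivative Y) (at s)" "(r has_real_derivative Z) (at s)"
    and I: "p s \<in> {0<..<pi}" "q s \<in> {0<..<pi}" "r s \<in> {0<..<pi}" and nd: "0 < sph_gram (p s) (q s) (r s)"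
  let ?x = "p s" and ?y = "q s" and ?z = "r s"
  have pos: "0 < sin (p s)" "0 < sin (q s)" "0 < sin (r s)" using I by (auto intro: sin_gt_zero)
  have nd': "0 < sph_gram ?y ?z ?x" "0 < sph_gram ?z ?x ?y" and g: "sph_gram ?y ?z ?x = sph_gram ?x ?y ?z" "sph_gram ?z ?x ?y = sph_gram ?x ?y ?z"
    using nd sph_gram_cyclic[of ?x ?y ?z] sph_gram_cyclic[of ?y ?z ?x] by auto
  have "0 < (sin ?x * sin ?y * sin ?z)\<^sup>2" using pos by simp
  then have gram0: "0 \<le> 1 - (sph_cos ?x ?y ?z)\<^sup>2 - (sph_cos ?y ?z ?x)\<^sup>2 - (sph_cos ?z ?x ?y)\<^sup>2
      - 2 * sph_cos ?x ?y ?z * sph_cos ?y ?z ?x * sph_cos ?z ?x ?y"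
    using sph_angle_gram[OF pos] by (metis zero_le_mult_iff zero_le_power2 not_less)
  show "positive_variation (\<lambda>s. carc (sph_cos (p s) (q s) (r s))) (\<lambda>s. carc (sph_cos (q s) (r s) (p s)))
     (\<lambda>s. carc (sph_cos (r s) (p s) (q s))) (X / sin (p s)) (Y / sin (q s)) (Z / sin (r s)) s"
    by (rule variation_from_angle_form[OF sph_angle_derivative[OF d pos nd]
         sph_angle_derivative[OF d(2,3,1) pos(2,3,1) nd'(1), unfolded g] sph_angle_derivative[OF d(3,1,2) pos(3,1,2) nd'(2), unfolded g] pos])
       (use nd nd' pos gram0 in \<open>simp_all add: sph_cos_less_1\<close>)
qed auto

section \<open>Variation of the angles: hyperbolic triangles\<close>

definition hyp_cos :: "real \<Rightarrow> real \<Rightarrow> real \<Rightarrow> real" where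
  "hyp_cos x y z = (cosh y * cosh z - cosh x) / (sinh y * sinh z)"

definition hyp_gram :: "real \<Rightarrow> real \<Rightarrow> real \<Rightarrow> real" where
  "hyp_gram x y z = gram (cosh x) (cosh y) (cosh z)"

lemma hyp_gram_cyclic: "hyp_gram y z x = hyp_gram x y z"
  by (simp add: hyp_gram_def gram_cyclic)

lemma sinh_squared_eq: "(sinh x)\<^sup>2 = (cosh x)\<^sup>2 - (1::real)"
  using cosh_square_eq[of x] by simp

lemma hyp_gram_eq: "(sinh y * sinh z)\<^sup>2 - (cosh y * cosh z - cosh x)\<^sup>2 = hyp_gram x y z"
  unfolding power_mult_distrib sinh_squared_eq hyp_gram_def gram_def by algebra

lemma hyp_cos_less_1: "0 < y \<Longrightarrow> 0 < z \<Longrightarrow> \<bar>hyp_cos x y z\<bar> < 1 \<longleftrightarrow> 0 < hyp_gram x y z"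
  unfolding hyp_cos_def
  by (subst abs_quotient_less_1) (auto simp: hyp_gram_eq)

lemma hyp_sin:
  assumes "0 < y" "0 < z" "0 < hyp_gram x y z"
  shows "sin (carc (hyp_cos x y z)) = sqrt (hyp_gram x y z) / (sinh y * sinh z)"
proof -
  have "\<bar>hyp_cos x y z\<bar> < 1" using assms hyp_cos_less_1 by simp
  then show ?thesis
    using abs_quotient_less_1(2)[of "sinh y * sinh z" "cosh y * cosh z - cosh x"] assms
    by (simp add: sin_carc hyp_cos_def hyp_gram_eq)
qed

lemma hyp_dual_cosine_law:
  assumes pos: "0 < x" "0 < y" "0 < z" and nd: "0 < hyp_gram x y z"
  shows "hyp_cos x y z + hyp_cos y z x * hyp_cos z x y =
    cosh x * sin (carc (hyp_cos y z x)) * sin (carc (hyp_cos z x y))"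
proof -
  have g: "hyp_gram y z x = hyp_gram x y z" "hyp_gram z x y = hyp_gram x y z"
    using hyp_gram_cyclic by metis+
  have spos: "0 < sinh x" "0 < sinh y" "0 < sinh z" using pos by simp_all
  define A where "A = sqrt (hyp_gram x y z)"
  have A: "A * A = hyp_gram x y z" using nd by (simp add: A_def)
  have eq: "hyp_cos x y z + hyp_cos y z x * hyp_cos z x y =
      ((cosh y * cosh z - cosh x) * (sinh x)\<^sup>2 + (cosh z * cosh x - cosh y) * (cosh x * cosh y - cosh z)) / ((sinh x)\<^sup>2 * sinh y * sinh z)"
    using pos spos unfolding hyp_cos_def by (simp add: divide_simps power2_eq_square)
  have num: "(cosh y * cosh z - cosh x) * (sinh x)\<^sup>2 + (cosh z * cosh x - cosh y) * (cosh x * cosh y - cosh z) = cosh x * (A * A)"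
    unfolding A sinh_squared_eq hyp_gram_def gram_def by algebra
  have sines: "sin (carc (hyp_cos y z x)) = A / (sinh z * sinh x)" "sin (carc (hyp_cos z x y)) = A / (sinh x * sinh y)"
    using pos nd by (simp_all add: hyp_sin g A_def)
  show ?thesis unfolding eq num sines by (simp add: power2_eq_square mult_ac)
qed

lemma hyp_angle_derivative:
  assumes d: "(p has_real_derivative X) (at s)" "(q has_real_derivative Y) (at s)" "(r has_real_derivative Z) (at s)"
    and pos: "0 < p s" "0 < q s" "0 < r s" and nd: "0 < hyp_gram (p s) (q s) (r s)"
  shows "\<exists>D. ((\<lambda>s. carc (hyp_cos (p s) (q s) (r s))) has_real_derivative D) (at s)"
proof -
  define u' where "u' = ((sinh (q s) * Y * cosh (r s) + cosh (q s) * sinh (r s) * Z - sinh (p s) * X) * (sinh (q s) * sinh (r s))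
      - (cosh (q s) * cosh (r s) - cosh (p s)) * (cosh (q s) * Y * sinh (r s) + sinh (q s) * cosh (r s) * Z))
      / ((sinh (q s) * sinh (r s)) * (sinh (q s) * sinh (r s)))"
  have "((\<lambda>s. hyp_cos (p s) (q s) (r s)) has_real_derivative u') (at s)"
    unfolding hyp_cos_def u'_def using pos
    by (auto intro!: derivative_eq_intros d simp: algebra_simps)
  from DERIV_carc[OF this] show ?thesis
    using nd pos by (auto simp add: hyp_cos_less_1)
qed

text \<open>The assumptions are what the dual law of cosines gives, as hyperbolic cosines exceed \<open>1\<close>. They say
  \<open>cos t\<^sub>i > - cos (t\<^sub>j + t\<^sub>k)\<close>, which leaves for each angle the alternatives \<open>t\<^sub>i < \<pi> - t\<^sub>j - t\<^sub>k\<close> and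
  \<open>t\<^sub>i < t\<^sub>j + t\<^sub>k - \<pi>\<close>; the second one, if true of an angle, contradicts both alternatives for another.\<close>

lemma hyp_angle_sum:
  fixes t1 t2 t3 :: real
  assumes t: "0 < t1" "t1 < pi" "0 < t2" "t2 < pi" "0 < t3" "t3 < pi"
    and c: "cos t1 + cos t2 * cos t3 > sin t2 * sin t3" "cos t2 + cos t3 * cos t1 > sin t3 * sin t1"
      "cos t3 + cos t1 * cos t2 > sin t1 * sin t2"
  shows "t1 + t2 + t3 < pi"
proof -
  have key: "a < pi - b - c \<or> pi < b + c \<and> a < b + c - pi"
    if "0 < a" "a < pi" "0 < b" "b < pi" "0 < c" "c < pi" "cos a + cos b * cos c > sin b * sin c" for a b c :: real
  proof (cases "b + c \<le> pi")
    case True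
    have "cos (pi - (b + c)) < cos a" using that(7) by (simp add: cos_add)
    then have "a < pi - (b + c)" using cos_mono_less_eq[of "pi - (b + c)" a] True that by auto
    then show ?thesis by simp
  next
    case False
    have "cos (b + c - pi) < cos a" using that(7) by (simp add: cos_add cos_diff)
    then have "a < b + c - pi" using cos_mono_less_eq[of "b + c - pi" a] False that by auto
    then show ?thesis using False by simp
  qed
  show ?thesis using key[OF _ _ _ _ _ _ c(1)] key[OF _ _ _ _ _ _ c(2)] key[OF _ _ _ _ _ _ c(3)] t by argo
qed

text \<open>The addition theorem for the tangent says precisely that this form in \<open>x\<close> and \<open>y\<close> has determinant \<open>1\<close>.\<close>

lemma tan_cot_form:
  fixes a b x y :: real
  assumes a: "- (pi/2) < a" "a < pi/2" and b: "- (pi/2) < b" "b < pi/2" and ab: "0 < a + b" "a + b < pi"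
  defines "Q \<equiv> tan a * x\<^sup>2 + tan b * y\<^sup>2 + cot (a + b) * (x + y)\<^sup>2"
  shows "0 \<le> Q" and "Q = 0 \<Longrightarrow> x = 0 \<and> y = 0"
proof -
  have ca: "0 < cos a" "0 < cos b" and sab: "0 < sin (a + b)"
    using a b ab by (auto intro: cos_gt_zero_pi sin_gt_zero)
  define \<alpha> \<beta> \<gamma> where "\<alpha> = tan a" "\<beta> = tan b" "\<gamma> = cot (a + b)"
  have det: "\<alpha>*\<beta> + \<gamma>*(\<alpha> + \<beta>) = 1"
  proof -
    have "\<alpha> + \<beta> = sin (a + b) / (cos a * cos b)"
      using ca by (simp add: \<alpha>_\<beta>_\<gamma>_def tan_def sin_add divide_simps)
    then have "\<gamma>*(\<alpha> + \<beta>) = cos (a + b) / (cos a * cos b)"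
      using sab by (simp add: \<alpha>_\<beta>_\<gamma>_def cot_def)
    also have "\<dots> = 1 - \<alpha>*\<beta>"
      using ca by (simp add: \<alpha>_\<beta>_\<gamma>_def tan_def cos_add divide_simps)
    finally show ?thesis by simp
  qed
  have "\<alpha> + \<gamma> = (sin a * sin (a + b) + cos (a + b) * cos a) / (cos a * sin (a + b))"
    using ca sab by (simp add: \<alpha>_\<beta>_\<gamma>_def tan_def cot_def add_frac_eq)
  also have "sin a * sin (a + b) + cos (a + b) * cos a = cos (a + b - a)" by (simp only: cos_diff) simp
  also have "\<dots> = cos b" by simp
  finally have pos: "\<alpha> + \<gamma> > 0" using ca sab by simp
  have "(\<alpha> + \<gamma>) * Q = ((\<alpha> + \<gamma>)*x + \<gamma>*y)\<^sup>2 + (\<alpha>*\<beta> + \<gamma>*(\<alpha> + \<beta>)) * y\<^sup>2"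
    unfolding Q_def \<alpha>_\<beta>_\<gamma>_def[symmetric] by algebra
  then have Q: "(\<alpha> + \<gamma>) * Q = ((\<alpha> + \<gamma>)*x + \<gamma>*y)\<^sup>2 + y\<^sup>2" by (simp add: det)
  then have "0 \<le> (\<alpha> + \<gamma>) * Q" by simp
  then show "0 \<le> Q" using pos by (simp add: zero_le_mult_iff)
  assume "Q = 0"
  then have "((\<alpha> + \<gamma>)*x + \<gamma>*y)\<^sup>2 + y\<^sup>2 = 0" using Q by (simp only: mult_zero_right)
  then have c: "(\<alpha> + \<gamma>)*x + \<gamma>*y = 0 \<and> y = 0" by (rule iffD1[OF sum_power2_eq_zero_iff])
  then have "y = 0" by (rule conjunct2)
  moreover from this c have "(\<alpha> + \<gamma>) * x = 0" by (metis add.right_neutral mult_zero_right)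
  ultimately show "x = 0 \<and> y = 0" using pos by (metis less_irrefl mult_eq_0_iff)
qed

text \<open>The left-hand side is the logarithmic derivative of \<open>sinh\<^sup>2 (x/2)\<close>. Since
  \<open>sinh\<^sup>2 (x/2) sin t\<^sub>2 sin t\<^sub>3 = cos ((t\<^sub>1 + t\<^sub>2 + t\<^sub>3)/2) cos ((t\<^sub>2 + t\<^sub>3 - t\<^sub>1)/2)\<close>, it can be read off from the
  variation of the angles; \<open>dlaw\<close> is the derivative of \<open>law\<close>.\<close>

lemma hyp_half_edge_variation:
  fixes t1 t2 t3 D1 D2 D3 x X :: real
  assumes t: "0 < t1" "0 < t2" "0 < t3" "t1 + t2 + t3 < pi" and x: "0 < x"
    and law: "cos t1 + cos t2 * cos t3 = cosh x * sin t2 * sin t3"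
    and dlaw: "- sin t1 * D1 - sin t2 * D2 * cos t3 - cos t2 * sin t3 * D3 =
        sinh x * X * sin t2 * sin t3 + cosh x * (cos t2 * D2 * sin t3 + sin t2 * cos t3 * D3)"
  shows "X / tanh (x/2) = - tan ((t1+t2+t3)/2) * ((D1+D2+D3)/2) - tan ((t2+t3-t1)/2) * ((D2+D3-D1)/2)
     - cot t2 * D2 - cot t3 * D3"
proof -
  define S b where "S = (t1+t2+t3)/2" and "b = (t2+t3-t1)/2"
  have Sb: "S + b = t2 + t3" "S - b = t1" by (simp_all add: S_def b_def field_simps)
  have cS: "0 < cos S" and cb: "0 < cos b" unfolding S_def b_def using t by (auto intro!: cos_gt_zero_pi)
  have s2: "0 < sin t2" "0 < sin t3" using t by (auto intro!: sin_gt_zero)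
  have ch: "cosh x - 1 > 0" using x cosh_real_strict_mono[of 0 x] by simp
  have half: "1 / tanh (x/2) = sinh x / (cosh x - 1)"
    using x sinh_double[of "x/2"] cosh_double[of "x/2"] cosh_square_eq[of "x/2"]
    by (simp add: tanh_def field_simps power2_eq_square)
  have P: "sin t2 * sin t3 * (cosh x - 1) = 2 * cos S * cos b"
  proof -
    have "2 * cos S * cos b = cos (S - b) + cos (S + b)" by (simp add: cos_add cos_diff)
    also have "\<dots> = cos t1 + cos (t2 + t3)" by (simp add: Sb)
    finally show ?thesis using law by (simp add: cos_add algebra_simps)
  qed
  have e1: "2 * sin S * cos b = sin (t2 + t3) + sin t1"
  proof -
    have "2 * sin S * cos b = sin (S + b) + sin (S - b)" by (simp add: sin_add sin_diff)
    then show ?thesis by (simp add: Sb)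
  qed
  have e2: "2 * cos S * sin b = sin (t2 + t3) - sin t1"
  proof -
    have "2 * cos S * sin b = sin (S + b) - sin (S - b)" by (simp add: sin_add sin_diff)
    then show ?thesis by (simp add: Sb)
  qed
  define T where "T = tan S * ((D1+D2+D3)/2) + tan b * ((D2+D3-D1)/2) + cot t2 * D2 + cot t3 * D3"
  have "sin t2 * sin t3 * (cosh x - 1) * T = 
      2 * sin S * cos b * ((D1+D2+D3)/2) + 2 * cos S * sin b * ((D2+D3-D1)/2)
      + (cosh x - 1) * (cos t2 * sin t3 * D2 + sin t2 * cos t3 * D3)"
  proof -
    have "sin t2 * sin t3 * (cosh x - 1) * (cot t2 * D2 + cot t3 * D3) =
        (cosh x - 1) * (cos t2 * sin t3 * D2 + sin t2 * cos t3 * D3)"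
      using s2 by (simp add: cot_def field_simps)
    moreover have "2 * cos S * cos b * (tan S * ((D1+D2+D3)/2) + tan b * ((D2+D3-D1)/2)) =
      2 * sin S * cos b * ((D1+D2+D3)/2) + 2 * cos S * sin b * ((D2+D3-D1)/2)"
      using cS cb by (simp add: tan_def field_simps)
    ultimately show ?thesis unfolding T_def P[symmetric] by (simp add: distrib_left)
  qed
  also have "\<dots> = sin t1 * D1 + sin t2 * D2 * cos t3 + cos t2 * sin t3 * D3
      + cosh x * (cos t2 * D2 * sin t3 + sin t2 * cos t3 * D3)"
    unfolding e1 e2 sin_add by (simp add: field_simps)
  also have "\<dots> = - (sinh x * X * sin t2 * sin t3)"
    using dlaw by linarith
  finally have "(sin t2 * sin t3) * ((cosh x - 1) * T + sinh x * X) = 0" by (simp add: algebra_simps)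
  then have "(cosh x - 1) * T + sinh x * X = 0" using s2 by simp
  then have "T * (cosh x - 1) = - (X * sinh x)" by (simp add: algebra_simps)
  then have "T = - (X * sinh x) / (cosh x - 1)" using ch by (subst nonzero_eq_divide_eq) auto
  then have "X * (1 / tanh (x/2)) = - T" unfolding half by simp
  then show ?thesis unfolding T_def S_def b_def by simp
qed

text \<open>Quotient of the half-side formulas for \<open>sinh\<^sup>2 (x/2)\<close> and \<open>cosh\<^sup>2 (x/2)\<close>. It implies the law of sines
  that relates the angles \<open>hyp_ang\<close> to \<open>\<sigma> x = tanh (x/2)\<close>.\<close>

lemma hyp_half_edge:
  fixes t1 t2 t3 x :: real
  assumes t: "0 < t1" "0 < t2" "0 < t3" "t1 + t2 + t3 < pi" and x: "0 < x"
    and law: "cos t1 + cos t2 * cos t3 = cosh x * sin t2 * sin t3"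
  shows "(tanh (x/2))\<^sup>2 * (cos ((t3+t1-t2)/2) * cos ((t1+t2-t3)/2)) = cos ((t1+t2+t3)/2) * cos ((t2+t3-t1)/2)"
proof -
  define S b1 b2 b3 where "S = (t1+t2+t3)/2" and "b1 = (t2+t3-t1)/2" and "b2 = (t3+t1-t2)/2" and "b3 = (t1+t2-t3)/2"
  have Sb: "S + b1 = t2 + t3" "S - b1 = t1" "b2 + b3 = t1" "b2 - b3 = t3 - t2"
    by (simp_all add: S_def b1_def b2_def b3_def field_simps)
  have s: "0 < sin t2 * sin t3" using t by (intro mult_pos_pos sin_gt_zero) auto
  have "2 * cos S * cos b1 = cos (S - b1) + cos (S + b1)" by (simp add: cos_add cos_diff)
  then have P: "sin t2 * sin t3 * (cosh x - 1) = 2 * cos S * cos b1"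
    unfolding Sb using law by (simp add: cos_add algebra_simps)
  have "2 * cos b2 * cos b3 = cos (b2 + b3) + cos (b2 - b3)" by (simp add: cos_add cos_diff)
  then have M: "sin t2 * sin t3 * (cosh x + 1) = 2 * cos b2 * cos b3"
    unfolding Sb using law by (simp add: cos_diff algebra_simps)
  have "(tanh (x/2))\<^sup>2 * (cosh x + 1) = cosh x - 1"
  proof -
    have c: "cosh x = 2 * (cosh (x/2))\<^sup>2 - 1" "cosh x = 2 * (sinh (x/2))\<^sup>2 + 1"
      using cosh_double[of "x/2"] cosh_square_eq[of "x/2"] by simp_all
    have "(tanh (x/2))\<^sup>2 * (cosh x + 1) = (sinh (x/2))\<^sup>2 / (cosh (x/2))\<^sup>2 * (2 * (cosh (x/2))\<^sup>2)"
      unfolding c(1) by (simp add: tanh_def power_divide)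
    also have "\<dots> = 2 * (sinh (x/2))\<^sup>2" by simp
    finally show ?thesis using c(2) by simp
  qed
  then have "(tanh (x/2))\<^sup>2 * (sin t2 * sin t3 * (cosh x + 1)) = sin t2 * sin t3 * (cosh x - 1)"
    by (metis mult.left_commute)
  then show ?thesis unfolding P M by (simp add: S_def b1_def b2_def b3_def)
qed

lemma hyp_angles:
  assumes pos: "0 < x" "0 < y" "0 < z" and nd: "0 < hyp_gram x y z"
  defines "t1 \<equiv> carc (hyp_cos x y z)" and "t2 \<equiv> carc (hyp_cos y z x)" and "t3 \<equiv> carc (hyp_cos z x y)"
  shows "0 < t1" "0 < t2" "0 < t3" "t1 + t2 + t3 < pi"
    and "cos t1 + cos t2 * cos t3 = cosh x * sin t2 * sin t3"
    and "cos t2 + cos t3 * cos t1 = cosh y * sin t3 * sin t1"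
    and "cos t3 + cos t1 * cos t2 = cosh z * sin t1 * sin t2"
proof -
  have g: "hyp_gram y z x = hyp_gram x y z" "hyp_gram z x y = hyp_gram x y z"
    using hyp_gram_cyclic by metis+
  have lt: "\<bar>hyp_cos x y z\<bar> < 1" "\<bar>hyp_cos y z x\<bar> < 1" "\<bar>hyp_cos z x y\<bar> < 1"
    using pos nd g by (simp_all add: hyp_cos_less_1)
  have t: "0 < t1" "t1 < pi" "0 < t2" "t2 < pi" "0 < t3" "t3 < pi"
    using lt carc_bounds unfolding t1_def t2_def t3_def by blast+
  then show "0 < t1" "0 < t2" "0 < t3" by auto
  have c: "cos t1 = hyp_cos x y z" "cos t2 = hyp_cos y z x" "cos t3 = hyp_cos z x y"
    using lt by (simp_all add: t1_def t2_def t3_def cos_carc)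
  show law: "cos t1 + cos t2 * cos t3 = cosh x * sin t2 * sin t3"
    "cos t2 + cos t3 * cos t1 = cosh y * sin t3 * sin t1"
    "cos t3 + cos t1 * cos t2 = cosh z * sin t1 * sin t2"
    using hyp_dual_cosine_law[of x y z] hyp_dual_cosine_law[of y z x] hyp_dual_cosine_law[of z x y] pos nd g
    unfolding c by (simp_all add: t1_def t2_def t3_def)
  have s: "0 < sin t1" "0 < sin t2" "0 < sin t3" using t by (simp_all add: sin_gt_zero)
  have ch: "1 < cosh x" "1 < cosh y" "1 < cosh z"
    using pos cosh_real_strict_mono[of 0] by auto
  have gt: "s' * s'' < k * s' * s''" if "1 < k" "0 < s'" "0 < s''" for k s' s'' :: real
  proof -
    have "1 * (s' * s'') < k * (s' * s'')" using that by (intro mult_strict_right_mono) auto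
    then show ?thesis by (simp add: mult.assoc)
  qed
  show "t1 + t2 + t3 < pi"
    by (rule hyp_angle_sum[OF t])
       (simp_all only: law gt[OF ch(1) s(2,3)] gt[OF ch(2) s(3,1)] gt[OF ch(3) s(1,2)])
qed

text \<open>If \<open>a\<close> denotes this value, then \<open>\<pi>/2 - a\<close> is the upper limit of the integral in the \<open>\<psi>\<close>-curvature.\<close>

definition hyp_ang :: "real \<Rightarrow> real \<Rightarrow> real \<Rightarrow> real" where
  "hyp_ang x y z = (pi + carc (hyp_cos x y z) - carc (hyp_cos y z x) - carc (hyp_cos z x y)) / 2"

text \<open>The first factors of the three products in \<open>Q\<close> are the logarithmic derivatives just computed, the
  second ones the variations of the angles \<open>hyp_ang\<close>. Multiplied out, \<open>Q\<close> is the sum of \<open>tan S S'\<^sup>2\<close>, the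
  \<open>tan b\<^sub>i B\<^sub>i\<^sup>2\<close> and the \<open>cot t\<^sub>i D\<^sub>i\<^sup>2\<close>. As \<open>t\<^sub>3 = S - b\<^sub>3\<close>, \<open>t\<^sub>2 = b\<^sub>1 + b\<^sub>3\<close> and \<open>t\<^sub>1 = b\<^sub>2 + b\<^sub>3\<close>, each cotangent
  joins two tangents to a form as in \<open>tan_cot_form\<close>, where \<open>tan b\<^sub>3\<close> is used twice and \<open>tan (- b\<^sub>3)\<close>
  once.\<close>

lemma hyp_form_nonneg:
  fixes t1 t2 t3 D1 D2 D3 :: real
  assumes t: "0 < t1" "0 < t2" "0 < t3" "t1 + t2 + t3 < pi"
  defines "S \<equiv> (t1+t2+t3)/2" and "b1 \<equiv> (t2+t3-t1)/2" and "b2 \<equiv> (t3+t1-t2)/2" and "b3 \<equiv> (t1+t2-t3)/2"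
    and "S' \<equiv> (D1+D2+D3)/2" and "B1 \<equiv> (D2+D3-D1)/2" and "B2 \<equiv> (D3+D1-D2)/2" and "B3 \<equiv> (D1+D2-D3)/2"
  defines "Q \<equiv> (- tan S * S' - tan b1 * B1 - cot t2 * D2 - cot t3 * D3) * (- B1)
     + (- tan S * S' - tan b2 * B2 - cot t3 * D3 - cot t1 * D1) * (- B2)
     + (- tan S * S' - tan b3 * B3 - cot t1 * D1 - cot t2 * D2) * (- B3)"
  shows "0 \<le> Q" and "Q = 0 \<Longrightarrow> D1 = 0 \<and> D2 = 0 \<and> D3 = 0"
proof -
  have ang: "S + - b3 = t3" "b1 + b3 = t2" "b2 + b3 = t1"
    by (simp_all add: S_def b1_def b2_def b3_def field_simps)
  have bd: "- (pi/2) < S" "S < pi/2" "- (pi/2) < b3" "b3 < pi/2"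
    "- (pi/2) < b1" "b1 < pi/2" "- (pi/2) < b2" "b2 < pi/2"
    using t by (simp_all add: S_def b1_def b2_def b3_def)
  then have mb3: "- (pi/2) < - b3" "- b3 < pi/2" by simp_all
  have D: "S' + - B3 = D3" "B1 + B3 = D2" "B2 + B3 = D1"
    by (simp_all add: S'_def B1_def B2_def B3_def field_simps)
  have tlt: "t1 < pi" "t2 < pi" "t3 < pi" using t by auto
  note q1 = tan_cot_form[OF bd(1,2) mb3, unfolded ang, OF t(3) tlt(3), of S' "- B3", unfolded D]
   and q2 = tan_cot_form[OF bd(5,6,3,4), unfolded ang, OF t(2) tlt(2), of B1 B3, unfolded D]
   and q3 = tan_cot_form[OF bd(7,8,3,4), unfolded ang, OF t(1) tlt(1), of B2 B3, unfolded D]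
  have Q: "Q = (tan S * S'\<^sup>2 + tan (- b3) * (- B3)\<^sup>2 + cot t3 * D3\<^sup>2)
    + (tan b1 * B1\<^sup>2 + tan b3 * B3\<^sup>2 + cot t2 * D2\<^sup>2) + (tan b2 * B2\<^sup>2 + tan b3 * B3\<^sup>2 + cot t1 * D1\<^sup>2)"
  proof -
    have S3: "S' = B1 + B2 + B3" "D1 = B2 + B3" "D2 = B1 + B3" "D3 = B1 + B2"
      by (simp_all add: S'_def B1_def B2_def B3_def field_simps)
    show ?thesis unfolding Q_def S3 tan_minus by algebra
  qed
  show "0 \<le> Q" unfolding Q using q1(1) q2(1) q3(1) by linarith
  assume "Q = 0"
  then have "tan b1 * B1\<^sup>2 + tan b3 * B3\<^sup>2 + cot t2 * D2\<^sup>2 = 0" "tan b2 * B2\<^sup>2 + tan b3 * B3\<^sup>2 + cot t1 * D1\<^sup>2 = 0"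
    unfolding Q using q1(1) q2(1) q3(1) by linarith+
  then have "B1 = 0" "B2 = 0" "B3 = 0" using q2(2) q3(2) by auto
  moreover have "D3 = B1 + B2" by (simp add: B1_def B2_def field_simps)
  ultimately show "D1 = 0 \<and> D2 = 0 \<and> D3 = 0" using D by auto
qed

lemma hyp_dual_law_derivative:
  fixes \<theta>1 \<theta>2 \<theta>3 p :: "real \<Rightarrow> real"
  assumes d: "(\<theta>1 has_real_derivative D1) (at s)" "(\<theta>2 has_real_derivative D2) (at s)"
      "(\<theta>3 has_real_derivative D3) (at s)" "(p has_real_derivative X) (at s)"
    and law: "\<forall>\<^sub>F u in nhds s. cos (\<theta>1 u) + cos (\<theta>2 u) * cos (\<theta>3 u) = cosh (p u) * sin (\<theta>2 u) * sin (\<theta>3 u)"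
  shows "- sin (\<theta>1 s) * D1 - sin (\<theta>2 s) * D2 * cos (\<theta>3 s) - cos (\<theta>2 s) * sin (\<theta>3 s) * D3 =
        sinh (p s) * X * sin (\<theta>2 s) * sin (\<theta>3 s) + cosh (p s) * (cos (\<theta>2 s) * D2 * sin (\<theta>3 s) + sin (\<theta>2 s) * cos (\<theta>3 s) * D3)"
    (is "?l = ?r")
proof -
  have "((\<lambda>u. cos (\<theta>1 u) + cos (\<theta>2 u) * cos (\<theta>3 u)) has_real_derivative ?l) (at s)"
    by (auto intro!: derivative_eq_intros d simp: algebra_simps)
  moreover have "((\<lambda>u. cosh (p u) * sin (\<theta>2 u) * sin (\<theta>3 u)) has_real_derivative ?r) (at s)"
    by (auto intro!: derivative_eq_intros d simp: algebra_simps)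
  ultimately show ?thesis
    using DERIV_cong_ev[OF refl law refl] DERIV_unique by blast
qed

interpretation hyperbolic: triangle_geometry "{0<..}" "\<lambda>x. tanh (x/2)" hyp_ang "\<lambda>x y z. 0 < hyp_gram x y z"
  "(\<lambda>(t1, t2, t3). (pi + t1 - t2 - t3) / 2) ` ({0, pi} \<times> {0, pi} \<times> {0, pi})"
proof
  show "is_interval {0::real<..}" by (auto simp: is_interval_1)
  show "0 < tanh (x/2)" if "x \<in> {0<..}" for x :: real using that by simp
  show "finite ((\<lambda>(t1, t2, t3). (pi + t1 - t2 - t3) / 2) ` ({0, pi} \<times> {0, pi} \<times> {0, pi}))" by simp
  show "continuous_on {0..1} (\<lambda>s. hyp_ang (p s) (q s) (r s))"
    if "continuous_on {0..1} p" "continuous_on {0..1} q" "continuous_on {0..1} r"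
      "p ` {0..1} \<subseteq> {0<..}" "q ` {0..1} \<subseteq> {0<..}" "r ` {0..1} \<subseteq> {0<..}" for p q r :: "real \<Rightarrow> real"
  proof -
    have "continuous_on {0..1} (\<lambda>s. carc (hyp_cos (p s) (q s) (r s)))"
      if "continuous_on {0..1} p" "continuous_on {0..1} q" "continuous_on {0..1} r"
       "p ` {0..1} \<subseteq> {0<..}" "q ` {0..1} \<subseteq> {0<..}" "r ` {0..1} \<subseteq> {0<..}" for p q r :: "real \<Rightarrow> real"
      unfolding hyp_cos_def using that by (intro continuous_on_carc continuous_intros) force+
    then show ?thesis unfolding hyp_ang_def using that by (intro continuous_intros) auto
  qed
  show "0 < hyp_gram y z x" if "0 < hyp_gram x y z" for x y z using that hyp_gram_cyclic by simp
next
  fix x y z :: real assume "x \<in> {0<..}" "y \<in> {0<..}" "z \<in> {0<..}"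
  then have pos: "0 < x" "0 < y" "0 < z" by auto
  have g: "hyp_gram y z x = hyp_gram x y z" "hyp_gram z x y = hyp_gram x y z"
    using hyp_gram_cyclic by metis+
  define t1 t2 t3 where t: "t1 = carc (hyp_cos x y z)" "t2 = carc (hyp_cos y z x)" "t3 = carc (hyp_cos z x y)"
  have ang: "hyp_ang x y z = (pi + t1 - t2 - t3)/2" "hyp_ang y z x = (pi + t2 - t3 - t1)/2" "hyp_ang z x y = (pi + t3 - t1 - t2)/2"
    by (simp_all add: hyp_ang_def t)
  show "hyp_ang x y z \<in> (\<lambda>(t1, t2, t3). (pi + t1 - t2 - t3) / 2) ` ({0, pi} \<times> {0, pi} \<times> {0, pi})" if "\<not> 0 < hyp_gram x y z"
  proof -
    have "(t1, t2, t3) \<in> {0, pi} \<times> {0, pi} \<times> {0, pi}"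
      unfolding t using that pos g by (intro SigmaI carc_degenerate) (simp_all add: hyp_cos_less_1)
    then show ?thesis unfolding ang by (rule rev_image_eqI) simp
  qed
  assume nd: "0 < hyp_gram x y z"
  note T = hyp_angles[OF pos nd, folded t]
  show "0 < hyp_ang x y z \<and> hyp_ang x y z < pi"
    unfolding ang using T(1-4) by (auto simp: field_simps)
  define S b1 b2 b3 where "S = (t1+t2+t3)/2" and "b1 = (t2+t3-t1)/2" and "b2 = (t3+t1-t2)/2" and "b3 = (t1+t2-t3)/2"
  have cb: "0 < cos S" "0 < cos b1" "0 < cos b2" "0 < cos b3"
    unfolding S_def b1_def b2_def b3_def using T(1-4) by (auto intro!: cos_gt_zero_pi)
  \<comment> \<open>the constant in the law of sines, obtained by solving \<open>hyp_half_edge\<close> for \<open>cos b1\<close>, \<open>cos b2\<close> and \<open>cos b3\<close>\<close>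
  define c where "c = sqrt (cos b1 * cos b2 * cos b3 / cos S)"
  have c: "c > 0" unfolding c_def using cb by simp
  have S: "(t2+t3+t1)/2 = S" "(t3+t1+t2)/2 = S" by (simp_all add: S_def)
  have "(tanh (x/2))\<^sup>2 * (cos b2 * cos b3) = cos S * cos b1"
    using hyp_half_edge[OF T(1-4) pos(1) T(5)] by (simp add: S_def b1_def b2_def b3_def)
  moreover have "(tanh (y/2))\<^sup>2 * (cos b3 * cos b1) = cos S * cos b2"
    using hyp_half_edge[OF T(2,3,1) _ pos(2) T(6)] T(4) unfolding S b1_def[symmetric] b2_def[symmetric] b3_def[symmetric] by simp
  moreover have "(tanh (z/2))\<^sup>2 * (cos b1 * cos b2) = cos S * cos b3"
    using hyp_half_edge[OF T(3,1,2) _ pos(3) T(7)] T(4) unfolding S b1_def[symmetric] b2_def[symmetric] b3_def[symmetric] by simp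
  ultimately have sq: "(cos b1)\<^sup>2 = (c * tanh (x/2))\<^sup>2" "(cos b2)\<^sup>2 = (c * tanh (y/2))\<^sup>2" "(cos b3)\<^sup>2 = (c * tanh (z/2))\<^sup>2"
    using cb unfolding power_mult_distrib c_def by (simp_all add: field_simps power2_eq_square)
  have "cos b1 = c * tanh (x/2)" "cos b2 = c * tanh (y/2)" "cos b3 = c * tanh (z/2)"
    using sq cb c pos by (auto intro!: power2_eq_imp_eq)
  moreover have "sin (hyp_ang x y z) = cos b1" "sin (hyp_ang y z x) = cos b2" "sin (hyp_ang z x y) = cos b3"
    unfolding ang b1_def b2_def b3_def cos_sin_eq by (auto intro!: arg_cong[of _ _ sin] simp: field_simps)
  ultimately show "\<exists>c>0. sin (hyp_ang x y z) = c * tanh (x/2) \<and> sin (hyp_ang y z x) = c * tanh (y/2) \<and> sin (hyp_ang z x y) = c * tanh (z/2)"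
    using c by auto
next
  fix p q r :: "real \<Rightarrow> real" and s X Y Z :: real
  assume d: "(p has_real_derivative X) (at s)" "(q has_real_derivative Y) (at s)" "(r has_real_derivative Z) (at s)"
    and I: "p s \<in> {0<..}" "q s \<in> {0<..}" "r s \<in> {0<..}" and nd: "0 < hyp_gram (p s) (q s) (r s)"
  have pos: "0 < p s" "0 < q s" "0 < r s" using I by auto
  have nd': "0 < hyp_gram (q s) (r s) (p s)" "0 < hyp_gram (r s) (p s) (q s)" using nd hyp_gram_cyclic by metis+
  define T1 T2 T3 where T_def: "T1 = (\<lambda>s. carc (hyp_cos (p s) (q s) (r s)))" "T2 = (\<lambda>s. carc (hyp_cos (q s) (r s) (p s)))"
    "T3 = (\<lambda>s. carc (hyp_cos (r s) (p s) (q s)))"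
  obtain D1 D2 D3 where D: "(T1 has_real_derivative D1) (at s)" "(T2 has_real_derivative D2) (at s)" "(T3 has_real_derivative D3) (at s)"
    using hyp_angle_derivative[OF d pos nd] hyp_angle_derivative[OF d(2,3,1) pos(2,3,1) nd'(1)]
      hyp_angle_derivative[OF d(3,1,2) pos(3,1,2) nd'(2)] unfolding T_def by blast
  have cont: "isCont p s" "isCont q s" "isCont r s" using d by (auto intro: DERIV_isCont)
  have ev: "\<forall>\<^sub>F u in nhds s. 0 < f u" if "isCont f s" "0 < f s" for f :: "real \<Rightarrow> real"
    using that by (intro order_tendstoD(1)[of f "f s"]) (auto simp: isCont_def tendsto_nhds_iff)
  have "isCont (\<lambda>u. hyp_gram (p u) (q u) (r u)) s"
    unfolding hyp_gram_def gram_def by (intro continuous_intros cont)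
  \<comment> \<open>nearby triangles are nondegenerate as well, so the dual law of cosines can be differentiated\<close>
  note evs = ev[OF this nd] ev[OF cont(1) pos(1)] ev[OF cont(2) pos(2)] ev[OF cont(3) pos(3)]
  have law: "\<forall>\<^sub>F u in nhds s. cos (T1 u) + cos (T2 u) * cos (T3 u) = cosh (p u) * sin (T2 u) * sin (T3 u)"
      "\<forall>\<^sub>F u in nhds s. cos (T2 u) + cos (T3 u) * cos (T1 u) = cosh (q u) * sin (T3 u) * sin (T1 u)"
      "\<forall>\<^sub>F u in nhds s. cos (T3 u) + cos (T1 u) * cos (T2 u) = cosh (r u) * sin (T1 u) * sin (T2 u)"
    using evs by (eventually_elim, (simp add: T_def hyp_angles))+
  note T = hyp_angles[OF pos nd, folded fun_cong[OF T_def(1), of s, simplified] fun_cong[OF T_def(2), of s, simplified] fun_cong[OF T_def(3), of s, simplified]]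
  have T4: "T2 s + T3 s + T1 s < pi" "T3 s + T1 s + T2 s < pi" using T(4) by auto
  note z1 = hyp_half_edge_variation[OF T(1-4) pos(1) T(5) hyp_dual_law_derivative[OF D d(1) law(1)]]
   and z2 = hyp_half_edge_variation[OF T(2,3,1) T4(1) pos(2) T(6) hyp_dual_law_derivative[OF D(2,3,1) d(2) law(2)]]
   and z3 = hyp_half_edge_variation[OF T(3,1,2) T4(2) pos(3) T(7) hyp_dual_law_derivative[OF D(3,1,2) d(3) law(3)]]
  have rot: "T2 s + T3 s + T1 s = T1 s + T2 s + T3 s" "T3 s + T1 s + T2 s = T1 s + T2 s + T3 s"
     "D2 + D3 + D1 = D1 + D2 + D3" "D3 + D1 + D2 = D1 + D2 + D3" by simp_all
  note form = hyp_form_nonneg[OF T(1-4), of D1 D2 D3, folded z1 z2[unfolded rot] z3[unfolded rot]]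
  have dang: "((\<lambda>s. hyp_ang (p s) (q s) (r s)) has_real_derivative - ((D2+D3-D1)/2)) (at s)"
     "((\<lambda>s. hyp_ang (q s) (r s) (p s)) has_real_derivative - ((D3+D1-D2)/2)) (at s)"
     "((\<lambda>s. hyp_ang (r s) (p s) (q s)) has_real_derivative - ((D1+D2-D3)/2)) (at s)"
    unfolding hyp_ang_def using D unfolding T_def
    by (auto intro!: derivative_eq_intros simp: field_simps)
  show "positive_variation (\<lambda>s. hyp_ang (p s) (q s) (r s)) (\<lambda>s. hyp_ang (q s) (r s) (p s))
     (\<lambda>s. hyp_ang (r s) (p s) (q s)) (X / tanh (p s / 2)) (Y / tanh (q s / 2)) (Z / tanh (r s / 2)) s"
    unfolding positive_variation_def
    by (rule exI[of _ "- ((D2+D3-D1)/2)"], rule exI[of _ "- ((D3+D1-D2)/2)"], rule exI[of _ "- ((D1+D2-D3)/2)"])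
       (use dang form in auto)
qed

section \<open>Convexity of the space of triangles\<close>

lemma harmonic_cauchy:
  fixes A B C Y Z :: real
  assumes "0 < A" "0 < B" "A + B \<le> C"
  shows "(Y + Z)\<^sup>2 / C \<le> Y\<^sup>2 / A + Z\<^sup>2 / B"
proof -
  have "(Y + Z)\<^sup>2 / C \<le> (Y + Z)\<^sup>2 / (A + B)"
    using assms by (intro divide_left_mono) auto
  also have "\<dots> \<le> Y\<^sup>2 / A + Z\<^sup>2 / B"
  proof -
    have "Y\<^sup>2 / A + Z\<^sup>2 / B - (Y + Z)\<^sup>2 / (A + B) = (Y * B - Z * A)\<^sup>2 / (A * B * (A + B))"
      using assms by (simp add: divide_simps add_pos_pos less_imp_neq[symmetric]) algebra
    also have "\<dots> \<ge> 0" using assms by simp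
    finally show ?thesis by simp
  qed
  finally show ?thesis .
qed

text \<open>For \<open>L = y + z\<close> the inequality says that \<open>U(L) - U(x)\<close> is positive, where \<open>U' = \<sigma>\<^sup>p\<close>. Along the path
  \<open>U(x)\<close> is linear, and with \<open>r = \<sigma>' / \<sigma>\<close> the second derivative of \<open>U(L)\<close> is
  \<open>p \<sigma>(L)\<^sup>p (r(L) (y' + z')\<^sup>2 - r(y) y'\<^sup>2 - r(z) z'\<^sup>2)\<close>. It is not positive, because \<open>1 / r\<close> is superadditive.
  The applications are \<open>\<sigma> t = t\<close> with \<open>1 / r(t) = t\<close>, and \<open>\<sigma> t = tanh (t/2)\<close> with \<open>1 / r(t) = sinh t\<close>.\<close>

lemma triangle_inequality_along_straight_path:
  fixes \<sigma> \<sigma>' x y z :: "real \<Rightarrow> real" and p v1 v2 v3 :: real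
  assumes \<sigma>: "\<And>t. 0 < t \<Longrightarrow> 0 < \<sigma> t" "\<And>t. 0 < t \<Longrightarrow> 0 < \<sigma>' t"
      "\<And>t. 0 < t \<Longrightarrow> (\<sigma> has_real_derivative \<sigma>' t) (at t)"
    and super: "\<And>t u. 0 < t \<Longrightarrow> 0 < u \<Longrightarrow> \<sigma> t / \<sigma>' t + \<sigma> u / \<sigma>' u \<le> \<sigma> (t + u) / \<sigma>' (t + u)"
    and p: "0 \<le> p"
    and cont: "continuous_on {0..1} x" "continuous_on {0..1} y" "continuous_on {0..1} z"
    and pos: "\<And>s. s \<in> {0..1} \<Longrightarrow> 0 < x s" "\<And>s. s \<in> {0..1} \<Longrightarrow> 0 < y s" "\<And>s. s \<in> {0..1} \<Longrightarrow> 0 < z s"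
    and d: "\<And>s. s \<in> {0<..<1} \<Longrightarrow> (x has_real_derivative v1 / \<sigma> (x s) powr p) (at s)"
      "\<And>s. s \<in> {0<..<1} \<Longrightarrow> (y has_real_derivative v2 / \<sigma> (y s) powr p) (at s)"
      "\<And>s. s \<in> {0<..<1} \<Longrightarrow> (z has_real_derivative v3 / \<sigma> (z s) powr p) (at s)"
    and ends: "x 0 < y 0 + z 0" "x 1 < y 1 + z 1" and s: "s \<in> {0..1}"
  shows "x s < y s + z s"
proof -
  have "\<exists>U. \<forall>t. 0 < ereal t \<longrightarrow> ereal t < \<infinity> \<longrightarrow> (U has_vector_derivative \<sigma> t powr p) (at t)"
  proof (rule einterval_antiderivative)
    fix t :: real assume "0 < ereal t"
    then have "0 < t" by simp
    then have "isCont \<sigma> t" "\<sigma> t \<noteq> 0" using DERIV_isCont[OF \<sigma>(3)] \<sigma>(1)[of t] by auto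
    then show "isCont (\<lambda>t. \<sigma> t powr p) t" unfolding isCont_def by (intro tendsto_powr tendsto_const)
  qed simp
  then obtain U where dU: "\<And>t. 0 < t \<Longrightarrow> (U has_real_derivative \<sigma> t powr p) (at t)"
    by (auto simp: has_real_derivative_iff_has_vector_derivative)
  have U_mono: "U t < U u" if "0 < t" "t < u" for t u
  proof (rule DERIV_pos_imp_increasing[OF \<open>t < u\<close>])
    fix w assume "t \<le> w" "w \<le> u"
    then have "0 < w" using that by simp
    then show "\<exists>D. (U has_real_derivative D) (at w) \<and> 0 < D" using dU[of w] \<sigma>(1)[of w] by auto
  qed
  have U_less: "t < u \<longleftrightarrow> U t < U u" if "0 < t" "0 < u" for t u
    using U_mono[of t u] U_mono[of u t] that by (cases t u rule: linorder_cases) auto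
  have contU: "continuous_on {0<..} U"
    by (intro continuous_at_imp_continuous_on ballI, rule DERIV_isCont[OF dU]) simp
  define L where "L s = y s + z s" for s
  have Lpos: "0 < L s" if "s \<in> {0..1}" for s using pos that by (auto simp: L_def intro: add_pos_pos)
  have "0 < U (L s) - U (x s)"
  proof (rule positive_between_if_concave[where g = "\<lambda>s. U (L s) - U (x s)"
        and g' = "\<lambda>s. v2 * (\<sigma> (L s) / \<sigma> (y s)) powr p + v3 * (\<sigma> (L s) / \<sigma> (z s)) powr p - v1"])
    show "continuous_on {0..1} (\<lambda>s. U (L s) - U (x s))"
      using pos Lpos unfolding L_def
      by (intro continuous_intros continuous_on_compose2[OF contU] cont) auto
    show "0 < U (L 0) - U (x 0)" "0 < U (L 1) - U (x 1)"
      using ends U_less Lpos pos by (auto simp: L_def)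
    show "0 \<le> s" "s \<le> 1" using s by auto
  next
    fix s :: real assume "0 < s" "s < 1"
    then have s: "s \<in> {0<..<1}" and s': "s \<in> {0..1}" by auto
    note P = pos[OF s'] Lpos[OF s']
    note S = P(1,2,3,4)[THEN \<sigma>(1)] and S' = P(1,2,3,4)[THEN \<sigma>(2)]
    define Y Z where "Y = v2 / \<sigma> (y s) powr p" and "Z = v3 / \<sigma> (z s) powr p"
    have dL: "(L has_real_derivative Y + Z) (at s)"
      unfolding L_def Y_def Z_def by (intro DERIV_add d s)
    have pw: "v2 * (\<sigma> (L s) / \<sigma> (y s)) powr p = \<sigma> (L s) powr p * Y" "v3 * (\<sigma> (L s) / \<sigma> (z s)) powr p = \<sigma> (L s) powr p * Z"
      using S by (simp_all add: Y_def Z_def powr_divide)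
    have "((\<lambda>s. U (L s) - U (x s)) has_real_derivative \<sigma> (L s) powr p * (Y + Z) - \<sigma> (x s) powr p * (v1 / \<sigma> (x s) powr p)) (at s)"
      by (intro DERIV_diff DERIV_chain2[OF dU] P dL d s)
    moreover have "\<sigma> (x s) powr p * (v1 / \<sigma> (x s) powr p) = v1" using S by simp
    ultimately show "((\<lambda>s. U (L s) - U (x s)) has_real_derivative v2 * (\<sigma> (L s) / \<sigma> (y s)) powr p + v3 * (\<sigma> (L s) / \<sigma> (z s)) powr p - v1) (at s)"
      unfolding pw by (simp add: distrib_left)
    define r where "r t = \<sigma>' t / \<sigma> t" for t
    \<comment> \<open>stated for \<open>y\<close> and \<open>z\<close> together\<close>
    have quot: "((\<lambda>s. (\<sigma> (L s) / \<sigma> (w s)) powr p) has_real_derivative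
        p * (\<sigma> (L s) / \<sigma> (w s)) powr p * (r (L s) * (Y + Z) - r (w s) * W)) (at s)"
      if w: "(w has_real_derivative W) (at s)" "0 < w s" for w W
    proof -
      note Sw = \<sigma>(1)[OF w(2)]
      have q: "((\<lambda>s. \<sigma> (L s) / \<sigma> (w s)) has_real_derivative
         (\<sigma>' (L s) * (Y + Z) * \<sigma> (w s) - \<sigma> (L s) * (\<sigma>' (w s) * W)) / (\<sigma> (w s) * \<sigma> (w s))) (at s)"
        using Sw by (intro DERIV_divide DERIV_chain2[OF \<sigma>(3)] P dL w) auto
      have "0 < \<sigma> (L s) / \<sigma> (w s)" using Sw S by simp
      from DERIV_chain2[OF has_real_derivative_powr[OF this] q]
      have "((\<lambda>s. (\<sigma> (L s) / \<sigma> (w s)) powr p) has_real_derivative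
         p * (\<sigma> (L s) / \<sigma> (w s)) powr (p - 1) *
         ((\<sigma>' (L s) * (Y + Z) * \<sigma> (w s) - \<sigma> (L s) * (\<sigma>' (w s) * W)) / (\<sigma> (w s) * \<sigma> (w s)))) (at s)" .
      moreover have "(\<sigma> (L s) / \<sigma> (w s)) powr (p - 1) *
         ((\<sigma>' (L s) * (Y + Z) * \<sigma> (w s) - \<sigma> (L s) * (\<sigma>' (w s) * W)) / (\<sigma> (w s) * \<sigma> (w s)))
          = (\<sigma> (L s) / \<sigma> (w s)) powr p * (r (L s) * (Y + Z) - r (w s) * W)"
        using Sw S(4) by (simp add: powr_diff r_def field_simps)
      ultimately show ?thesis by (simp only: mult.assoc)
    qed
    have dy: "(y has_real_derivative Y) (at s)" and dz: "(z has_real_derivative Z) (at s)"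
      unfolding Y_def Z_def by (intro d s)+
    have der: "((\<lambda>s. v2 * (\<sigma> (L s) / \<sigma> (y s)) powr p + v3 * (\<sigma> (L s) / \<sigma> (z s)) powr p - v1) has_real_derivative
        v2 * (p * (\<sigma> (L s) / \<sigma> (y s)) powr p * (r (L s) * (Y + Z) - r (y s) * Y))
        + v3 * (p * (\<sigma> (L s) / \<sigma> (z s)) powr p * (r (L s) * (Y + Z) - r (z s) * Z)) - 0) (at s)"
      by (intro DERIV_diff DERIV_add DERIV_cmult quot dy dz P DERIV_const)
    have D_eq: "v2 * (p * (\<sigma> (L s) / \<sigma> (y s)) powr p * (r (L s) * (Y + Z) - r (y s) * Y))
        + v3 * (p * (\<sigma> (L s) / \<sigma> (z s)) powr p * (r (L s) * (Y + Z) - r (z s) * Z)) - 0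
        = - (p * \<sigma> (L s) powr p * (r (y s) * Y\<^sup>2 + r (z s) * Z\<^sup>2 - r (L s) * (Y + Z)\<^sup>2))" (is "?D = _")
    proof -
      have "?D = p * (v2 * (\<sigma> (L s) / \<sigma> (y s)) powr p) * (r (L s) * (Y + Z) - r (y s) * Y)
        + p * (v3 * (\<sigma> (L s) / \<sigma> (z s)) powr p) * (r (L s) * (Y + Z) - r (z s) * Z)" by simp
      also have "\<dots> = - (p * \<sigma> (L s) powr p * (r (y s) * Y\<^sup>2 + r (z s) * Z\<^sup>2 - r (L s) * (Y + Z)\<^sup>2))"
        unfolding pw by (simp add: algebra_simps power2_eq_square)
      finally show ?thesis .
    qed
    have nonneg: "0 \<le> p * \<sigma> (L s) powr p * (r (y s) * Y\<^sup>2 + r (z s) * Z\<^sup>2 - r (L s) * (Y + Z)\<^sup>2)"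
    proof -
      have "(Y + Z)\<^sup>2 / (\<sigma> (L s) / \<sigma>' (L s)) \<le> Y\<^sup>2 / (\<sigma> (y s) / \<sigma>' (y s)) + Z\<^sup>2 / (\<sigma> (z s) / \<sigma>' (z s))"
        using super[OF P(2,3)] S S' by (intro harmonic_cauchy) (auto simp: L_def)
      then have "r (L s) * (Y + Z)\<^sup>2 \<le> r (y s) * Y\<^sup>2 + r (z s) * Z\<^sup>2"
        by (simp add: r_def mult.commute)
      then show ?thesis using p by simp
    qed
    have "?D \<le> 0" unfolding D_eq using nonneg by simp
    with der show "\<exists>D\<le>0. ((\<lambda>s. v2 * (\<sigma> (L s) / \<sigma> (y s)) powr p + v3 * (\<sigma> (L s) / \<sigma> (z s)) powr p - v1) has_real_derivative D) (at s)"
      by blast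
  qed
  then show ?thesis using U_less[OF pos(1)[OF s] Lpos[OF s]] by (simp add: L_def)
qed

lemma euc_gram_pos_iff:
  assumes "0 < x" "0 < y" "0 < z"
  shows "0 < euc_gram x y z \<longleftrightarrow> x < y + z \<and> y < z + x \<and> z < x + y"
proof -
  have "euc_gram x y z = (x + y + z) * ((y + z - x) * (z + x - y) * (x + y - z))"
    unfolding euc_gram_def by algebra
  then have "0 < euc_gram x y z \<longleftrightarrow> 0 < (y + z - x) * (z + x - y) * (x + y - z)"
    using assms by (simp add: zero_less_mult_iff)
  also have "\<dots> \<longleftrightarrow> x < y + z \<and> y < z + x \<and> z < x + y"
    using assms by (auto simp: zero_less_mult_iff mult_less_0_iff)
  finally show ?thesis .
qed

lemma hyp_gram_pos_iff:
  assumes "0 < x" "0 < y" "0 < z"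
  shows "0 < hyp_gram x y z \<longleftrightarrow> x < y + z \<and> y < z + x \<and> z < x + y"
proof -
  have s: "0 < sinh y * sinh z" using assms by simp
  have "0 < hyp_gram x y z \<longleftrightarrow> \<bar>hyp_cos x y z\<bar> < 1"
    using assms hyp_cos_less_1 by blast
  also have "\<dots> \<longleftrightarrow> cosh x < cosh (y + z) \<and> cosh (y - z) < cosh x"
    using s unfolding hyp_cos_def abs_less_iff cosh_add cosh_diff
    by (simp add: divide_less_eq less_divide_eq minus_divide_left del: minus_divide_left[symmetric]) argo
  also have "\<dots> \<longleftrightarrow> x < y + z \<and> \<bar>y - z\<bar> < x"
    using cosh_real_nonneg_less_iff[of "\<bar>y - z\<bar>" x] assms by (simp add: cosh_real_nonneg_less_iff)
  finally show ?thesis by (auto simp: abs_less_iff)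
qed

lemma euclidean_straight: "h \<le> -1 \<Longrightarrow> euclidean.straight_paths_nondegenerate h"
  unfolding euclidean.straight_paths_nondegenerate_def
proof (intro allI impI ballI, elim conjE)
  fix x :: "nat \<Rightarrow> real \<Rightarrow> real" and v :: "nat \<Rightarrow> real" and s :: real
  assume h: "h \<le> -1" and cI: "\<forall>i. continuous_on {0..1} (x i) \<and> x i ` {0..1} \<subseteq> {0<..}"
    and d: "\<forall>i. \<forall>s\<in>{0<..<1}. (x i has_real_derivative v i / x i s powr (-h-1)) (at s)"
    and e: "0 < euc_gram (x 0 0) (x 1 0) (x 2 0)" "0 < euc_gram (x 0 1) (x 1 1) (x 2 1)" and s: "s \<in> {0..1}"
  have pos: "0 < x i u" if "u \<in> {0..1}" for i u using cI that by blast
  have e': "x 0 u < x 1 u + x 2 u \<and> x 1 u < x 2 u + x 0 u \<and> x 2 u < x 0 u + x 1 u" if "u = 0 \<or> u = 1" for u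
    using e that euc_gram_pos_iff[OF pos[of u 0] pos[of u 1] pos[of u 2]] by auto
  have "x i s < x j s + x k s" if "x i 0 < x j 0 + x k 0" "x i 1 < x j 1 + x k 1" for i j k
    by (rule triangle_inequality_along_straight_path[where x = "x i" and y = "x j" and z = "x k" and ?v1.0 = "v i" and ?v2.0 = "v j" and ?v3.0 = "v k" and s = s and \<sigma> = "\<lambda>t. t" and \<sigma>' = "\<lambda>_. 1" and p = "-h-1"])
      (use h cI d s that pos in auto)
  then show "0 < euc_gram (x 0 s) (x 1 s) (x 2 s)"
    using euc_gram_pos_iff[OF pos[OF s, of 0] pos[OF s, of 1] pos[OF s, of 2]] e'[of 0] e'[of 1] by blast
qed

lemma hyperbolic_straight: "h \<le> -1 \<Longrightarrow> hyperbolic.straight_paths_nondegenerate h"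
  unfolding hyperbolic.straight_paths_nondegenerate_def
proof (intro allI impI ballI, elim conjE)
  fix x :: "nat \<Rightarrow> real \<Rightarrow> real" and v :: "nat \<Rightarrow> real" and s :: real
  assume h: "h \<le> -1" and cI: "\<forall>i. continuous_on {0..1} (x i) \<and> x i ` {0..1} \<subseteq> {0<..}"
    and d: "\<forall>i. \<forall>s\<in>{0<..<1}. (x i has_real_derivative v i / tanh (x i s / 2) powr (-h-1)) (at s)"
    and e: "0 < hyp_gram (x 0 0) (x 1 0) (x 2 0)" "0 < hyp_gram (x 0 1) (x 1 1) (x 2 1)" and s: "s \<in> {0..1}"
  have pos: "0 < x i u" if "u \<in> {0..1}" for i u using cI that by blast
  have e': "x 0 u < x 1 u + x 2 u \<and> x 1 u < x 2 u + x 0 u \<and> x 2 u < x 0 u + x 1 u" if "u = 0 \<or> u = 1" for u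
    using e that hyp_gram_pos_iff[OF pos[of u 0] pos[of u 1] pos[of u 2]] by auto
  have dtanh: "((\<lambda>t. tanh (t/2)) has_real_derivative 1 / (2 * (cosh (t/2))\<^sup>2)) (at t)" for t :: real
    by (auto intro!: derivative_eq_intros simp: tanh_def divide_simps sinh_squared_eq power2_eq_square)
      (use sinh_squared_eq[of "t/2"] in \<open>simp add: power2_eq_square\<close>)
  have ratio: "tanh (t/2) / (1 / (2 * (cosh (t/2))\<^sup>2)) = sinh t" for t :: real
    using sinh_double[of "t/2"] by (simp add: tanh_def power2_eq_square)
  have "x i s < x j s + x k s" if "x i 0 < x j 0 + x k 0" "x i 1 < x j 1 + x k 1" for i j k
  proof (rule triangle_inequality_along_straight_path[where x = "x i" and y = "x j" and z = "x k" and ?v1.0 = "v i" and ?v2.0 = "v j" and ?v3.0 = "v k" and s = s and \<sigma> = "\<lambda>t. tanh (t/2)" and \<sigma>' = "\<lambda>t. 1 / (2 * (cosh (t/2))\<^sup>2)" and p = "-h-1"])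
    fix t u :: real assume tu: "0 < t" "0 < u"
    have "sinh t * 1 + 1 * sinh u \<le> sinh t * cosh u + cosh t * sinh u"
      using tu by (intro add_mono mult_mono) (auto simp: cosh_real_ge_1)
    then show "tanh (t/2) / (1 / (2 * (cosh (t/2))\<^sup>2)) + tanh (u/2) / (1 / (2 * (cosh (u/2))\<^sup>2))
        \<le> tanh ((t+u)/2) / (1 / (2 * (cosh ((t+u)/2))\<^sup>2))"
      unfolding ratio by (simp add: sinh_add)
  qed (use h cI d s that pos dtanh in auto)
  then show "0 < hyp_gram (x 0 s) (x 1 s) (x 2 s)"
    using hyp_gram_pos_iff[OF pos[OF s, of 0] pos[OF s, of 1] pos[OF s, of 2]] e'[of 0] e'[of 1] by blast
qed

section \<open>The pair inequality in the three geometries\<close>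

text \<open>The sides of the polar triangle are the supplements of the angles, and conversely.\<close>

lemma sph_polar:
  assumes "x \<in> {0<..<pi}" "y \<in> {0<..<pi}" "z \<in> {0<..<pi}" and nd: "0 < sph_gram x y z"
  defines "t1 \<equiv> carc (sph_cos x y z)" and "t2 \<equiv> carc (sph_cos y z x)" and "t3 \<equiv> carc (sph_cos z x y)"
  shows "0 < sph_gram (pi - t1) (pi - t2) (pi - t3)"
    and "carc (sph_cos (pi - t1) (pi - t2) (pi - t3)) = pi - x"
    and "t1 \<in> {0<..<pi}" "t2 \<in> {0<..<pi}" "t3 \<in> {0<..<pi}"
proof -
  have pos: "0 < sin x" "0 < sin y" "0 < sin z" using assms by (auto intro: sin_gt_zero)
  have g: "sph_gram y z x = sph_gram x y z" "sph_gram z x y = sph_gram x y z"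
    using sph_gram_cyclic by metis+
  have lt: "\<bar>sph_cos x y z\<bar> < 1" "\<bar>sph_cos y z x\<bar> < 1" "\<bar>sph_cos z x y\<bar> < 1"
    using pos nd g by (simp_all add: sph_cos_less_1)
  show t: "t1 \<in> {0<..<pi}" "t2 \<in> {0<..<pi}" "t3 \<in> {0<..<pi}"
    using lt carc_bounds unfolding t1_def t2_def t3_def by auto
  have c: "cos t1 = sph_cos x y z" "cos t2 = sph_cos y z x" "cos t3 = sph_cos z x y"
    using lt by (simp_all add: t1_def t2_def t3_def cos_carc)
  have s: "0 < sin t2" "0 < sin t3" using t by (auto intro: sin_gt_zero)
  have "0 < (sin x * sin y * sin z)\<^sup>2" using pos by simp
  moreover have "0 < (sph_gram x y z)\<^sup>2" using nd by simp
  ultimately have "0 < 1 - (cos t1)\<^sup>2 - (cos t2)\<^sup>2 - (cos t3)\<^sup>2 - 2 * cos t1 * cos t2 * cos t3"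
    using sph_angle_gram[OF pos] unfolding c by (metis zero_less_mult_pos2)
  then show "0 < sph_gram (pi - t1) (pi - t2) (pi - t3)"
    by (simp add: sph_gram_def gram_def cos_diff)
  have "cos t1 + cos t2 * cos t3 = cos x * sin t2 * sin t3"
    using sph_dual_cosine_law[OF pos nd] unfolding c by (simp add: t2_def t3_def)
  moreover have "sph_cos (pi - t1) (pi - t2) (pi - t3) = - (cos t1 + cos t2 * cos t3) / (sin t2 * sin t3)"
    by (simp add: sph_cos_def cos_diff sin_diff)
  ultimately have "sph_cos (pi - t1) (pi - t2) (pi - t3) = - (cos x * sin t2 * sin t3) / (sin t2 * sin t3)"
    by (simp only:)
  then have "sph_cos (pi - t1) (pi - t2) (pi - t3) = cos (pi - x)" using s by (simp add: cos_diff)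
  then show "carc (sph_cos (pi - t1) (pi - t2) (pi - t3)) = pi - x"
    using assms by (simp add: carc_eq_arccos arccos_cos del: cos_pi_minus)
qed

lemma euclidean_pair_inequality:
  assumes "\<And>x. x \<in> {0<..} \<Longrightarrow> (U has_real_derivative x powr (-h-1)) (at x)"
    and "\<And>t. 0 < t \<Longrightarrow> t < pi \<Longrightarrow> (F has_real_derivative sin t powr h) (at t)"
  shows "euclidean.pair_rigid U F"
  by (rule euclidean.pair_rigidI[OF assms]) (use euclidean_straight[of h] in linarith)+

lemma hyperbolic_pair_inequality:
  assumes "\<And>x. x \<in> {0<..} \<Longrightarrow> (U has_real_derivative tanh (x/2) powr (-h-1)) (at x)"
    and "\<And>t. 0 < t \<Longrightarrow> t < pi \<Longrightarrow> (F has_real_derivative sin t powr h) (at t)"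
  shows "hyperbolic.pair_rigid U F"
  by (rule hyperbolic.pair_rigidI[OF assms]) (use hyperbolic_straight[of h] in linarith)+

text \<open>Passing to the polar triangles interchanges the roles of \<open>U\<close> and \<open>F\<close>, up to sign, and turns the exponent \<open>h\<close>
  into \<open>-1 - h\<close>, while the sum stays the same. This reduces \<open>h \<le> -1\<close> to a nonnegative exponent.\<close>

lemma spherical_pair_inequality:
  assumes dU: "\<And>x. x \<in> {0<..<pi} \<Longrightarrow> (U has_real_derivative sin x powr (-h-1)) (at x)"
    and dF: "\<And>t. 0 < t \<Longrightarrow> t < pi \<Longrightarrow> (F has_real_derivative sin t powr h) (at t)"
  shows "spherical.pair_rigid U F"
proof (cases "h > -1")
  case True
  then show ?thesis by (intro spherical.pair_rigidI[OF dU dF]) auto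
next
  case False
  define h' where "h' = -1 - h"
  define U' F' where "U' x = - F (pi - x)" and "F' t = - U (pi - t)" for x t
  have dU': "(U' has_real_derivative sin x powr (-h'-1)) (at x)" if "x \<in> {0<..<pi}" for x
  proof -
    have "((\<lambda>x. - F (pi - x)) has_real_derivative - (sin (pi - x) powr h * (0 - 1))) (at x)"
      by (intro DERIV_minus DERIV_chain2[OF dF] DERIV_diff DERIV_const DERIV_ident) (use that in auto)
    then show ?thesis unfolding U'_def h'_def by simp
  qed
  have dF': "(F' has_real_derivative sin t powr h') (at t)" if "0 < t" "t < pi" for t
  proof -
    have "((\<lambda>x. - U (pi - x)) has_real_derivative - (sin (pi - t) powr (-h-1) * (0 - 1))) (at t)"
      by (intro DERIV_minus DERIV_chain2[OF dU] DERIV_diff DERIV_const DERIV_ident) (use that in auto)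
    then show ?thesis unfolding F'_def h'_def by (simp add: minus_diff_commute)
  qed
  have h': "h' > -1 \<or> spherical.straight_paths_nondegenerate h'" using False by (simp add: h'_def)
  show ?thesis unfolding spherical.pair_rigid_def Let_def
  proof (intro allI impI, elim conjE)
    fix x y z x' y' z' :: real
    assume l: "x \<in> {0<..<pi}" "y \<in> {0<..<pi}" "z \<in> {0<..<pi}" "0 < sph_gram x y z"
      and m: "x' \<in> {0<..<pi}" "y' \<in> {0<..<pi}" "z' \<in> {0<..<pi}" "0 < sph_gram x' y' z'"
    have lc: "0 < sph_gram y z x" "0 < sph_gram z x y" and mc: "0 < sph_gram y' z' x'" "0 < sph_gram z' x' y'"
      using l m sph_gram_cyclic by metis+
    define t1 t2 t3 where t: "t1 = carc (sph_cos x y z)" "t2 = carc (sph_cos y z x)" "t3 = carc (sph_cos z x y)"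
    define t1' t2' t3' where t': "t1' = carc (sph_cos x' y' z')" "t2' = carc (sph_cos y' z' x')" "t3' = carc (sph_cos z' x' y')"
    note p = sph_polar[OF l, folded t] and p' = sph_polar[OF m, folded t']
    note polar = p(2) sph_polar(2)[OF l(2,3,1) lc(1), folded t] sph_polar(2)[OF l(3,1,2) lc(2), folded t]
      p'(2) sph_polar(2)[OF m(2,3,1) mc(1), folded t'] sph_polar(2)[OF m(3,1,2) mc(2), folded t']
    have I: "pi - t1 \<in> {0<..<pi}" "pi - t2 \<in> {0<..<pi}" "pi - t3 \<in> {0<..<pi}"
      "pi - t1' \<in> {0<..<pi}" "pi - t2' \<in> {0<..<pi}" "pi - t3' \<in> {0<..<pi}"
      using p(3-5) p'(3-5) by auto
    let ?S = "(U x' - U x) * (F t1' - F t1) + (U y' - U y) * (F t2' - F t2) + (U z' - U z) * (F t3' - F t3)"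
    have S: "(U' (pi - t1') - U' (pi - t1)) * (F' (pi - x') - F' (pi - x))
       + (U' (pi - t2') - U' (pi - t2)) * (F' (pi - y') - F' (pi - y))
       + (U' (pi - t3') - U' (pi - t3)) * (F' (pi - z') - F' (pi - z)) = ?S"
      by (simp add: U'_def F'_def algebra_simps)
    note pair = spherical.pair_inequality[OF dU' dF' h' I(1-3) p(1) I(4-6) p'(1), unfolded polar S]
    have "?S = 0 \<Longrightarrow> x = x' \<and> y = y' \<and> z = z'" using pair(2) by simp
    then show "0 \<le> ?S \<and> (?S = 0 \<longrightarrow> t1 = t1' \<and> t2 = t2' \<and> t3 = t3')"
      using pair(1) unfolding t t' by blast
  qed
qed

section \<open>Triangles and their angles\<close>

lemma euc_sides_proportional:
  assumes "0 < x" "0 < y" "0 < z" "0 < euc_gram x y z" "0 < x'" "0 < y'" "0 < z'" "0 < euc_gram x' y' z'"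
    and "carc (euc_cos x y z) = carc (euc_cos x' y' z')" "carc (euc_cos y z x) = carc (euc_cos y' z' x')"
      "carc (euc_cos z x y) = carc (euc_cos z' x' y')"
  shows "x' / x = y' / y \<and> y' / y = z' / z"
proof -
  obtain c where c: "c > 0" "sin (carc (euc_cos x y z)) = c * x" "sin (carc (euc_cos y z x)) = c * y" "sin (carc (euc_cos z x y)) = c * z"
    using euclidean.sine_law[of x y z] assms by auto
  obtain c' where c': "c' > 0" "sin (carc (euc_cos x' y' z')) = c' * x'" "sin (carc (euc_cos y' z' x')) = c' * y'" "sin (carc (euc_cos z' x' y')) = c' * z'"
    using euclidean.sine_law[of x' y' z'] assms by auto
  have "c * x = c' * x'" "c * y = c' * y'" "c * z = c' * z'" using c c' assms by simp_all
  then have "x' / x = c / c'" "y' / y = c / c'" "z' / z = c / c'"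
    using c(1) c'(1) assms by (simp_all add: frac_eq_eq mult.commute)
  then show ?thesis by simp
qed

lemma sph_side_determined:
  assumes l: "x \<in> {0<..<pi}" "y \<in> {0<..<pi}" "z \<in> {0<..<pi}" "0 < sph_gram x y z"
    and m: "x' \<in> {0<..<pi}" "y' \<in> {0<..<pi}" "z' \<in> {0<..<pi}" "0 < sph_gram x' y' z'"
    and "carc (sph_cos x y z) = carc (sph_cos x' y' z')" "carc (sph_cos y z x) = carc (sph_cos y' z' x')"
      "carc (sph_cos z x y) = carc (sph_cos z' x' y')"
  shows "x = x'"
  using sph_polar(2)[OF l] sph_polar(2)[OF m] assms by simp

lemma hyp_side_determined:
  assumes l: "0 < x" "0 < y" "0 < z" "0 < hyp_gram x y z" and m: "0 < x'" "0 < y'" "0 < z'" "0 < hyp_gram x' y' z'"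
    and a: "hyp_ang x y z = hyp_ang x' y' z'" "hyp_ang y z x = hyp_ang y' z' x'" "hyp_ang z x y = hyp_ang z' x' y'"
  shows "x = x'"
proof -
  let ?t1 = "carc (hyp_cos x y z)" and ?t2 = "carc (hyp_cos y z x)" and ?t3 = "carc (hyp_cos z x y)"
  have e: "carc (hyp_cos x' y' z') = ?t1" "carc (hyp_cos y' z' x') = ?t2" "carc (hyp_cos z' x' y') = ?t3"
    using a by (auto simp: hyp_ang_def)
  have s: "0 < sin ?t2" "0 < sin ?t3" using hyp_angles(1-4)[OF l] by (auto intro!: sin_gt_zero)
  have "cosh x * sin ?t2 * sin ?t3 = cosh x' * sin ?t2 * sin ?t3"
    by (rule trans[OF hyp_angles(5)[OF l, symmetric] hyp_angles(5)[OF m, unfolded e]])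
  then have "cosh x = cosh x'" using s by simp
  then show ?thesis using l(1) m(1) by (metis cosh_real_nonneg_less_iff less_imp_le less_irrefl linorder_neqE_linordered_idom)
qed

lemma euc_angle_sum:
  assumes pos: "0 < x" "0 < y" "0 < z" and nd: "0 < euc_gram x y z"
  shows "carc (euc_cos x y z) + carc (euc_cos y z x) + carc (euc_cos z x y) = pi"
proof -
  have g: "euc_gram y z x = euc_gram x y z" "euc_gram z x y = euc_gram x y z"
    using euc_gram_cyclic by metis+
  have lt: "\<bar>euc_cos x y z\<bar> < 1" "\<bar>euc_cos y z x\<bar> < 1" "\<bar>euc_cos z x y\<bar> < 1"
    using pos nd g by (simp_all add: euc_cos_less_1)
  have law: "euc_cos x y z + euc_cos y z x * euc_cos z x y = sin (carc (euc_cos y z x)) * sin (carc (euc_cos z x y))"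
    if pos: "0 < x" "0 < y" "0 < z" and nd: "0 < euc_gram x y z" for x y z
  proof -
    have g: "euc_gram y z x = euc_gram x y z" "euc_gram z x y = euc_gram x y z"
      using euc_gram_cyclic by metis+
    have "sin (carc (euc_cos y z x)) * sin (carc (euc_cos z x y)) = (sqrt (euc_gram x y z) * sqrt (euc_gram x y z)) / (4 * x\<^sup>2 * y * z)"
      using pos nd g by (simp add: euc_sin power2_eq_square)
    also have "\<dots> = euc_gram x y z / (4 * x\<^sup>2 * y * z)" using nd by simp
    also have "euc_gram x y z = (y\<^sup>2 + z\<^sup>2 - x\<^sup>2) * (2 * x\<^sup>2) + (z\<^sup>2 + x\<^sup>2 - y\<^sup>2) * (x\<^sup>2 + y\<^sup>2 - z\<^sup>2)"
      unfolding euc_gram_def by algebra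
    also have "\<dots> / (4 * x\<^sup>2 * y * z) = (y\<^sup>2 + z\<^sup>2 - x\<^sup>2) * (2 * x\<^sup>2) / (4 * x\<^sup>2 * y * z)
        + (z\<^sup>2 + x\<^sup>2 - y\<^sup>2) * (x\<^sup>2 + y\<^sup>2 - z\<^sup>2) / (4 * x\<^sup>2 * y * z)" by (rule add_divide_distrib)
    also have "(y\<^sup>2 + z\<^sup>2 - x\<^sup>2) * (2 * x\<^sup>2) / (4 * x\<^sup>2 * y * z) = euc_cos x y z"
      using pos by (simp add: euc_cos_def divide_simps)
    also have "(z\<^sup>2 + x\<^sup>2 - y\<^sup>2) * (x\<^sup>2 + y\<^sup>2 - z\<^sup>2) / (4 * x\<^sup>2 * y * z) = euc_cos y z x * euc_cos z x y"
      by (simp add: euc_cos_def power2_eq_square mult_ac)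
    finally show ?thesis by simp
  qed
  define t1 t2 t3 where t: "t1 = carc (euc_cos x y z)" "t2 = carc (euc_cos y z x)" "t3 = carc (euc_cos z x y)"
  have T: "0 < t1" "t1 < pi" "0 < t2" "t2 < pi" "0 < t3" "t3 < pi" using lt carc_bounds unfolding t by blast+
  have key: "a = pi - b - c \<or> a = b + c - pi"
    if "0 < a" "a < pi" "0 < b" "b < pi" "0 < c" "c < pi" "cos a + cos b * cos c = sin b * sin c" for a b c :: real
  proof (cases "b + c \<le> pi")
    case True
    have "cos a = cos (pi - (b + c))" using that(7) by (simp add: cos_add)
    then have "a = pi - (b + c)" by (rule cos_inj_pi[rotated 4]) (use True that in linarith)+
    then show ?thesis by simp
  next
    case False
    have "cos a = cos (b + c - pi)" using that(7) by (simp add: cos_add cos_diff)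
    then have "a = b + c - pi" by (rule cos_inj_pi[rotated 4]) (use False that in linarith)+
    then show ?thesis by simp
  qed
  have c: "cos t1 = euc_cos x y z" "cos t2 = euc_cos y z x" "cos t3 = euc_cos z x y"
    using lt by (simp_all add: t cos_carc)
  have "t1 = pi - t2 - t3 \<or> t1 = t2 + t3 - pi"
    using law[OF pos nd] T by (intro key) (simp_all add: c t[symmetric])
  moreover have "t3 = pi - t1 - t2 \<or> t3 = t1 + t2 - pi"
    using law[of z x y] pos nd g T by (intro key) (simp_all add: c t[symmetric])
  ultimately have "t1 + t2 + t3 = pi" using T by argo
  then show ?thesis by (simp add: t)
qed

lemma sph_gram_pos:
  assumes "triangle_lengths Spherical x y z"
  shows "0 < sph_gram x y z"
proof -
  have a: "0 < x" "x < pi" "0 < y" "y < pi" "0 < z" "z < pi" "x < y + z" "y < z + x" "z < x + y" "x + y + z < 2 * pi"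
    using assms by auto
  have s: "0 < sin y" "0 < sin z" using a by (auto intro: sin_gt_zero)
  have lower: "cos (y + z) < cos x"
  proof (cases "y + z \<le> pi")
    case True then show ?thesis using a by (simp add: cos_mono_less_eq)
  next
    case False
    have "cos (2 * pi - (y + z)) < cos x" using a False by (subst cos_mono_less_eq) auto
    then show ?thesis by (simp add: cos_diff)
  qed
  have "cos x < cos \<bar>y - z\<bar>" using a by (subst cos_mono_less_eq) auto
  then have upper: "cos x < cos (y - z)" by simp
  have "\<bar>cos x - cos y * cos z\<bar> < sin y * sin z"
    using lower upper by (simp add: cos_add cos_diff abs_less_iff)
  then have "\<bar>sph_cos x y z\<bar> < 1" using s by (simp add: sph_cos_def abs_mult)
  then show ?thesis using sph_cos_less_1 s by simp
qed

section \<open>Sides of the triangles of a complex\<close>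

lemma triangle_cases:
  fixes K :: "'v::euclidean_space set set"
  assumes K: "simplicial_complex K" and t: "t \<in> triangles K"
  obtains a b c where "t = convex hull {a, b, c}" "\<not> affine_dependent {a, b, c}" "a \<noteq> b" "b \<noteq> c" "a \<noteq> c"
    "sides K t = {convex hull {b, c}, convex hull {c, a}, convex hull {a, b}}"
    "distinct [convex hull {b, c}, convex hull {c, a}, convex hull {a, b}]"
proof -
  have tK: "t \<in> K" and t2: "2 simplex t" using t by (auto simp: triangles_def)
  obtain C where C: "\<not> affine_dependent C" "int (card C) = 2 + 1" "t = convex hull C"
    using t2 unfolding simplex_def by blast
  have "card C = 3" using C(2) by simp
  then obtain a b c where abc: "C = {a, b, c}" "a \<noteq> b" "b \<noteq> c" "a \<noteq> c"
    by (metis card_3_iff)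
  have indep: "\<not> affine_dependent S" if "S \<subseteq> {a, b, c}" for S
    using C(1) abc(1) that affine_independent_subset by blast
  have face: "convex hull S \<in> K" if "S \<subseteq> {a, b, c}" for S
  proof -
    have "convex hull S face_of t"
      unfolding C(3) abc(1) using that face_of_convex_hull_affine_independent[OF indep[OF subset_refl]] by blast
    then show ?thesis using K tK unfolding simplicial_complex_def by blast
  qed
  have pair: "convex hull {p, q} \<in> sides K t" if "{p, q} \<subseteq> {a, b, c}" "p \<noteq> q" for p q
    unfolding sides_def edges_def
  proof (intro CollectI conjI)
    show "convex hull {p, q} \<in> K" using face[OF that(1)] .
    show "1 simplex convex hull {p, q}"
      unfolding simplex_def using indep[OF that(1)] that(2) by (intro exI[of _ "{p, q}"]) auto
    show "convex hull {p, q} \<subseteq> t" unfolding C(3) abc(1) by (rule hull_mono[OF that(1)])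
  qed
  have inj: "S = S'" if "convex hull S = convex hull S'" "S \<subseteq> {a, b, c}" "S' \<subseteq> {a, b, c}" for S S'
    using that extreme_point_of_convex_hull_affine_independent[OF indep[OF that(2)]]
      extreme_point_of_convex_hull_affine_independent[OF indep[OF that(3)]] by auto
  have "e \<in> {convex hull {b, c}, convex hull {c, a}, convex hull {a, b}}" if e: "e \<in> sides K t" for e
  proof -
    have eK: "e \<in> K" "1 simplex e" "e \<subseteq> t" using e by (auto simp: sides_def edges_def)
    then have "e \<inter> t face_of t" using K tK unfolding simplicial_complex_def by (metis inf_commute)
    then have "e face_of convex hull {a, b, c}" using eK(3) C(3) abc(1) by (simp add: inf_absorb1)
    then obtain S where S: "S \<subseteq> {a, b, c}" "e = convex hull S"
      using face_of_convex_hull_affine_independent[OF indep[OF subset_refl]] by blast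
    obtain S' where S': "\<not> affine_dependent S'" "int (card S') = 1 + 1" "e = convex hull S'"
      using eK(2) unfolding simplex_def by blast
    have "S = S'"
      using S(2) S'(1,3) extreme_point_of_convex_hull_affine_independent[OF indep[OF S(1)]]
       extreme_point_of_convex_hull_affine_independent[OF S'(1)] by auto
    then have "card S = 2" using S'(2) by simp
    then obtain p q where "S = {p, q}" "p \<noteq> q" by (auto simp: card_2_iff)
    then have "S \<in> {{b, c}, {c, a}, {a, b}}" using S(1) by auto
    then show ?thesis using S(2) by auto
  qed
  moreover have "{convex hull {b, c}, convex hull {c, a}, convex hull {a, b}} \<subseteq> sides K t"
    using abc pair[of b c] pair[of c a] pair[of a b] by simp
  ultimately have sides: "sides K t = {convex hull {b, c}, convex hull {c, a}, convex hull {a, b}}" by blast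
  have dist: "distinct [convex hull {b, c}, convex hull {c, a}, convex hull {a, b}]"
    using inj[of "{b, c}" "{c, a}"] inj[of "{b, c}" "{a, b}"] inj[of "{c, a}" "{a, b}"] abc
    by (auto simp: doubleton_eq_iff)
  show ?thesis
  proof (rule that[of a b c])
    show "t = convex hull {a, b, c}" using C(3) abc(1) by simp
    show "\<not> affine_dependent {a, b, c}" by (rule indep[OF subset_refl])
  qed (rule abc(2-4) sides dist)+
qed

lemma triangle_angle_commute: "triangle_angle G x y z = triangle_angle G x z y"
  by (cases G) (simp_all add: mult_ac add.commute)

lemma facing_angle_eq:
  assumes "sides K t = {e1, e2, e3}" "distinct [e1, e2, e3]"
  shows "facing_angle G K d t e1 = triangle_angle G (d e1) (d e2) (d e3)"
  unfolding facing_angle_def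
proof (rule the_equality)
  show "\<exists>f1 f2. sides K t = {e1, f1, f2} \<and> distinct [e1, f1, f2] \<and>
     triangle_angle G (d e1) (d e2) (d e3) = triangle_angle G (d e1) (d f1) (d f2)" using assms by blast
  fix \<theta> assume "\<exists>f1 f2. sides K t = {e1, f1, f2} \<and> distinct [e1, f1, f2] \<and> \<theta> = triangle_angle G (d e1) (d f1) (d f2)"
  then obtain f1 f2 where f: "{e1, e2, e3} = {e1, f1, f2}" "distinct [e1, f1, f2]" "\<theta> = triangle_angle G (d e1) (d f1) (d f2)"
    using assms(1) by auto
  have "f1 = e2 \<and> f2 = e3 \<or> f1 = e3 \<and> f2 = e2" 
  proof -
    have "{e2, e3} = {e1, e2, e3} - {e1}" "{f1, f2} = {e1, f1, f2} - {e1}" using f(2) assms(2) by auto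
    then have "{f1, f2} = {e2, e3}" using f(1) by simp
    then show ?thesis by (simp add: doubleton_eq_iff)
  qed
  then show "\<theta> = triangle_angle G (d e1) (d e2) (d e3)" using f(3) triangle_angle_commute by auto
qed

section \<open>From single triangles to the complex\<close>

lemma sum_over_sides_swap:
  assumes fin: "finite T" "finite E" and sub: "\<And>t. t \<in> T \<Longrightarrow> S t \<subseteq> E"
  shows "(\<Sum>t\<in>T. \<Sum>e\<in>S t. w e * g t e) = (\<Sum>e\<in>E. w e * (\<Sum>t | t \<in> T \<and> e \<in> S t. g t e :: real))"
proof -
  have "(\<Sum>t\<in>T. \<Sum>e\<in>S t. w e * g t e) = (\<Sum>t\<in>T. \<Sum>e\<in>E. if e \<in> S t then w e * g t e else 0)"
  proof (rule sum.cong[OF refl])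
    fix t assume "t \<in> T"
    then show "(\<Sum>e\<in>S t. w e * g t e) = (\<Sum>e\<in>E. if e \<in> S t then w e * g t e else 0)"
      by (intro sum.mono_neutral_cong_left) (use fin sub in auto)
  qed
  also have "\<dots> = (\<Sum>e\<in>E. \<Sum>t\<in>T. if e \<in> S t then w e * g t e else 0)" by (rule sum.swap)
  also have "\<dots> = (\<Sum>e\<in>E. w e * (\<Sum>t | t \<in> T \<and> e \<in> S t. g t e))"
    using fin by (intro sum.cong refl) (simp add: sum_distrib_left sum.inter_filter[symmetric])
  finally show ?thesis .
qed

text \<open>Grouped by edges, the sum of all products vanishes, since one of the factors does at each edge. Grouped
  by triangles, it consists of nonnegative terms. So the case of equality occurs in every triangle.\<close>

lemma angles_equal:
  assumes fin: "finite T" "finite E" and sub: "\<And>t. t \<in> T \<Longrightarrow> S t \<subseteq> E"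
    and edge: "\<And>e. e \<in> E \<Longrightarrow> U (d2 e) = U (d1 e) \<or> (\<Sum>t | t \<in> T \<and> e \<in> S t. F (\<alpha>2 t e) - F (\<alpha>1 t e)) = (0::real)"
    and nonneg: "\<And>t. t \<in> T \<Longrightarrow> 0 \<le> (\<Sum>e\<in>S t. (U (d2 e) - U (d1 e)) * (F (\<alpha>2 t e) - F (\<alpha>1 t e)))"
    and rigid: "\<And>t e. t \<in> T \<Longrightarrow> (\<Sum>e\<in>S t. (U (d2 e) - U (d1 e)) * (F (\<alpha>2 t e) - F (\<alpha>1 t e))) = 0 \<Longrightarrow> e \<in> S t \<Longrightarrow> \<alpha>1 t e = \<alpha>2 t e"
    and t: "t \<in> T" "e \<in> S t"
  shows "\<alpha>1 t e = \<alpha>2 t e"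
proof -
  have "(\<Sum>t\<in>T. \<Sum>e\<in>S t. (U (d2 e) - U (d1 e)) * (F (\<alpha>2 t e) - F (\<alpha>1 t e)))
     = (\<Sum>e\<in>E. (U (d2 e) - U (d1 e)) * (\<Sum>t | t \<in> T \<and> e \<in> S t. F (\<alpha>2 t e) - F (\<alpha>1 t e)))"
    by (rule sum_over_sides_swap[OF fin sub])
  also have "\<dots> = 0" using edge by (intro sum.neutral) auto
  finally have "(\<Sum>e\<in>S t. (U (d2 e) - U (d1 e)) * (F (\<alpha>2 t e) - F (\<alpha>1 t e))) = 0"
    using sum_nonneg_eq_0_iff[OF fin(1), of "\<lambda>t. \<Sum>e\<in>S t. (U (d2 e) - U (d1 e)) * (F (\<alpha>2 t e) - F (\<alpha>1 t e))"] nonneg t(1) by auto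
  then show ?thesis using rigid t by blast
qed

lemma sin_powr_integral:
  assumes dF: "\<And>t. 0 < t \<Longrightarrow> t < pi \<Longrightarrow> (F has_real_derivative sin t powr h) (at t)" and a: "0 < a" "a < pi"
  shows "(LBINT x = ereal a..ereal (pi / 2). sin x powr h) = F (pi / 2) - F a"
proof (rule interval_integral_FTC_finite)
  have *: "0 < sin x" if "x \<in> {min a (pi/2)..max a (pi/2)}" for x
    using that a by (intro sin_gt_zero) (auto simp: min_def max_def split: if_splits)
  show "continuous_on {min a (pi / 2)..max a (pi / 2)} (\<lambda>x. sin x powr h)"
    by (intro continuous_intros ballI) (use * in \<open>simp add: less_imp_neq[symmetric]\<close>)
  fix x assume "min a (pi / 2) \<le> x" "x \<le> max a (pi / 2)"
  then have "0 < x" "x < pi" using a by (auto simp: min_def max_def split: if_splits)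
  from dF[OF this] show "(F has_vector_derivative sin x powr h) (at x within {min a (pi / 2)..max a (pi / 2)})"
    by (simp add: has_real_derivative_iff_has_vector_derivative has_vector_derivative_at_within)
qed

lemma cos_powr_integral:
  assumes dF: "\<And>t. 0 < t \<Longrightarrow> t < pi \<Longrightarrow> (F has_real_derivative sin t powr h) (at t)" and a: "0 < a" "a < pi"
  shows "(LBINT x = 0..ereal (pi / 2 - a). cos x powr h) = F (pi / 2) - F a"
proof -
  let ?b = "pi/2 - a"
  have "(LBINT x = ereal 0..ereal ?b. cos x powr h) = - F (pi / 2 - ?b) - - F (pi / 2 - 0)"
  proof (rule interval_integral_FTC_finite)
    have *: "- (pi/2) < x \<and> x < pi/2" if "x \<in> {min 0 ?b..max 0 ?b}" for x
      using that a pi_gt_zero by (auto simp: min_def max_def split: if_splits)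
    have "cos x \<noteq> 0" if "x \<in> {min 0 ?b..max 0 ?b}" for x
      using cos_gt_zero_pi[of x] *[OF that] by linarith
    then show "continuous_on {min 0 ?b..max 0 ?b} (\<lambda>x. cos x powr h)"
      by (intro continuous_intros) blast
    fix x assume "min 0 ?b \<le> x" "x \<le> max 0 ?b"
    then have "0 < pi/2 - x" "pi/2 - x < pi" using *[of x] by auto
    then have "((\<lambda>x. - F (pi/2 - x)) has_real_derivative - (sin (pi/2 - x) powr h * (0 - 1))) (at x)"
      by (intro DERIV_minus DERIV_chain2[OF dF] DERIV_diff DERIV_const DERIV_ident)
    then show "((\<lambda>x. - F (pi/2 - x)) has_vector_derivative cos x powr h) (at x within {min 0 ?b..max 0 ?b})"
      by (simp add: cos_sin_eq has_real_derivative_iff_has_vector_derivative has_vector_derivative_at_within)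
  qed
  then show ?thesis by (simp add: zero_ereal_def)
qed

section \<open>Boundary points of a polyhedral surface\<close>

abbreviation half_plane :: "complex set" where
  "half_plane \<equiv> {z. 0 \<le> Im z}"

text \<open>The triangulating homeomorphism moves the surface onto the polyhedron \<open>M\<close>, where charts become
  homeomorphisms between subsets of Euclidean spaces.\<close>

definition surface_chart :: "'v::euclidean_space set \<Rightarrow> 'v set \<Rightarrow> complex set \<Rightarrow> ('v \<Rightarrow> complex) \<Rightarrow> (complex \<Rightarrow> 'v) \<Rightarrow> bool" where
  "surface_chart M N V k \<gamma> \<longleftrightarrow> openin (top_of_set M) N \<and> openin (top_of_set half_plane) V \<and> homeomorphism N V k \<gamma>"

definition boundary_point :: "'v::euclidean_space set \<Rightarrow> 'v \<Rightarrow> bool" where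
  "boundary_point M x \<longleftrightarrow> (\<exists>N V k \<gamma>. surface_chart M N V k \<gamma> \<and> x \<in> N \<and> Im (k x) = 0)"

definition surface :: "'v::euclidean_space set \<Rightarrow> bool" where
  "surface M \<longleftrightarrow> (\<forall>x\<in>M. \<exists>N V k \<gamma>. surface_chart M N V k \<gamma> \<and> x \<in> N)"

lemma homeomorphic_map_top_of_set:
  assumes "homeomorphic_map (top_of_set S) (top_of_set T) f"
  obtains g where "homeomorphism S T f g"
proof -
  obtain g where g: "homeomorphic_maps (top_of_set S) (top_of_set T) f g"
    using assms homeomorphic_map_maps by blast
  have "homeomorphism S T f g"
    unfolding homeomorphism_def
    using g by (auto simp: homeomorphic_maps_def continuous_map_subtopology_eu Pi_iff image_iff) metis+
  then show ?thesis by (rule that)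
qed

lemma homeomorphism_imp_homeomorphic_map:
  assumes "homeomorphism S T f g"
  shows "homeomorphic_map (top_of_set S) (top_of_set T) f"
  unfolding homeomorphic_map_maps
  by (rule exI[of _ g]) (use assms in \<open>auto simp: homeomorphic_maps_def homeomorphism_def\<close>)

lemma surface_chart_of_half_plane_chart:
  assumes f: "homeomorphic_map (top_of_set M) X f" and \<kappa>: "half_plane_chart X U \<kappa>"
  obtains V \<gamma> where "surface_chart M {x \<in> M. f x \<in> U} V (\<kappa> \<circ> f) \<gamma>"
proof -
  have U: "openin X U" using \<kappa> by (simp add: half_plane_chart_def)
  obtain V where V: "openin (top_of_set half_plane) V" "homeomorphic_map (subtopology X U) (top_of_set V) \<kappa>"
    using \<kappa> by (auto simp: half_plane_chart_def)
  let ?N = "{x \<in> M. f x \<in> U}"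
  have N: "openin (top_of_set M) ?N"
    using openin_continuous_map_preimage[OF homeomorphic_imp_continuous_map[OF f] U] by simp
  have "homeomorphic_map (subtopology (top_of_set M) ?N) (subtopology X U) f"
    by (rule homeomorphic_map_subtopologies_alt[OF f]) auto
  then have "homeomorphic_map (top_of_set ?N) (subtopology X U) f"
    by (simp add: subtopology_subtopology Int_absorb1 subset_iff)
  from homeomorphic_map_compose[OF this V(2)] obtain \<gamma> where "homeomorphism ?N V (\<kappa> \<circ> f) \<gamma>"
    by (rule homeomorphic_map_top_of_set)
  then show ?thesis using that N V(1) by (simp add: surface_chart_def)
qed

lemma surface_boundary_iff:
  assumes f: "homeomorphic_map (top_of_set M) X f" and x: "x \<in> M"
  shows "f x \<in> surface_boundary X \<longleftrightarrow> boundary_point M x"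
proof
  assume "f x \<in> surface_boundary X"
  then obtain U \<kappa> where \<kappa>: "f x \<in> U" "half_plane_chart X U \<kappa>" "Im (\<kappa> (f x)) = 0"
    by (auto simp: surface_boundary_def)
  obtain V \<gamma> where "surface_chart M {x \<in> M. f x \<in> U} V (\<kappa> \<circ> f) \<gamma>"
    using surface_chart_of_half_plane_chart[OF f \<kappa>(2)] by blast
  then show "boundary_point M x"
    unfolding boundary_point_def using \<kappa> x by force
next
  assume "boundary_point M x"
  then obtain N V k \<gamma> where c: "surface_chart M N V k \<gamma>" "x \<in> N" "Im (k x) = 0"
    by (auto simp: boundary_point_def)
  then have N: "openin (top_of_set M) N" and V: "openin (top_of_set half_plane) V" and h: "homeomorphism N V k \<gamma>"
    by (auto simp: surface_chart_def)
  have NM: "N \<subseteq> M" using N openin_imp_subset by blast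
  obtain g where g: "homeomorphic_maps (top_of_set M) X f g" using f homeomorphic_map_maps by blast
  have gf: "g (f y) = y" if "y \<in> M" for y using g that by (simp add: homeomorphic_maps_def)
  have open_fN: "openin X (f ` N)" using f N homeomorphic_map_openness_eq by blast
  have "homeomorphic_map X (top_of_set M) g" using g homeomorphic_map_maps homeomorphic_maps_sym by blast
  then have "homeomorphic_map (subtopology X (f ` N)) (subtopology (top_of_set M) N) g"
  proof (rule homeomorphic_map_subtopologies_alt)
    fix y assume y: "y \<in> topspace X" "g y \<in> topspace (top_of_set M)"
    then have "f (g y) = y" using g by (simp add: homeomorphic_maps_def)
    then show "g y \<in> N \<longleftrightarrow> y \<in> f ` N" using gf NM by (metis image_iff subsetD)
  qed
  then have "homeomorphic_map (subtopology X (f ` N)) (top_of_set N) g"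
    using NM by (simp add: subtopology_subtopology Int_absorb1)
  from homeomorphic_map_compose[OF this homeomorphism_imp_homeomorphic_map[OF h]]
  have "homeomorphic_map (subtopology X (f ` N)) (top_of_set V) (k \<circ> g)" .
  then have "half_plane_chart X (f ` N) (k \<circ> g)"
    using open_fN V by (auto simp: half_plane_chart_def)
  moreover have "Im ((k \<circ> g) (f x)) = 0" using c(3) gf[OF x] by simp
  ultimately show "f x \<in> surface_boundary X"
    using c(2) unfolding surface_boundary_def by blast
qed

lemma open_not_in_half_plane:
  assumes "open S" "z \<in> S" "Im z = 0" shows "\<not> S \<subseteq> half_plane"
proof
  assume S: "S \<subseteq> half_plane"
  obtain e where e: "e > 0" "ball z e \<subseteq> S" using assms open_contains_ball by blast
  have "z - \<i> * of_real (e/2) \<in> ball z e" using e(1) by (simp add: dist_norm norm_mult)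
  then have "0 \<le> Im (z - \<i> * of_real (e/2))" using e(2) S by blast
  then show False using assms(3) e(1) by simp
qed

text \<open>By invariance of domain, a chart maps the disc onto an open subset of the plane, and such a set inside
  the half-plane contains no point of the boundary line.\<close>

lemma plane_disc_not_boundary:
  fixes g :: "complex \<Rightarrow> 'v::euclidean_space"
  assumes D: "open D" "continuous_on D g" "inj_on g D" "g ` D \<subseteq> M" "w \<in> D"
  shows "\<not> boundary_point M (g w)"
proof
  assume "boundary_point M (g w)"
  then obtain N V k \<gamma> where c: "surface_chart M N V k \<gamma>" "g w \<in> N" "Im (k (g w)) = 0"
    by (auto simp: boundary_point_def)
  then have N: "openin (top_of_set M) N" and V: "V \<subseteq> half_plane" and h: "homeomorphism N V k \<gamma>"
    by (auto simp: surface_chart_def dest: openin_imp_subset)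
  define D' where "D' = D \<inter> g -` N"
  have "openin (top_of_set D) D'"
    unfolding D'_def by (rule continuous_openin_preimage[OF D(2) _ N]) (use D(4) in auto)
  then have "open D'" using D(1) openin_open_eq by blast
  have "open ((k \<circ> g) ` D')"
  proof (rule invariance_of_domain)
    have "continuous_on (g ` D') k"
      using homeomorphism_cont1[OF h] by (rule continuous_on_subset) (auto simp: D'_def)
    then show "continuous_on D' (k \<circ> g)"
      by (intro continuous_on_compose continuous_on_subset[OF D(2)]) (auto simp: D'_def)
    show "open D'" by fact
    have "inj_on k N" using homeomorphism_apply1[OF h] by (metis inj_onI)
    then show "inj_on (k \<circ> g) D'"
      using D(3) by (intro comp_inj_on) (auto simp: D'_def inj_on_def)
  qed
  moreover have "(k \<circ> g) ` D' \<subseteq> half_plane"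
    using homeomorphism_image1[OF h] V by (auto simp: D'_def)
  moreover have "k (g w) \<in> (k \<circ> g) ` D'" using c(2) D(5) by (auto simp: D'_def)
  ultimately show False using open_not_in_half_plane c(3) by blast
qed

lemma interior_chart_not_boundary:
  assumes c: "surface_chart M N V k \<gamma>" and x: "x \<in> N" "0 < Im (k x)"
  shows "\<not> boundary_point M x"
proof -
  have N: "N \<subseteq> M" and V: "openin (top_of_set half_plane) V" and h: "homeomorphism N V k \<gamma>"
    using c by (auto simp: surface_chart_def dest: openin_imp_subset)
  obtain W where W: "open W" "V = half_plane \<inter> W" using V by (auto simp: openin_open)
  define D where "D = V \<inter> {z. 0 < Im z}"
  have "D = W \<inter> {z. 0 < Im z}" using W by (auto simp: D_def)
  then have "open D" using W(1) open_halfspace_Im_gt[of 0] by (simp add: open_Int)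
  moreover have "continuous_on D \<gamma>" using homeomorphism_cont2[OF h] by (rule continuous_on_subset) (auto simp: D_def)
  moreover have "inj_on \<gamma> D" using homeomorphism_apply2[OF h] by (intro inj_on_inverseI[of _ k]) (auto simp: D_def)
  moreover have "\<gamma> ` D \<subseteq> M" using homeomorphism_image2[OF h] N by (auto simp: D_def)
  moreover have "k x \<in> D" using x homeomorphism_image1[OF h] by (auto simp: D_def)
  ultimately have "\<not> boundary_point M (\<gamma> (k x))" by (rule plane_disc_not_boundary)
  then show ?thesis using homeomorphism_apply1[OF h x(1)] by simp
qed

text \<open>A chart at a boundary point covers a piece of the boundary line. So some boundary point is not a
  vertex, as there are only finitely many vertices.\<close>

lemma infinite_boundary_points:
  assumes "boundary_point M x0"
  shows "infinite {x. boundary_point M x}"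
proof
  assume fin: "finite {x. boundary_point M x}"
  obtain N V k \<gamma> where c: "surface_chart M N V k \<gamma>" "x0 \<in> N" "Im (k x0) = 0"
    using assms by (auto simp: boundary_point_def)
  then have V: "openin (top_of_set half_plane) V" and h: "homeomorphism N V k \<gamma>"
    by (auto simp: surface_chart_def)
  obtain W where W: "open W" "V = half_plane \<inter> W" using V by (auto simp: openin_open)
  have "k x0 \<in> W" using W(2) c(2) homeomorphism_image1[OF h] by blast
  then obtain e where e: "e > 0" "ball (k x0) e \<subseteq> W" using W(1) open_contains_ball by blast
  define L where "L = (\<lambda>r. k x0 + of_real r) ` {0<..<e}"
  have "infinite L" unfolding L_def using e(1) by (subst finite_image_iff) (auto simp: inj_on_def infinite_Ioo)
  have LV: "L \<subseteq> V" "z \<in> L \<Longrightarrow> Im z = 0" for z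
    using e(2) c(3) by (auto simp: L_def W(2) dist_norm subset_iff)
  have "inj_on \<gamma> L" using homeomorphism_apply2[OF h] LV(1) by (intro inj_on_inverseI[of _ k]) auto
  moreover have "\<gamma> ` L \<subseteq> {x. boundary_point M x}"
  proof
    fix y assume "y \<in> \<gamma> ` L"
    then obtain z where z: "z \<in> L" "y = \<gamma> z" by blast
    then have "y \<in> N" "k y = z" using LV(1) homeomorphism_image2[OF h] homeomorphism_apply2[OF h] by auto
    then show "y \<in> {x. boundary_point M x}" using c(1) LV(2)[OF z(1)] by (auto simp: boundary_point_def)
  qed
  ultimately have "finite L" using fin by (meson finite_imageD finite_subset)
  then show False using \<open>infinite L\<close> by simp
qed

section \<open>Boundary points on edges and triangles\<close>

lemma triangle_coordinates:
  fixes p q r :: "'v::euclidean_space"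
  assumes "\<not> affine_dependent {p, q, r}" "p \<noteq> q" "p \<noteq> r" "q \<noteq> r"
  obtains L :: "'v \<Rightarrow> complex" where "bounded_linear L" "L (q - p) = 1" "L (r - p) = \<i>"
proof -
  have "\<not> dependent ((\<lambda>x. - p + x) ` {q, r})"
    using assms affine_dependent_iff_dependent[of p "{q, r}"] by auto
  then have "independent {q - p, r - p}" by (simp add: add.commute)
  then obtain L :: "'v \<Rightarrow> complex" where L: "linear L" "\<forall>x\<in>{q - p, r - p}. L x = (if x = q - p then 1 else \<i>)"
    using linear_independent_extend[of "{q - p, r - p}" "\<lambda>x. if x = q - p then 1 else \<i>"] by blast
  then have "L (q - p) = 1" "L (r - p) = \<i>" using assms(4) by auto
  then show ?thesis using that L(1) linear_conv_bounded_linear by blast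
qed

lemma convex_hull_3_coordinates:
  "convex hull {p, q, r} = {p + s *\<^sub>R (q - p) + w *\<^sub>R (r - p) | s w. 0 \<le> s \<and> 0 \<le> w \<and> s + w \<le> 1}"
  for p q r :: "'v::euclidean_space"
  unfolding convex_hull_3_alt by blast

lemma convex_hull_2_coordinates:
  "convex hull {p, q} = {p + s *\<^sub>R (q - p) | s. 0 \<le> s \<and> s \<le> 1}"
  for p q :: "'v::euclidean_space"
  unfolding convex_hull_2_alt by auto

text \<open>The point with the barycentric coordinates \<open>1 - Re z - Im z\<close>, \<open>Re z\<close>, \<open>Im z\<close>.\<close>

definition tri_map :: "'v \<Rightarrow> 'v \<Rightarrow> 'v \<Rightarrow> complex \<Rightarrow> 'v::euclidean_space" where
  "tri_map p q r z = p + Re z *\<^sub>R (q - p) + Im z *\<^sub>R (r - p)"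

lemma continuous_on_tri_map: "continuous_on S (tri_map p q r)"
  unfolding tri_map_def by (intro continuous_intros)

lemma tri_map_inverse:
  assumes "bounded_linear L" "L (q - p) = 1" "L (r - p) = \<i>"
  shows "L (tri_map p q r z - p) = z"
proof -
  interpret bounded_linear L by fact
  show ?thesis
    by (simp add: tri_map_def add scaleR assms(2,3) complex_eq_iff)
qed

lemma triangles_meet:
  assumes K: "simplicial_complex K" and t: "t \<in> triangles K" "t = convex hull {p, q, r}" "\<not> affine_dependent {p, q, r}"
    and t': "t' \<in> triangles K" "t' \<noteq> t"
  obtains S where "S \<subseteq> {p, q, r}" "S \<noteq> {p, q, r}" "t \<inter> t' = convex hull S"
proof -
  have tK: "t \<in> K" "t' \<in> K" using t t' by (auto simp: triangles_def)
  have "t \<inter> t' face_of t" using K tK unfolding simplicial_complex_def by blast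
  then obtain S where S: "S \<subseteq> {p, q, r}" "t \<inter> t' = convex hull S"
    using face_of_convex_hull_affine_independent[OF t(3)] unfolding t(2) by blast
  have "S \<noteq> {p, q, r}"
  proof
    assume "S = {p, q, r}"
    then have "t \<inter> t' = t" using S(2) t(2) by simp
    moreover have "t' \<inter> t face_of t'" using K tK unfolding simplicial_complex_def by blast
    ultimately have "t face_of t'" by (simp add: Int_commute)
    moreover have "aff_dim t = 2" "aff_dim t' = 2" using t(1) t'(1) by (auto simp: triangles_def aff_dim_simplex)
    moreover have "convex t'" using t'(1) by (auto simp: triangles_def simplex_def)
    ultimately show False using face_of_aff_dim_lt[of t' t] t'(2) by simp
  qed
  then show ?thesis using that S by blast
qed

lemma edge_face_vertices:
  assumes K: "simplicial_complex K" and t: "t \<in> triangles K" and e: "e \<subseteq> t" "e = convex hull {p, q}" "e \<in> edges K" and "p \<noteq> q"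
  obtains r where "t = convex hull {p, q, r}" "\<not> affine_dependent {p, q, r}" "r \<noteq> p" "r \<noteq> q"
proof -
  obtain a b c where abc: "t = convex hull {a, b, c}" "\<not> affine_dependent {a, b, c}" "a \<noteq> b" "b \<noteq> c" "a \<noteq> c"
    "sides K t = {convex hull {b, c}, convex hull {c, a}, convex hull {a, b}}"
    by (rule triangle_cases[OF K t], rule that)
  have "e \<in> sides K t" using e by (simp add: sides_def)
  have pq: "\<not> affine_dependent {p, q}" by (simp add: affine_independent_2)
  have eqset: "{p, q} = {u, v}" if "convex hull {p, q} = convex hull {u, v}" for u v
    using that extreme_point_of_convex_hull_affine_independent[OF pq]
      extreme_point_of_convex_hull_affine_independent[OF affine_independent_2[of u v]] by auto
  have "{p, q} = {b, c} \<or> {p, q} = {c, a} \<or> {p, q} = {a, b}"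
    using \<open>e \<in> sides K t\<close> eqset unfolding abc(6) e(2) by blast
  then obtain r where r: "{p, q, r} = {a, b, c}" "r \<noteq> p" "r \<noteq> q"
  proof (elim disjE)
    assume *: "{p, q} = {b, c}"
    show ?thesis by (rule that[of a]) (use * abc(3-5) in \<open>auto simp: doubleton_eq_iff\<close>)
  next
    assume *: "{p, q} = {c, a}"
    show ?thesis by (rule that[of b]) (use * abc(3-5) in \<open>auto simp: doubleton_eq_iff\<close>)
  next
    assume *: "{p, q} = {a, b}"
    show ?thesis by (rule that[of c]) (use * abc(3-5) in \<open>auto simp: doubleton_eq_iff\<close>)
  qed
  show ?thesis by (rule that[of r]) (use r abc(1,2) in simp_all)
qed

lemma triangle_subset: "t \<in> triangles K \<Longrightarrow> t \<subseteq> \<Union>K"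
  by (auto simp: triangles_def)

lemma tri_map_in_triangle:
  "0 \<le> Re z \<Longrightarrow> 0 \<le> Im z \<Longrightarrow> Re z + Im z \<le> 1 \<Longrightarrow> tri_map p q r z \<in> convex hull {p, q, r}"
  unfolding convex_hull_3_coordinates tri_map_def by blast

lemma interior_of_triangle_not_boundary:
  assumes "t \<in> triangles K" "t = convex hull {p, q, r}" "\<not> affine_dependent {p, q, r}" "p \<noteq> q" "p \<noteq> r" "q \<noteq> r"
    and z: "0 < Re z" "0 < Im z" "Re z + Im z < 1"
  shows "\<not> boundary_point (\<Union>K) (tri_map p q r z)"
proof -
  obtain L :: "_ \<Rightarrow> complex" where L: "bounded_linear L" "L (q - p) = 1" "L (r - p) = \<i>"
    by (rule triangle_coordinates[OF assms(3-6)])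
  let ?D = "{z. 0 < Re z} \<inter> {z. 0 < Im z} \<inter> {z. Re z + Im z < 1}"
  have "open ?D"
    by (intro open_Int open_halfspace_Re_gt open_halfspace_Im_gt open_Collect_less continuous_intros)
  moreover have "inj_on (tri_map p q r) ?D"
    by (rule inj_on_inverseI[of _ "\<lambda>y. L (y - p)"]) (rule tri_map_inverse[OF L])
  moreover have "tri_map p q r ` ?D \<subseteq> \<Union>K"
  proof
    fix y assume "y \<in> tri_map p q r ` ?D"
    then obtain z where "z \<in> ?D" "y = tri_map p q r z" by blast
    then have "y \<in> t" unfolding assms(2) by (auto intro: tri_map_in_triangle)
    then show "y \<in> \<Union>K" using triangle_subset[OF assms(1)] by blast
  qed
  ultimately show ?thesis
    using z by (intro plane_disc_not_boundary[OF _ continuous_on_tri_map]) auto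
qed

text \<open>Two triangles with a common edge unfold into the plane, one above and one below the real line, and
  the edge becomes a segment in the interior of the resulting disc.\<close>

lemma edge_of_two_triangles_not_boundary:
  assumes K: "simplicial_complex K" and t: "t \<in> triangles K" "t' \<in> triangles K" "t \<noteq> t'"
    and e: "e \<in> edges K" "e \<subseteq> t" "e \<subseteq> t'" "e = convex hull {p, q}" "p \<noteq> q" and u: "0 < u" "u < 1"
  shows "\<not> boundary_point (\<Union>K) (p + u *\<^sub>R (q - p))"
proof -
  obtain r where r: "t = convex hull {p, q, r}" "\<not> affine_dependent {p, q, r}" "r \<noteq> p" "r \<noteq> q"
    by (rule edge_face_vertices[OF K t(1) e(2,4,1,5)])
  obtain r' where r': "t' = convex hull {p, q, r'}" "\<not> affine_dependent {p, q, r'}" "r' \<noteq> p" "r' \<noteq> q"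
    by (rule edge_face_vertices[OF K t(2) e(3,4,1,5)])
  obtain L :: "_ \<Rightarrow> complex" where L: "bounded_linear L" "L (q - p) = 1" "L (r - p) = \<i>"
    by (rule triangle_coordinates[OF r(2) e(5) r(3)[symmetric] r(4)[symmetric]])
  obtain L' :: "_ \<Rightarrow> complex" where L': "bounded_linear L'" "L' (q - p) = 1" "L' (r' - p) = \<i>"
    by (rule triangle_coordinates[OF r'(2) e(5) r'(3)[symmetric] r'(4)[symmetric]])
  obtain S where S: "S \<subseteq> {p, q, r}" "S \<noteq> {p, q, r}" "t \<inter> t' = convex hull S"
    by (rule triangles_meet[OF K t(1) r(1,2) t(2) t(3)[symmetric]])
  have "e \<subseteq> convex hull S" using e S(3) by blast
  have "p \<in> S" "q \<in> S"
  proof -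
    have "p \<in> convex hull S" "q \<in> convex hull S"
      using \<open>e \<subseteq> convex hull S\<close> hull_subset[of "{p, q}" convex] e(4) by auto
    moreover have "p extreme_point_of t" "q extreme_point_of t"
      unfolding r(1) using extreme_point_of_convex_hull_affine_independent[OF r(2)] by auto
    moreover have "convex hull S \<subseteq> t" using S(3) by blast
    ultimately have "p extreme_point_of convex hull S" "q extreme_point_of convex hull S"
      unfolding extreme_point_of_def by blast+
    then show "p \<in> S" "q \<in> S" using extreme_point_of_convex_hull by blast+
  qed
  then have "S = {p, q}" using S(1,2) by auto
  then have meet: "t \<inter> t' = convex hull {p, q}" using S(3) by simp
  \<comment> \<open>the upper half of the disc is mapped into \<open>t\<close>, the lower half into the other triangle\<close>
  define g where "g z = p + Re z *\<^sub>R (q - p) + max 0 (Im z) *\<^sub>R (r - p) + max 0 (- Im z) *\<^sub>R (r' - p)" for z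
  have g1: "g z = tri_map p q r z" if "0 \<le> Im z" for z using that by (simp add: g_def tri_map_def)
  have g2: "g z = tri_map p q r' (cnj z)" if "Im z \<le> 0" for z using that by (simp add: g_def tri_map_def)
  let ?D = "{z. 0 < Re z} \<inter> {z. Re z + \<bar>Im z\<bar> < 1}"
  have in1: "g z \<in> t" if "z \<in> ?D" "0 \<le> Im z" for z
    unfolding g1[OF that(2)] r(1) using that by (intro tri_map_in_triangle) auto
  have in2: "g z \<in> t'" if "z \<in> ?D" "Im z \<le> 0" for z
    unfolding g2[OF that(2)] r'(1) using that by (intro tri_map_in_triangle) auto
  have real: "Im (L (y - p)) = 0" if y: "y \<in> convex hull {p, q}" for y
  proof -
    obtain s where "y = p + s *\<^sub>R (q - p)" using y unfolding convex_hull_2_coordinates by blast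
    then show ?thesis using L(2) by (simp add: linear_scale[OF bounded_linear.linear[OF L(1)]])
  qed
  have mixed: "g z \<noteq> g z'" if "z \<in> ?D" "z' \<in> ?D" "0 < Im z" "Im z' \<le> 0" for z z'
  proof
    assume eq: "g z = g z'"
    then have "g z \<in> t \<inter> t'" using in1[of z] in2[of z'] that by auto
    then have "Im (L (g z - p)) = 0" using real meet by blast
    then show False using tri_map_inverse[OF L, of z] g1[of z] that(3) by simp
  qed
  have "inj_on g ?D"
  proof (rule inj_onI)
    fix z z' assume z: "z \<in> ?D" "z' \<in> ?D" "g z = g z'"
    consider "0 < Im z" "0 < Im z'" | "Im z \<le> 0" "Im z' \<le> 0" | "0 < Im z" "Im z' \<le> 0" | "Im z \<le> 0" "0 < Im z'" by linarith
    then show "z = z'"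
    proof cases
      case 1
      then have "tri_map p q r z = tri_map p q r z'" using g1[of z] g1[of z'] z(3) by simp
      then show ?thesis using tri_map_inverse[OF L] by metis
    next
      case 2
      then have "tri_map p q r' (cnj z) = tri_map p q r' (cnj z')" using g2[of z] g2[of z'] z(3) by simp
      then have "cnj z = cnj z'" using tri_map_inverse[OF L'] by metis
      then show ?thesis by simp
    qed (use mixed[of z z'] mixed[of z' z] z in auto)
  qed
  moreover have "open ?D"
    by (intro open_Int open_halfspace_Re_gt open_Collect_less continuous_intros)
  moreover have "continuous_on ?D g" unfolding g_def by (intro continuous_intros)
  moreover have "g ` ?D \<subseteq> \<Union>K"
  proof
    fix y assume "y \<in> g ` ?D"
    then obtain z where z: "z \<in> ?D" "y = g z" by blast
    then have "y \<in> t \<union> t'" using in1[of z] in2[of z] by (cases "0 \<le> Im z") auto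
    then show "y \<in> \<Union>K" using triangle_subset t by blast
  qed
  moreover have "of_real u \<in> ?D" using u by simp
  ultimately have "\<not> boundary_point (\<Union>K) (g (of_real u))" by (intro plane_disc_not_boundary)
  then show ?thesis by (simp add: g_def)
qed

text \<open>The interior of the triangle together with that of the edge is open in the polyhedron, since its
  complement is the closed union \<open>C\<close> of the other triangles and the other two sides. Barycentric coordinates are a
  chart on it that sends the edge to the boundary line.\<close>

lemma edge_of_one_triangle_boundary:
  assumes K: "simplicial_complex K" and dim: "\<forall>c\<in>K. \<exists>t\<in>triangles K. c \<subseteq> t"
    and t: "t \<in> triangles K" "t = convex hull {p, q, r}" "\<not> affine_dependent {p, q, r}" "p \<noteq> q" "p \<noteq> r" "q \<noteq> r"
    and only: "\<And>t'. t' \<in> triangles K \<Longrightarrow> convex hull {p, q} \<subseteq> t' \<Longrightarrow> t' = t" and u: "0 < u" "u < 1"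
  shows "boundary_point (\<Union>K) (p + u *\<^sub>R (q - p))"
proof -
  obtain L :: "_ \<Rightarrow> complex" where L: "bounded_linear L" "L (q - p) = 1" "L (r - p) = \<i>"
    by (rule triangle_coordinates[OF t(3-6)])
  let ?g = "tri_map p q r" and ?k = "\<lambda>y. L (y - p)"
  define V where "V = half_plane \<inter> ({z. 0 < Re z} \<inter> {z. Re z + Im z < 1})"
  have V: "openin (top_of_set half_plane) V"
    unfolding V_def
    by (intro openin_open_Int open_Int open_halfspace_Re_gt open_Collect_less continuous_intros)
  define C where "C = \<Union>(triangles K - {t}) \<union> convex hull {q, r} \<union> convex hull {p, r}"
  have finK: "finite K" using K by (simp add: simplicial_complex_def)
  have "closed C"
    unfolding C_def using finK
    by (intro closed_Un closed_Union ballI compact_imp_closed)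
       (auto simp: triangles_def intro: compact_simplex finite_imp_compact_convex_hull)
  have avoid: "?g z \<notin> C" if z: "z \<in> V" for z
  proof
    assume "?g z \<in> C"
    have kz: "?k (?g z) = z" by (rule tri_map_inverse[OF L])
    have lin: "linear L" using L(1) by (rule bounded_linear.linear)
    have not_qr: "?g z \<notin> convex hull {q, r}"
    proof
      assume "?g z \<in> convex hull {q, r}"
      then obtain s where "?g z = q + s *\<^sub>R (r - q)" unfolding convex_hull_2_coordinates by blast
      then have "?g z - p = (q - p) + s *\<^sub>R ((r - p) - (q - p))" by simp
      then have "z = 1 + of_real s * (\<i> - 1)"
        using kz L(2,3) by (simp only: linear_add[OF lin] linear_scale[OF lin] linear_diff[OF lin] scaleR_conv_of_real)
      then show False using z by (simp add: V_def)
    qed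
    have not_pr: "?g z \<notin> convex hull {p, r}"
    proof
      assume "?g z \<in> convex hull {p, r}"
      then obtain s where "?g z = p + s *\<^sub>R (r - p)" unfolding convex_hull_2_coordinates by blast
      then have "?g z - p = s *\<^sub>R (r - p)" by simp
      then have "z = of_real s * \<i>" using kz L(3) by (simp only: linear_scale[OF lin] scaleR_conv_of_real)
      then show False using z by (simp add: V_def)
    qed
    obtain t' where t': "t' \<in> triangles K" "t' \<noteq> t" "?g z \<in> t'"
      using \<open>?g z \<in> C\<close> not_qr not_pr by (auto simp: C_def)
    obtain S where S: "S \<subseteq> {p, q, r}" "S \<noteq> {p, q, r}" "t \<inter> t' = convex hull S"
      by (rule triangles_meet[OF K t(1,2,3) t'(1,2)])
    have "?g z \<in> t" unfolding t(2) using z by (intro tri_map_in_triangle) (auto simp: V_def)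
    then have gS: "?g z \<in> convex hull S" using S(3) t'(3) by blast
    have "\<not> {p, q} \<subseteq> S"
    proof
      assume "{p, q} \<subseteq> S"
      then have "convex hull {p, q} \<subseteq> t'" using S(3) hull_mono[of "{p, q}" S convex] by blast
      then show False using only[OF t'(1)] t'(2) by blast
    qed
    then have "S \<subseteq> {q, r} \<or> S \<subseteq> {p, r}" using S(1) by auto
    then show False using gS not_qr not_pr hull_mono[of S _ convex] by blast
  qed
  have N: "?g ` V = \<Union>K - C"
  proof
    show "?g ` V \<subseteq> \<Union>K - C"
    proof
      fix y assume "y \<in> ?g ` V"
      then obtain z where z: "z \<in> V" "y = ?g z" by blast
      then have "y \<in> t" unfolding t(2) by (auto simp: V_def intro: tri_map_in_triangle)
      then show "y \<in> \<Union>K - C" using triangle_subset[OF t(1)] avoid z by blast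
    qed
    show "\<Union>K - C \<subseteq> ?g ` V"
    proof
      fix y assume y: "y \<in> \<Union>K - C"
      then obtain c where c: "c \<in> K" "y \<in> c" by blast
      obtain t' where "t' \<in> triangles K" "c \<subseteq> t'" using dim c(1) by blast
      then have "y \<in> t" using y c(2) by (auto simp: C_def)
      then obtain s w where sw: "y = p + s *\<^sub>R (q - p) + w *\<^sub>R (r - p)" "0 \<le> s" "0 \<le> w" "s + w \<le> 1"
        unfolding t(2) convex_hull_3_coordinates by blast
      have "s \<noteq> 0"
      proof
        assume "s = 0"
        then have "y \<in> convex hull {p, r}" using sw unfolding convex_hull_2_coordinates by auto
        then show False using y by (simp add: C_def)
      qed
      moreover have "s + w \<noteq> 1"
      proof
        assume "s + w = 1"
        then have s: "s = 1 - w" by simp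
        have "y = q + w *\<^sub>R (r - q)" unfolding sw(1) s by (simp add: algebra_simps)
        then have "y \<in> convex hull {q, r}" using sw unfolding convex_hull_2_coordinates by auto
        then show False using y by (simp add: C_def)
      qed
      ultimately have "Complex s w \<in> V" using sw by (simp add: V_def)
      moreover have "y = ?g (Complex s w)" by (simp add: tri_map_def sw(1))
      ultimately show "y \<in> ?g ` V" by blast
    qed
  qed
  have openN: "openin (top_of_set (\<Union>K)) (?g ` V)"
    unfolding N Diff_eq using \<open>closed C\<close> by (intro openin_open_Int) (simp add: open_Compl)
  have "homeomorphism (?g ` V) V ?k ?g"
    unfolding homeomorphism_def
  proof (intro conjI ballI)
    show "continuous_on (?g ` V) ?k"
      by (intro bounded_linear.continuous_on[OF L(1)] continuous_intros)
    show "continuous_on V ?g" by (rule continuous_on_tri_map)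
  qed (auto simp: tri_map_inverse[OF L] image_iff)
  then have chart: "surface_chart (\<Union>K) (?g ` V) V ?k ?g"
    using openN V by (simp add: surface_chart_def)
  have uV: "of_real u \<in> V" using u by (simp add: V_def)
  have gu: "?g (of_real u) = p + u *\<^sub>R (q - p)" by (simp add: tri_map_def)
  have "?k (p + u *\<^sub>R (q - p)) = of_real u" using tri_map_inverse[OF L, of "of_real u"] gu by simp
  moreover have "p + u *\<^sub>R (q - p) \<in> ?g ` V" using gu uV by (metis imageI)
  ultimately show ?thesis
    using chart unfolding boundary_point_def by (metis Im_complex_of_real)
qed

text \<open>If the chart sent \<open>x\<close> to the open half-plane, it would do the same with the boundary points near \<open>x\<close>,
  and these would have a neighbourhood that is a disc.\<close>

lemma boundary_point_closure:
  assumes c: "surface_chart M N V k \<gamma>" "x \<in> N" and x: "x \<in> closure {y. boundary_point M y}"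
  shows "boundary_point M x"
proof (rule ccontr)
  assume nb: "\<not> boundary_point M x"
  have N: "openin (top_of_set M) N" and V: "V \<subseteq> half_plane" and h: "homeomorphism N V k \<gamma>"
    using c by (auto simp: surface_chart_def dest: openin_imp_subset)
  have "k x \<in> V" using c(2) homeomorphism_image1[OF h] by blast
  then have "0 < Im (k x)" using V nb c unfolding boundary_point_def by force
  define W where "W = N \<inter> k -` {z. 0 < Im z}"
  have "openin (top_of_set N) W"
    unfolding W_def using homeomorphism_cont1[OF h]
    by (rule continuous_openin_preimage_gen[OF _ open_halfspace_Im_gt])
  then have "openin (top_of_set M) W" using N openin_trans by blast
  then obtain O' where O': "open O'" "W = M \<inter> O'" by (auto simp: openin_open)
  have "x \<in> O'" using \<open>0 < Im (k x)\<close> c(2) O'(2) by (auto simp: W_def)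
  then obtain y where y: "boundary_point M y" "y \<in> O'"
    using x O'(1) by (metis (mono_tags, lifting) closure_iff_nhds_not_empty disjoint_iff mem_Collect_eq subset_refl)
  have "y \<in> M" using y(1) unfolding boundary_point_def surface_chart_def by (meson openin_imp_subset subsetD)
  then have "y \<in> N" "0 < Im (k y)" using y(2) O'(2) by (auto simp: W_def)
  then show False using interior_chart_not_boundary[OF c(1)] y(1) by blast
qed

text \<open>The given boundary point is no vertex, hence an inner point of the edge; so there is no second triangle
  at this edge. This makes all its inner points boundary points, and then the end points by closedness.\<close>

lemma boundary_edge_through_point:
  assumes K: "simplicial_complex K" and dim: "\<forall>c\<in>K. \<exists>t\<in>triangles K. c \<subseteq> t"
    and manifold: "surface (\<Union>K)"
    and t: "t \<in> triangles K" "t = convex hull {p, q, r}" "\<not> affine_dependent {p, q, r}" "p \<noteq> q" "p \<noteq> r" "q \<noteq> r"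
    and x: "x = p + u *\<^sub>R (q - p)" "0 \<le> u" "u \<le> 1" "{x} \<notin> K" "boundary_point (\<Union>K) x"
  shows "\<exists>e\<in>edges K. \<forall>y\<in>e. boundary_point (\<Union>K) y"
proof -
  have tK: "t \<in> K" using t(1) by (simp add: triangles_def)
  have face: "convex hull S \<in> K" if "S \<subseteq> {p, q, r}" for S
  proof -
    have "convex hull S face_of t"
      unfolding t(2) using that face_of_convex_hull_affine_independent[OF t(3)] by blast
    then show ?thesis using K tK unfolding simplicial_complex_def by blast
  qed
  have "{p} \<in> K" "{q} \<in> K" using face[of "{p}"] face[of "{q}"] by simp_all
  then have "u \<noteq> 0" "u \<noteq> 1" using x(1,4) by auto
  then have u: "0 < u" "u < 1" using x(2,3) by auto
  define e where "e = convex hull {p, q}"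
  have eK: "e \<in> edges K"
    unfolding edges_def e_def
  proof (intro CollectI conjI)
    show "convex hull {p, q} \<in> K" by (rule face) auto
    show "1 simplex convex hull {p, q}"
      unfolding simplex_def by (intro exI[of _ "{p, q}"]) (use t(4) affine_independent_2 in auto)
  qed
  have et: "e \<subseteq> t" unfolding e_def t(2) by (rule hull_mono) auto
  have only: "t' = t" if "t' \<in> triangles K" "e \<subseteq> t'" for t'
  proof (rule ccontr)
    assume "t' \<noteq> t"
    then have "\<not> boundary_point (\<Union>K) (p + u *\<^sub>R (q - p))"
      by (intro edge_of_two_triangles_not_boundary[OF K t(1) that(1) _ eK et that(2) e_def t(4) u]) auto
    then show False using x(1,5) by simp
  qed
  have "open_segment p q \<subseteq> {y. boundary_point (\<Union>K) y}"
  proof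
    fix y assume "y \<in> open_segment p q"
    then obtain s where s: "0 < s" "s < 1" "y = (1 - s) *\<^sub>R p + s *\<^sub>R q" by (auto simp: in_segment)
    have "boundary_point (\<Union>K) (p + s *\<^sub>R (q - p))"
      by (rule edge_of_one_triangle_boundary[OF K dim t only[unfolded e_def] s(1,2)])
    moreover have "y = p + s *\<^sub>R (q - p)" using s(3) by (simp add: algebra_simps)
    ultimately show "y \<in> {y. boundary_point (\<Union>K) y}" by simp
  qed
  then have "closure (open_segment p q) \<subseteq> closure {y. boundary_point (\<Union>K) y}" by (rule closure_mono)
  then have "e \<subseteq> closure {y. boundary_point (\<Union>K) y}"
    using t(4) by (simp add: e_def segment_convex_hull)
  moreover have "e \<subseteq> \<Union>K" using eK by (auto simp: edges_def)
  ultimately have "\<forall>y\<in>e. boundary_point (\<Union>K) y"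
    using manifold boundary_point_closure unfolding surface_def by (metis subsetD)
  then show ?thesis using eK by blast
qed

lemma exists_boundary_edge:
  assumes K: "simplicial_complex K" and dim: "\<forall>c\<in>K. \<exists>t\<in>triangles K. c \<subseteq> t"
    and manifold: "surface (\<Union>K)"
    and bd: "boundary_point (\<Union>K) x0"
  shows "\<exists>e\<in>edges K. \<forall>y\<in>e. boundary_point (\<Union>K) y"
proof -
  have "finite K" using K by (simp add: simplicial_complex_def)
  \<comment> \<open>only finitely many points are vertices\<close>
  then have "finite ((\<lambda>x. {x}) -` K)" by (intro finite_vimageI) auto
  then obtain x where x: "boundary_point (\<Union>K) x" "{x} \<notin> K"
    using infinite_boundary_points[OF bd] by (metis (mono_tags, lifting) finite_subset mem_Collect_eq subsetI vimageI)
  have "x \<in> \<Union>K" using x(1) unfolding boundary_point_def surface_chart_def by (meson openin_imp_subset subsetD)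
  then obtain t where t: "t \<in> triangles K" "x \<in> t" using dim by blast
  obtain a b c where abc: "t = convex hull {a, b, c}" "\<not> affine_dependent {a, b, c}" "a \<noteq> b" "b \<noteq> c" "a \<noteq> c"
    by (rule triangle_cases[OF K t(1)], rule that)
  note through = boundary_edge_through_point[OF K dim manifold t(1) _ _ _ _ _ _ _ _ x(2,1)]
  obtain s w where sw: "x = a + s *\<^sub>R (b - a) + w *\<^sub>R (c - a)" "0 \<le> s" "0 \<le> w" "s + w \<le> 1"
    using t(2) unfolding abc(1) convex_hull_3_coordinates by blast
  have "\<not> (0 < s \<and> 0 < w \<and> s + w < 1)"
  proof
    assume "0 < s \<and> 0 < w \<and> s + w < 1"
    then have "\<not> boundary_point (\<Union>K) (tri_map a b c (Complex s w))"
      by (intro interior_of_triangle_not_boundary[OF t(1) abc(1,2,3,5,4)]) auto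
    then show False using x(1) sw(1) by (simp add: tri_map_def)
  qed
  \<comment> \<open>the point lies on one of the three sides\<close>
  then consider "w = 0" | "s = 0" | "s + w = 1" using sw by linarith
  then show ?thesis
  proof cases
    case 1
    then have "x = a + s *\<^sub>R (b - a)" using sw(1) by simp
    from through[OF abc(1,2,3,5,4) this] show ?thesis using sw 1 by simp
  next
    case 2
    then have "x = a + w *\<^sub>R (c - a)" using sw(1) by simp
    moreover have "{a, b, c} = {a, c, b}" by auto
    ultimately show ?thesis using through[of a c b w] abc sw 2 by simp
  next
    case 3
    then have s: "s = 1 - w" by simp
    have "x = b + w *\<^sub>R (c - b)" unfolding sw(1) s by (simp add: algebra_simps)
    moreover have "{a, b, c} = {b, c, a}" by auto
    ultimately show ?thesis using through[of b c a w] abc sw by simp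
  qed
qed

section \<open>Strong connectedness\<close>

lemma half_disc_not_collinear:
  assumes "Im z \<ge> 0" "0 < e"
  shows "\<not> collinear (ball z e \<inter> half_plane)"
proof
  assume "collinear (ball z e \<inter> half_plane)"
  then obtain u where u: "\<And>x y. x \<in> ball z e \<inter> half_plane \<Longrightarrow> y \<in> ball z e \<inter> half_plane \<Longrightarrow> \<exists>c. x - y = c *\<^sub>R u"
    unfolding collinear_def by blast
  let ?d = "e/2"
  have mem: "z \<in> ball z e \<inter> half_plane" "z + of_real ?d \<in> ball z e \<inter> half_plane" "z + \<i> * of_real ?d \<in> ball z e \<inter> half_plane"
    using assms by (auto simp: dist_norm norm_mult)
  obtain c1 where "z + of_real ?d - z = c1 *\<^sub>R u" using u[OF mem(2,1)] by blast
  then have 1: "c1 * Re u = ?d" "c1 * Im u = 0" by (auto simp: complex_eq_iff)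
  obtain c2 where "z + \<i> * of_real ?d - z = c2 *\<^sub>R u" using u[OF mem(3,1)] by blast
  then have 2: "c2 * Re u = 0" "c2 * Im u = ?d" by (auto simp: complex_eq_iff)
  show False using 1 2 assms(2) by auto
qed

lemma triangle_infinite_near:
  assumes "t \<in> triangles K" "v \<in> t" "open W" "v \<in> W"
  shows "infinite (t \<inter> W)"
proof -
  have "aff_dim t = 2" "convex t" using assms(1) by (auto simp: triangles_def aff_dim_simplex simplex_def)
  then have "t \<noteq> {v}" using aff_dim_sing[of v] by auto
  then obtain w where w: "w \<in> t" "w \<noteq> v" using assms(2) by blast
  have "closed_segment v w \<subseteq> t" using \<open>convex t\<close> assms(2) w(1) by (simp add: closed_segment_subset)
  moreover have "infinite (closed_segment v w \<inter> W)"
  proof -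
    have "v islimpt closed_segment v w"
    proof (rule connected_imp_perfect)
      show "closed_segment v w \<noteq> {x}" for x using w(2) ends_in_segment(1)[of v w] ends_in_segment(2)[of w v] by (metis singletonD)
    qed auto
    then show ?thesis using assms(3,4) unfolding islimpt_eq_acc_point by (metis Int_commute)
  qed
  ultimately show ?thesis by (meson finite_subset inf_mono subset_refl)
qed

text \<open>Otherwise \<open>P\<close> and the remaining triangles form two closed sets that share no edge, hence meet in a
  finite set \<open>A\<close>, and connectedness gives a point \<open>v\<close> of \<open>A\<close>. A small half-disc around \<open>v\<close> remains connected when
  finitely many points are removed, yet \<open>P\<close> and the remaining triangles would separate it.\<close>

lemma triangles_strongly_connected:
  assumes K: "simplicial_complex K" and dim: "\<forall>c\<in>K. \<exists>t\<in>triangles K. c \<subseteq> t"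
    and manifold: "surface (\<Union>K)"
    and conn: "connected (\<Union>K)"
    and P: "P \<subseteq> triangles K" "P \<noteq> {}"
    and adj: "\<And>t t' e. t \<in> P \<Longrightarrow> t' \<in> triangles K \<Longrightarrow> e \<in> edges K \<Longrightarrow> e \<subseteq> t \<Longrightarrow> e \<subseteq> t' \<Longrightarrow> t' \<in> P"
  shows "P = triangles K"
proof (rule ccontr)
  assume "P \<noteq> triangles K"
  define Q where "Q = triangles K - P"
  have Q: "Q \<noteq> {}" "Q \<subseteq> triangles K" using P \<open>P \<noteq> triangles K\<close> by (auto simp: Q_def)
  have finT: "finite (triangles K)" using K by (simp add: simplicial_complex_def triangles_def)
  have ne: "t \<noteq> {}" "closed t" if "t \<in> triangles K" for t
    using that by (auto simp: triangles_def simplex_def intro!: compact_imp_closed finite_imp_compact_convex_hull aff_independent_finite)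
  have closed: "closed (\<Union>P)" "closed (\<Union>Q)"
    using P Q finT ne by (auto intro!: closed_Union finite_subset[OF _ finT])
  have un: "\<Union>K = \<Union>P \<union> \<Union>Q"
  proof
    show "\<Union>K \<subseteq> \<Union>P \<union> \<Union>Q"
    proof
      fix x assume "x \<in> \<Union>K"
      then obtain t where "t \<in> triangles K" "x \<in> t" using dim by blast
      then show "x \<in> \<Union>P \<union> \<Union>Q" by (cases "t \<in> P") (auto simp: Q_def)
    qed
    show "\<Union>P \<union> \<Union>Q \<subseteq> \<Union>K" using triangle_subset P(1) Q(2) by blast
  qed
  define A where "A = \<Union>P \<inter> \<Union>Q"
  have "A \<noteq> {}"
  proof
    assume "A = {}"
    then have "\<Union>P \<inter> \<Union>K = {} \<or> \<Union>Q \<inter> \<Union>K = {}"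
      using un by (intro connected_closedD[OF conn _ _ closed]) (auto simp: A_def)
    then have "\<Union>P = {} \<or> \<Union>Q = {}" using un by blast
    then show False using P Q ne(1) by blast
  qed
  then obtain v where v: "v \<in> A" by blast
  have finA: "finite A"
  proof -
    have "finite (t \<inter> t')" if tt: "t \<in> P" "t' \<in> Q" for t t'
    proof -
      have T: "t \<in> triangles K" "t' \<in> triangles K" "t' \<noteq> t" using tt P Q by (auto simp: Q_def)
      obtain a b c where abc: "t = convex hull {a, b, c}" "\<not> affine_dependent {a, b, c}" "a \<noteq> b" "b \<noteq> c" "a \<noteq> c"
          "sides K t = {convex hull {b, c}, convex hull {c, a}, convex hull {a, b}}"
        by (rule triangle_cases[OF K T(1)], rule that)
      obtain S where S: "S \<subseteq> {a, b, c}" "S \<noteq> {a, b, c}" "t \<inter> t' = convex hull S"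
        by (rule triangles_meet[OF K T(1) abc(1,2) T(2,3)])
      have no_edge: "\<not> {p, q} \<subseteq> S" if "convex hull {p, q} \<in> sides K t" for p q
      proof
        assume "{p, q} \<subseteq> S"
        then have "convex hull {p, q} \<subseteq> t'" using S(3) hull_mono[of "{p, q}" S convex] by blast
        then have "t' \<in> P" using adj[OF tt(1) T(2)] that by (auto simp: sides_def)
        then show False using tt(2) by (simp add: Q_def)
      qed
      have "S = {} \<or> S = {a} \<or> S = {b} \<or> S = {c}"
      proof -
        have "\<not> {b, c} \<subseteq> S" "\<not> {c, a} \<subseteq> S" "\<not> {a, b} \<subseteq> S" using no_edge[of b c] no_edge[of c a] no_edge[of a b] unfolding abc(6) by simp_all
        then show ?thesis using S(1) by (cases "a \<in> S"; cases "b \<in> S"; cases "c \<in> S") auto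
      qed
      then show ?thesis unfolding S(3) by (elim disjE) simp_all
    qed
    moreover have "A = (\<Union>t\<in>P. \<Union>t'\<in>Q. t \<inter> t')" by (auto simp: A_def)
    moreover have "finite P" "finite Q" using finite_subset[OF _ finT] P(1) Q(2) by auto
    ultimately show ?thesis by (simp only: finite_UN_I)
  qed
  have "v \<in> \<Union>K" using v un by (auto simp: A_def)
  then obtain N V k \<gamma> where c: "surface_chart (\<Union>K) N V k \<gamma>" "v \<in> N"
    using manifold unfolding surface_def by blast
  then have N: "openin (top_of_set (\<Union>K)) N" and V: "openin (top_of_set half_plane) V" and h: "homeomorphism N V k \<gamma>"
    by (auto simp: surface_chart_def)
  obtain W where W: "open W" "V = half_plane \<inter> W" using V by (auto simp: openin_open)
  have "k v \<in> V" using c(2) homeomorphism_image1[OF h] by blast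
  then obtain e where e: "e > 0" "ball (k v) e \<subseteq> W" using W open_contains_ball by blast
  define B where "B = ball (k v) e \<inter> half_plane"
  have BV: "B \<subseteq> V" using e W by (auto simp: B_def)
  have "Im (k v) \<ge> 0" using \<open>k v \<in> V\<close> W by auto
  have "convex B" unfolding B_def by (intro convex_Int convex_ball convex_halfspace_Im_ge)
  then have "connected (B - k ` (A \<inter> N))"
    using half_disc_not_collinear[OF \<open>Im (k v) \<ge> 0\<close> e(1)] finA
    by (intro connected_convex_diff_countable) (auto simp: B_def intro: countable_finite)
  then have "connected (\<gamma> ` (B - k ` (A \<inter> N)))"
    by (intro connected_continuous_image continuous_on_subset[OF homeomorphism_cont2[OF h]]) (use BV in auto)
  moreover define C where "C = \<gamma> ` (B - k ` (A \<inter> N))"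
  ultimately have connC: "connected C" by simp
  have CK: "C \<subseteq> \<Union>K"
    using BV homeomorphism_image2[OF h] openin_imp_subset[OF N] by (auto simp: C_def)
  have CA: "C \<inter> A = {}"
  proof -
    have "z \<in> k ` (A \<inter> N)" if "z \<in> B" "\<gamma> z \<in> A" for z
    proof -
      have "\<gamma> z \<in> N" "k (\<gamma> z) = z" using that BV homeomorphism_image2[OF h] homeomorphism_apply2[OF h] by auto
      then show ?thesis using that(2) by (metis IntI imageI)
    qed
    then show ?thesis by (auto simp: C_def)
  qed
  define G where "G = N \<inter> k -` ball (k v) e"
  have "openin (top_of_set N) G"
    unfolding G_def using homeomorphism_cont1[OF h] by (rule continuous_openin_preimage_gen) simp
  then have "openin (top_of_set (\<Union>K)) G" using N openin_trans by blast
  then obtain O' where O': "open O'" "G = \<Union>K \<inter> O'" by (auto simp: openin_open)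
  have vG: "v \<in> O'" using c(2) e(1) O'(2) by (auto simp: G_def)
  \<comment> \<open>\<open>C\<close> contains all points near \<open>v\<close> outside \<open>A\<close>, hence points of every triangle at \<open>v\<close>\<close>
  have GC: "y \<in> C" if "y \<in> G" "y \<notin> A" for y
  proof -
    have y: "y \<in> N" "k y \<in> V" "k y \<in> ball (k v) e" using that(1) homeomorphism_image1[OF h] by (auto simp: G_def)
    have "k y \<in> B" using y W by (auto simp: B_def)
    moreover have "k y \<notin> k ` (A \<inter> N)" using that(2) y(1) homeomorphism_apply1[OF h] by (metis IntD1 IntD2 imageE)
    moreover have "\<gamma> (k y) = y" using y(1) homeomorphism_apply1[OF h] by simp
    ultimately show ?thesis unfolding C_def by (metis DiffI imageI)
  qed
  have meets: "\<exists>y. y \<in> t \<and> y \<in> C" if t: "t \<in> triangles K" "v \<in> t" for t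
  proof -
    have "infinite (t \<inter> O' - A)" using triangle_infinite_near[OF t O'(1) vG] finA by simp
    then obtain y where "y \<in> t" "y \<in> O'" "y \<notin> A" by (metis DiffD1 DiffD2 IntD1 IntD2 ex_in_conv finite.emptyI)
    then show ?thesis using GC O'(2) triangle_subset[OF t(1)] by blast
  qed
  obtain t t' where "t \<in> P" "v \<in> t" "t' \<in> Q" "v \<in> t'" using v by (auto simp: A_def)
  then have "\<Union>P \<inter> C \<noteq> {}" "\<Union>Q \<inter> C \<noteq> {}" using meets[of t] meets[of t'] P Q by blast+
  moreover have "\<Union>P \<inter> C = {} \<or> \<Union>Q \<inter> C = {}"
    by (rule connected_closedD[OF connC _ _ closed]) (use CK un CA in \<open>auto simp: A_def\<close>)
  ultimately show False by blast
qed

section \<open>Rigidity\<close>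

context triangle_geometry
begin

lemma angles_determined:
  fixes K :: "'v::euclidean_space set set" and d1 d2 :: "'v set \<Rightarrow> real" and \<alpha> :: "('v set \<Rightarrow> real) \<Rightarrow> 'v set \<Rightarrow> 'v set \<Rightarrow> real"
  assumes K: "simplicial_complex K" and rigid: "pair_rigid U F"
    and tri: "\<And>d t e1 e2 e3. d \<in> {d1, d2} \<Longrightarrow> t \<in> triangles K \<Longrightarrow> sides K t = {e1, e2, e3} \<Longrightarrow> distinct [e1, e2, e3] \<Longrightarrow>
        d e1 \<in> I \<and> d e2 \<in> I \<and> d e3 \<in> I \<and> nd (d e1) (d e2) (d e3) \<and> \<alpha> d t e1 = ang (d e1) (d e2) (d e3)"
    and edge: "\<And>e. e \<in> edges K \<Longrightarrow> d1 e = d2 e \<or>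
        (\<Sum>t | t \<in> triangles K \<and> e \<in> sides K t. F (pi/2) - F (\<alpha> d1 t e)) = (\<Sum>t | t \<in> triangles K \<and> e \<in> sides K t. F (pi/2) - F (\<alpha> d2 t e))"
    and t: "t \<in> triangles K" "e \<in> sides K t"
  shows "\<alpha> d1 t e = \<alpha> d2 t e"
proof (rule angles_equal[where T = "triangles K" and E = "edges K" and S = "sides K" and U = U and F = F and ?d1.0 = d1 and ?d2.0 = d2])
  have finK: "finite K" using K by (simp add: simplicial_complex_def)
  then show "finite (triangles K)" "finite (edges K)" by (simp_all add: triangles_def edges_def)
  show "sides K t \<subseteq> edges K" if "t \<in> triangles K" for t by (auto simp: sides_def)
  show "U (d2 e) = U (d1 e) \<or> (\<Sum>t | t \<in> triangles K \<and> e \<in> sides K t. F (\<alpha> d2 t e) - F (\<alpha> d1 t e)) = 0" if "e \<in> edges K" for e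
    using edge[OF that] by (auto simp: sum_subtractf)
  have core: "0 \<le> (\<Sum>e\<in>sides K t. (U (d2 e) - U (d1 e)) * (F (\<alpha> d2 t e) - F (\<alpha> d1 t e))) \<and>
      ((\<Sum>e\<in>sides K t. (U (d2 e) - U (d1 e)) * (F (\<alpha> d2 t e) - F (\<alpha> d1 t e))) = 0 \<longrightarrow> (\<forall>e\<in>sides K t. \<alpha> d1 t e = \<alpha> d2 t e))"
    if t: "t \<in> triangles K" for t
  proof -
    obtain e1 e2 e3 where s: "sides K t = {e1, e2, e3}" "distinct [e1, e2, e3]"
      by (rule triangle_cases[OF K t], rule that)
    have s': "sides K t = {e2, e3, e1}" "distinct [e2, e3, e1]" "sides K t = {e3, e1, e2}" "distinct [e3, e1, e2]"
      using s by auto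
    have a: "\<alpha> d t e1 = ang (d e1) (d e2) (d e3)" "\<alpha> d t e2 = ang (d e2) (d e3) (d e1)" "\<alpha> d t e3 = ang (d e3) (d e1) (d e2)"
      if "d \<in> {d1, d2}" for d
      using tri[OF that t s] tri[OF that t s'(1,2)] tri[OF that t s'(3,4)] by auto
    have i: "d e1 \<in> I" "d e2 \<in> I" "d e3 \<in> I" "nd (d e1) (d e2) (d e3)" if "d \<in> {d1, d2}" for d
      using tri[OF that t s] by auto
    have "(\<Sum>e\<in>sides K t. (U (d2 e) - U (d1 e)) * (F (\<alpha> d2 t e) - F (\<alpha> d1 t e))) =
       (U (d2 e1) - U (d1 e1)) * (F (\<alpha> d2 t e1) - F (\<alpha> d1 t e1)) + (U (d2 e2) - U (d1 e2)) * (F (\<alpha> d2 t e2) - F (\<alpha> d1 t e2))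
       + (U (d2 e3) - U (d1 e3)) * (F (\<alpha> d2 t e3) - F (\<alpha> d1 t e3))"
      unfolding s(1) using s(2) by simp
    then show ?thesis
      using rigid[unfolded pair_rigid_def Let_def, THEN spec, THEN spec, THEN spec, THEN spec, THEN spec, THEN spec,
         of "d1 e1" "d1 e2" "d1 e3" "d2 e1" "d2 e2" "d2 e3"] i[of d1] i[of d2]
      by (simp add: a s(1))
  qed
  show "0 \<le> (\<Sum>e\<in>sides K t. (U (d2 e) - U (d1 e)) * (F (\<alpha> d2 t e) - F (\<alpha> d1 t e)))" if "t \<in> triangles K" for t
    using core[OF that] by blast
  show "\<alpha> d1 t e = \<alpha> d2 t e" if "t \<in> triangles K" "(\<Sum>e\<in>sides K t. (U (d2 e) - U (d1 e)) * (F (\<alpha> d2 t e) - F (\<alpha> d1 t e))) = 0"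
     "e \<in> sides K t" for t e
    using core[OF that(1)] that by blast
qed (rule t)+

end

text \<open>Chosen such that the upper limit of the integral in the \<open>\<psi>\<close>-curvature is \<open>\<pi>/2 - psi_angle\<close>. The
  substitution \<open>t \<mapsto> \<pi>/2 - t\<close> then turns the \<open>\<psi>\<close>-curvature into an expression like the \<open>\<phi>\<close>-curvature.\<close>

definition psi_angle :: "geometry \<Rightarrow> 'v::euclidean_space set set \<Rightarrow> ('v set \<Rightarrow> real) \<Rightarrow> 'v set \<Rightarrow> 'v set \<Rightarrow> real" where
  "psi_angle G K d t e = (pi + facing_angle G K d t e - (\<Sum>e'\<in>sides K t - {e}. facing_angle G K d t e')) / 2"

lemma phi_curvature_eq:
  assumes dF: "\<And>t. 0 < t \<Longrightarrow> t < pi \<Longrightarrow> (F has_real_derivative sin t powr h) (at t)"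
    and a: "\<And>t. t \<in> triangles K \<Longrightarrow> e \<in> sides K t \<Longrightarrow> facing_angle G K d t e \<in> {0<..<pi}"
  shows "phi_curvature G h K d e = (\<Sum>t | t \<in> triangles K \<and> e \<in> sides K t. F (pi/2) - F (facing_angle G K d t e))"
  unfolding phi_curvature_def
proof (rule sum.cong[OF refl])
  fix t assume "t \<in> {t. t \<in> triangles K \<and> e \<in> sides K t}"
  then have "0 < facing_angle G K d t e" "facing_angle G K d t e < pi" using a by auto
  then show "(LBINT x = ereal (facing_angle G K d t e)..ereal (pi / 2). sin x powr h) = F (pi/2) - F (facing_angle G K d t e)"
    by (intro sin_powr_integral dF)
qed

lemma psi_curvature_eq:
  assumes dF: "\<And>t. 0 < t \<Longrightarrow> t < pi \<Longrightarrow> (F has_real_derivative sin t powr h) (at t)"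
    and a: "\<And>t. t \<in> triangles K \<Longrightarrow> e \<in> sides K t \<Longrightarrow> psi_angle G K d t e \<in> {0<..<pi}"
  shows "psi_curvature G h K d e = (\<Sum>t | t \<in> triangles K \<and> e \<in> sides K t. F (pi/2) - F (psi_angle G K d t e))"
  unfolding psi_curvature_def
proof (rule sum.cong[OF refl])
  fix t assume "t \<in> {t. t \<in> triangles K \<and> e \<in> sides K t}"
  then have "0 < psi_angle G K d t e" "psi_angle G K d t e < pi" using a by auto
  then have "(LBINT x = 0..ereal (pi/2 - psi_angle G K d t e). cos x powr h) = F (pi/2) - F (psi_angle G K d t e)"
    by (intro cos_powr_integral dF)
  moreover have "((\<Sum>e'\<in>sides K t - {e}. facing_angle G K d t e') - facing_angle G K d t e) / 2 = pi/2 - psi_angle G K d t e"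
    by (simp add: psi_angle_def field_simps)
  ultimately show "(LBINT x = 0..ereal (((\<Sum>e' \<in> sides K t - {e}. facing_angle G K d t e') - facing_angle G K d t e) / 2). cos x powr h)
      = F (pi/2) - F (psi_angle G K d t e)"
    by (simp only:)
qed

lemma sides_rotate:
  assumes "sides K t = {e1, e2, e3}" "distinct [e1, e2, e3]"
  shows "sides K t = {e2, e3, e1}" "distinct [e2, e3, e1]" "sides K t = {e3, e1, e2}" "distinct [e3, e1, e2]"
  using assms by auto

lemma psi_angle_eq:
  assumes s: "sides K t = {e1, e2, e3}" "distinct [e1, e2, e3]"
  shows "psi_angle G K d t e1 = (pi + triangle_angle G (d e1) (d e2) (d e3)
     - triangle_angle G (d e2) (d e3) (d e1) - triangle_angle G (d e3) (d e1) (d e2)) / 2"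
proof -
  have "sides K t - {e1} = {e2, e3}" using s by auto
  then show ?thesis
    using s(2) unfolding psi_angle_def
    by (simp add: facing_angle_eq[OF s] facing_angle_eq[OF sides_rotate(1,2)[OF s]] facing_angle_eq[OF sides_rotate(3,4)[OF s]])
qed

lemma side_cases:
  assumes K: "simplicial_complex K" and t: "t \<in> triangles K" and e: "e \<in> sides K t"
  obtains e2 e3 where "sides K t = {e, e2, e3}" "distinct [e, e2, e3]"
proof -
  obtain a b c where s: "sides K t = {a, b, c}" "distinct [a, b, c]"
    by (rule triangle_cases[OF K t], rule that)
  then have "e = a \<or> e = b \<or> e = c" using e by auto
  then show ?thesis using that s sides_rotate[OF s] by metis
qed

lemma triangle_of_edge:
  assumes dim: "\<forall>c\<in>K. \<exists>t\<in>triangles K. c \<subseteq> t" and e: "e \<in> edges K"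
  obtains t where "t \<in> triangles K" "e \<in> sides K t"
proof -
  have "e \<in> K" using e by (simp add: edges_def)
  then obtain t where "t \<in> triangles K" "e \<subseteq> t" using dim by blast
  then show ?thesis using that e by (simp add: sides_def)
qed

lemma primitive_on_interval:
  fixes a :: real and b :: ereal and w :: "real \<Rightarrow> real"
  assumes "ereal a < b" "\<And>x. a < x \<Longrightarrow> ereal x < b \<Longrightarrow> isCont w x"
  obtains U where "\<And>x. a < x \<Longrightarrow> ereal x < b \<Longrightarrow> (U has_real_derivative w x) (at x)"
  using einterval_antiderivative[of "ereal a" b w] assms
  by (auto simp: has_real_derivative_iff_has_vector_derivative)

lemma isCont_powr_const: "isCont g x \<Longrightarrow> g x \<noteq> 0 \<Longrightarrow> isCont (\<lambda>x. g x powr c) x" for g :: "real \<Rightarrow> real"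
  unfolding isCont_def by (intro tendsto_powr tendsto_const)

lemma sin_powr_primitive:
  obtains F where "\<And>t. 0 < t \<Longrightarrow> t < pi \<Longrightarrow> (F has_real_derivative sin t powr h) (at t)"
proof (rule primitive_on_interval[of 0 "ereal pi" "\<lambda>t. sin t powr h"])
  show "isCont (\<lambda>t. sin t powr h) x" if "0 < x" "ereal x < ereal pi" for x
    using sin_gt_zero[of x] that by (intro isCont_powr_const) auto
qed (use that in auto)

lemma spherical_rigidity:
  assumes K: "simplicial_complex K" and dim: "\<forall>c\<in>K. \<exists>t\<in>triangles K. c \<subseteq> t"
    and d: "polyhedral_metric Spherical K d1" "polyhedral_metric Spherical K d2"
    and edge: "\<And>e. e \<in> edges K \<Longrightarrow> d1 e = d2 e \<or> phi_curvature Spherical h K d1 e = phi_curvature Spherical h K d2 e"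
    and e: "e \<in> edges K"
  shows "d1 e = d2 e"
proof -
  obtain F where dF: "\<And>t. 0 < t \<Longrightarrow> t < pi \<Longrightarrow> (F has_real_derivative sin t powr h) (at t)"
    using sin_powr_primitive by blast
  obtain U where dU: "\<And>x. x \<in> {0<..<pi} \<Longrightarrow> (U has_real_derivative sin x powr (-h-1)) (at x)"
    using sin_powr_primitive[of "-h-1"] by (metis greaterThanLessThan_iff)
  have tri: "d e1 \<in> {0<..<pi} \<and> d e2 \<in> {0<..<pi} \<and> d e3 \<in> {0<..<pi} \<and> 0 < sph_gram (d e1) (d e2) (d e3) \<and>
      facing_angle Spherical K d t e1 = carc (sph_cos (d e1) (d e2) (d e3))"
    if "d \<in> {d1, d2}" "t \<in> triangles K" "sides K t = {e1, e2, e3}" "distinct [e1, e2, e3]" for d t e1 e2 e3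
  proof -
    have "polyhedral_metric Spherical K d" using that(1) d by auto
    then have T: "triangle_lengths Spherical (d e1) (d e2) (d e3)" using that unfolding polyhedral_metric_def by blast
    then have I: "d e1 \<in> {0<..<pi}" "d e2 \<in> {0<..<pi}" "d e3 \<in> {0<..<pi}" by auto
    then have "\<bar>sph_cos (d e1) (d e2) (d e3)\<bar> < 1" using sph_gram_pos[OF T] sph_cos_less_1 by (auto simp: sin_gt_zero)
    then show ?thesis
      using sph_gram_pos[OF T] I facing_angle_eq[OF that(3,4), of Spherical d] by (auto simp: carc_eq_arccos sph_cos_def)
  qed
  have range: "facing_angle Spherical K d t e \<in> {0<..<pi}" if dd: "d \<in> {d1, d2}" and t: "t \<in> triangles K" "e \<in> sides K t" for d t e
  proof -
    obtain e2 e3 where s: "sides K t = {e, e2, e3}" "distinct [e, e2, e3]" by (rule side_cases[OF K t])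
    then show ?thesis using tri[OF dd t(1) s] spherical.ang_range by auto
  qed
  have curv: "phi_curvature Spherical h K d e = (\<Sum>t | t \<in> triangles K \<and> e \<in> sides K t. F (pi/2) - F (facing_angle Spherical K d t e))"
    if "d \<in> {d1, d2}" for d e
    by (rule phi_curvature_eq[OF dF range[OF that]])
  have eq: "facing_angle Spherical K d1 t e = facing_angle Spherical K d2 t e" if "t \<in> triangles K" "e \<in> sides K t" for t e
  proof (rule spherical.angles_determined[OF K spherical_pair_inequality[OF dU dF] tri _ that])
    fix e assume "e \<in> edges K"
    then show "d1 e = d2 e \<or> (\<Sum>t | t \<in> triangles K \<and> e \<in> sides K t. F (pi/2) - F (facing_angle Spherical K d1 t e))
       = (\<Sum>t | t \<in> triangles K \<and> e \<in> sides K t. F (pi/2) - F (facing_angle Spherical K d2 t e))"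
      using edge[of e] curv[of d1 e] curv[of d2 e] by simp
  qed
  obtain t where t: "t \<in> triangles K" "e \<in> sides K t" by (rule triangle_of_edge[OF dim e])
  obtain e2 e3 where s: "sides K t = {e, e2, e3}" "distinct [e, e2, e3]" by (rule side_cases[OF K t])
  note s' = sides_rotate[OF s]
  have in3: "e2 \<in> sides K t" "e3 \<in> sides K t" using s by auto
  note t1 = tri[of d1, OF _ t(1)] and t2 = tri[of d2, OF _ t(1)]
  show ?thesis
    using sph_side_determined[of "d1 e" "d1 e2" "d1 e3" "d2 e" "d2 e2" "d2 e3"] t1[OF _ s] t2[OF _ s]
      t1[OF _ s'(1,2)] t2[OF _ s'(1,2)] t1[OF _ s'(3,4)] t2[OF _ s'(3,4)] eq[OF t] eq[OF t(1) in3(1)] eq[OF t(1) in3(2)] by simp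
qed

lemma hyperbolic_rigidity:
  assumes K: "simplicial_complex K" and dim: "\<forall>c\<in>K. \<exists>t\<in>triangles K. c \<subseteq> t"
    and d: "polyhedral_metric Hyperbolic K d1" "polyhedral_metric Hyperbolic K d2"
    and edge: "\<And>e. e \<in> edges K \<Longrightarrow> d1 e = d2 e \<or> psi_curvature Hyperbolic h K d1 e = psi_curvature Hyperbolic h K d2 e"
    and e: "e \<in> edges K"
  shows "d1 e = d2 e"
proof -
  obtain F where dF: "\<And>t. 0 < t \<Longrightarrow> t < pi \<Longrightarrow> (F has_real_derivative sin t powr h) (at t)"
    using sin_powr_primitive by blast
  obtain U where dU: "\<And>x. x \<in> {0<..} \<Longrightarrow> (U has_real_derivative tanh (x/2) powr (-h-1)) (at x)"
  proof (rule primitive_on_interval[of 0 "\<infinity>" "\<lambda>x. tanh (x/2) powr (-h-1)"])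
    show "isCont (\<lambda>x. tanh (x/2) powr (-h-1)) x" if "0 < x" for x :: real
      using that by (intro isCont_powr_const continuous_intros) auto
  qed (use that in auto)
  have tri: "d e1 \<in> {0<..} \<and> d e2 \<in> {0<..} \<and> d e3 \<in> {0<..} \<and> 0 < hyp_gram (d e1) (d e2) (d e3) \<and>
      psi_angle Hyperbolic K d t e1 = hyp_ang (d e1) (d e2) (d e3)"
    if "d \<in> {d1, d2}" "t \<in> triangles K" "sides K t = {e1, e2, e3}" "distinct [e1, e2, e3]" for d t e1 e2 e3
  proof -
    have "polyhedral_metric Hyperbolic K d" using that(1) d by auto
    then have T: "triangle_lengths Hyperbolic (d e1) (d e2) (d e3)" using that unfolding polyhedral_metric_def by blast
    then have I: "0 < d e1" "0 < d e2" "0 < d e3" by auto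
    then have nd: "0 < hyp_gram (d e1) (d e2) (d e3)" using T hyp_gram_pos_iff by auto
    have angle: "triangle_angle Hyperbolic x y z = carc (hyp_cos x y z)" if "0 < y" "0 < z" "0 < hyp_gram x y z" for x y z
      using that hyp_cos_less_1[of y z x] by (simp add: carc_eq_arccos hyp_cos_def)
    have "0 < hyp_gram (d e2) (d e3) (d e1)" "0 < hyp_gram (d e3) (d e1) (d e2)"
      using nd hyp_gram_cyclic by metis+
    then show ?thesis
      using nd I psi_angle_eq[OF that(3,4), of Hyperbolic d] by (simp add: hyp_ang_def angle del: triangle_angle.simps)
  qed
  have range: "psi_angle Hyperbolic K d t e \<in> {0<..<pi}" if dd: "d \<in> {d1, d2}" and t: "t \<in> triangles K" "e \<in> sides K t" for d t e
  proof -
    obtain e2 e3 where s: "sides K t = {e, e2, e3}" "distinct [e, e2, e3]" by (rule side_cases[OF K t])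
    then show ?thesis using tri[OF dd t(1) s] hyperbolic.ang_range by auto
  qed
  have curv: "psi_curvature Hyperbolic h K d e = (\<Sum>t | t \<in> triangles K \<and> e \<in> sides K t. F (pi/2) - F (psi_angle Hyperbolic K d t e))"
    if "d \<in> {d1, d2}" for d e
    by (rule psi_curvature_eq[OF dF range[OF that]])
  have eq: "psi_angle Hyperbolic K d1 t e = psi_angle Hyperbolic K d2 t e" if "t \<in> triangles K" "e \<in> sides K t" for t e
  proof (rule hyperbolic.angles_determined[OF K hyperbolic_pair_inequality[OF dU dF] tri _ that])
    fix e assume "e \<in> edges K"
    then show "d1 e = d2 e \<or> (\<Sum>t | t \<in> triangles K \<and> e \<in> sides K t. F (pi/2) - F (psi_angle Hyperbolic K d1 t e))
       = (\<Sum>t | t \<in> triangles K \<and> e \<in> sides K t. F (pi/2) - F (psi_angle Hyperbolic K d2 t e))"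
      using edge[of e] curv[of d1 e] curv[of d2 e] by simp
  qed
  obtain t where t: "t \<in> triangles K" "e \<in> sides K t" by (rule triangle_of_edge[OF dim e])
  obtain e2 e3 where s: "sides K t = {e, e2, e3}" "distinct [e, e2, e3]" by (rule side_cases[OF K t])
  note s' = sides_rotate[OF s]
  have in3: "e2 \<in> sides K t" "e3 \<in> sides K t" using s by auto
  note t1 = tri[of d1, OF _ t(1)] and t2 = tri[of d2, OF _ t(1)]
  show ?thesis
    using hyp_side_determined[of "d1 e" "d1 e2" "d1 e3" "d2 e" "d2 e2" "d2 e3"] t1[OF _ s] t2[OF _ s]
      t1[OF _ s'(1,2)] t2[OF _ s'(1,2)] t1[OF _ s'(3,4)] t2[OF _ s'(3,4)] eq[OF t] eq[OF t(1) in3(1)] eq[OF t(1) in3(2)] by simp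
qed

text \<open>The angles of a Euclidean triangle add up to \<open>\<pi>\<close>, so that \<open>psi_angle\<close> is just the facing angle and the
  two kinds of curvature coincide. Equal angles leave the scale of the triangle open.\<close>

lemma euclidean_angle_rigidity:
  assumes K: "simplicial_complex K"
    and d: "polyhedral_metric Euclidean K d1" "polyhedral_metric Euclidean K d2"
    and edge: "(\<forall>e\<in>edges K. d1 e = d2 e \<or> phi_curvature Euclidean h K d1 e = phi_curvature Euclidean h K d2 e) \<or>
       (\<forall>e\<in>edges K. d1 e = d2 e \<or> psi_curvature Euclidean h K d1 e = psi_curvature Euclidean h K d2 e)"
    and t: "t \<in> triangles K" and s: "sides K t = {e1, e2, e3}" "distinct [e1, e2, e3]"
  shows "d2 e1 / d1 e1 = d2 e2 / d1 e2"
proof -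
  obtain F where dF: "\<And>t. 0 < t \<Longrightarrow> t < pi \<Longrightarrow> (F has_real_derivative sin t powr h) (at t)"
    using sin_powr_primitive by blast
  obtain U where dU: "\<And>x. x \<in> {0<..} \<Longrightarrow> (U has_real_derivative x powr (-h-1)) (at x)"
  proof (rule primitive_on_interval[of 0 "\<infinity>" "\<lambda>x. x powr (-h-1)"])
    show "isCont (\<lambda>x. x powr (-h-1)) x" if "0 < x" for x :: real
      using that by (intro isCont_powr_const continuous_intros) auto
  qed (use that in auto)
  have angle: "triangle_angle Euclidean x y z = carc (euc_cos x y z)" if "0 < y" "0 < z" "0 < euc_gram x y z" for x y z
    using that euc_cos_less_1[of y z x] by (simp add: carc_eq_arccos euc_cos_def)
  have nd: "0 < d e1 \<and> 0 < d e2 \<and> 0 < d e3 \<and> 0 < euc_gram (d e1) (d e2) (d e3)"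
    if "d \<in> {d1, d2}" "t \<in> triangles K" "sides K t = {e1, e2, e3}" "distinct [e1, e2, e3]" for d t e1 e2 e3
  proof -
    have "polyhedral_metric Euclidean K d" using that(1) d by auto
    then have T: "triangle_lengths Euclidean (d e1) (d e2) (d e3)" using that unfolding polyhedral_metric_def by blast
    then have "0 < d e1" "0 < d e2" "0 < d e3" by auto
    then show ?thesis using T euc_gram_pos_iff by auto
  qed
  have tri: "d e1 \<in> {0<..} \<and> d e2 \<in> {0<..} \<and> d e3 \<in> {0<..} \<and> 0 < euc_gram (d e1) (d e2) (d e3) \<and>
      facing_angle Euclidean K d t e1 = carc (euc_cos (d e1) (d e2) (d e3))"
    if "d \<in> {d1, d2}" "t \<in> triangles K" "sides K t = {e1, e2, e3}" "distinct [e1, e2, e3]" for d t e1 e2 e3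
    using nd[OF that] facing_angle_eq[OF that(3,4), of Euclidean d] by (simp add: angle del: triangle_angle.simps)
  have psi: "psi_angle Euclidean K d t e = facing_angle Euclidean K d t e" and range: "facing_angle Euclidean K d t e \<in> {0<..<pi}"
    if dd: "d \<in> {d1, d2}" and t: "t \<in> triangles K" "e \<in> sides K t" for d t e
  proof -
    obtain e2 e3 where s: "sides K t = {e, e2, e3}" "distinct [e, e2, e3]" by (rule side_cases[OF K t])
    note n = nd[OF dd t(1) s]
    have n': "0 < euc_gram (d e2) (d e3) (d e)" "0 < euc_gram (d e3) (d e) (d e2)" using n euc_gram_cyclic by metis+
    show "facing_angle Euclidean K d t e \<in> {0<..<pi}" using tri[OF dd t(1) s] euclidean.ang_range by auto
    show "psi_angle Euclidean K d t e = facing_angle Euclidean K d t e"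
      using n n' euc_angle_sum[of "d e" "d e2" "d e3"]
      by (simp add: psi_angle_eq[OF s] facing_angle_eq[OF s] angle field_simps del: triangle_angle.simps)
  qed
  have psi_range: "psi_angle Euclidean K d t e \<in> {0<..<pi}" if "d \<in> {d1, d2}" "t \<in> triangles K" "e \<in> sides K t" for d t e
    using psi[OF that] range[OF that] by simp
  have psi_eq: "psi_curvature Euclidean h K d e = (\<Sum>t | t \<in> triangles K \<and> e \<in> sides K t. F (pi/2) - F (facing_angle Euclidean K d t e))"
    if "d \<in> {d1, d2}" for d e
  proof -
    have "psi_curvature Euclidean h K d e = (\<Sum>t | t \<in> triangles K \<and> e \<in> sides K t. F (pi/2) - F (psi_angle Euclidean K d t e))"
      by (rule psi_curvature_eq[OF dF psi_range[OF that]])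
    also have "\<dots> = (\<Sum>t | t \<in> triangles K \<and> e \<in> sides K t. F (pi/2) - F (facing_angle Euclidean K d t e))"
      by (rule sum.cong[OF refl]) (use psi[OF that] in auto)
    finally show ?thesis .
  qed
  have phi_eq: "phi_curvature Euclidean h K d e = (\<Sum>t | t \<in> triangles K \<and> e \<in> sides K t. F (pi/2) - F (facing_angle Euclidean K d t e))"
    if "d \<in> {d1, d2}" for d e
    by (rule phi_curvature_eq[OF dF range[OF that]])
  have eq: "facing_angle Euclidean K d1 t e = facing_angle Euclidean K d2 t e" if "t \<in> triangles K" "e \<in> sides K t" for t e
  proof (rule euclidean.angles_determined[OF K euclidean_pair_inequality[OF dU dF] tri _ that])
    fix e assume "e \<in> edges K"
    then show "d1 e = d2 e \<or> (\<Sum>t | t \<in> triangles K \<and> e \<in> sides K t. F (pi/2) - F (facing_angle Euclidean K d1 t e))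
       = (\<Sum>t | t \<in> triangles K \<and> e \<in> sides K t. F (pi/2) - F (facing_angle Euclidean K d2 t e))"
      using edge phi_eq[of d1 e] phi_eq[of d2 e] psi_eq[of d1 e] psi_eq[of d2 e] by auto
  qed
  note s' = sides_rotate[OF s]
  have in3: "e1 \<in> sides K t" "e2 \<in> sides K t" "e3 \<in> sides K t" using s by auto
  note t1 = tri[of d1, OF _ t] and t2 = tri[of d2, OF _ t]
  show ?thesis
    using euc_sides_proportional[of "d1 e1" "d1 e2" "d1 e3" "d2 e1" "d2 e2" "d2 e3"] t1[OF _ s] t2[OF _ s]
      t1[OF _ s'(1,2)] t2[OF _ s'(1,2)] t1[OF _ s'(3,4)] t2[OF _ s'(3,4)] eq[OF t in3(1)] eq[OF t in3(2)] eq[OF t in3(3)] by simp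
qed

text \<open>The scale is settled at the edge \<open>e0\<close>. It passes from a triangle to its neighbours through the
  common side and thus, by strong connectedness, reaches all triangles.\<close>

lemma euclidean_rigidity:
  assumes K: "simplicial_complex K" and dim: "\<forall>c\<in>K. \<exists>t\<in>triangles K. c \<subseteq> t"
    and manifold: "surface (\<Union>K)"
    and conn: "connected (\<Union>K)"
    and d: "polyhedral_metric Euclidean K d1" "polyhedral_metric Euclidean K d2"
    and edge: "(\<forall>e\<in>edges K. d1 e = d2 e \<or> phi_curvature Euclidean h K d1 e = phi_curvature Euclidean h K d2 e) \<or>
       (\<forall>e\<in>edges K. d1 e = d2 e \<or> psi_curvature Euclidean h K d1 e = psi_curvature Euclidean h K d2 e)"
    and e0: "e0 \<in> edges K" "d1 e0 = d2 e0" and e: "e \<in> edges K"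
  shows "d1 e = d2 e"
proof -
  have pos: "0 < d1 e" if "e \<in> edges K" for e using d(1) that by (simp add: polyhedral_metric_def)
  define P where "P = {t \<in> triangles K. \<forall>e\<in>sides K t. d1 e = d2 e}"
  have spread: "t \<in> P" if t: "t \<in> triangles K" "e \<in> sides K t" and eq: "d1 e = d2 e" for t e
  proof -
    obtain e2 e3 where s: "sides K t = {e, e2, e3}" "distinct [e, e2, e3]" by (rule side_cases[OF K t])
    have s2: "sides K t = {e, e3, e2}" "distinct [e, e3, e2]" using s by auto
    have E: "e \<in> edges K" "e2 \<in> edges K" "e3 \<in> edges K" using s(1) by (auto simp: sides_def)
    have "d2 e / d1 e = d2 e2 / d1 e2" "d2 e / d1 e = d2 e3 / d1 e3"
      using euclidean_angle_rigidity[OF K d edge t(1) s] euclidean_angle_rigidity[OF K d edge t(1) s2] by auto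
    then have "d1 e2 = d2 e2" "d1 e3 = d2 e3" using eq pos[OF E(1)] pos[OF E(2)] pos[OF E(3)] by auto
    then show ?thesis using t(1) eq by (simp add: P_def s(1))
  qed
  have "P = triangles K"
  proof (rule triangles_strongly_connected[OF K dim manifold conn])
    show "P \<subseteq> triangles K" by (auto simp: P_def)
    obtain t where "t \<in> triangles K" "e0 \<in> sides K t" by (rule triangle_of_edge[OF dim e0(1)])
    then show "P \<noteq> {}" using spread e0(2) by blast
    fix t t' e assume "t \<in> P" "t' \<in> triangles K" "e \<in> edges K" "e \<subseteq> t" "e \<subseteq> t'"
    then show "t' \<in> P" using spread[of t' e] by (auto simp: P_def sides_def)
  qed
  moreover obtain t where "t \<in> triangles K" "e \<in> sides K t" by (rule triangle_of_edge[OF dim e])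
  ultimately show ?thesis by (auto simp: P_def)
qed

theorem theorem1p7:
  fixes X :: "'s topology" and K :: "'v::euclidean_space set set" and f :: "'v \<Rightarrow> 's" and h :: real
  assumes "bordered_triangulated_surface X K f" and "connected_space X"
  shows
    "(\<forall>d1 d2. polyhedral_metric Euclidean K d1 \<and> polyhedral_metric Euclidean K d2 \<and>
        (\<forall>e \<in> boundary_edges X K f. d1 e = d2 e) \<and>
        ((\<forall>e \<in> interior_edges X K f.
            phi_curvature Euclidean h K d1 e = phi_curvature Euclidean h K d2 e) \<or>
         (\<forall>e \<in> interior_edges X K f.
            psi_curvature Euclidean h K d1 e = psi_curvature Euclidean h K d2 e))
        \<longrightarrow> (\<forall>e \<in> edges K. d1 e = d2 e)) \<and>
     (\<forall>d1 d2. polyhedral_metric Hyperbolic K d1 \<and> polyhedral_metric Hyperbolic K d2 \<and>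
        (\<forall>e \<in> boundary_edges X K f. d1 e = d2 e) \<and>
        (\<forall>e \<in> interior_edges X K f.
            psi_curvature Hyperbolic h K d1 e = psi_curvature Hyperbolic h K d2 e)
        \<longrightarrow> (\<forall>e \<in> edges K. d1 e = d2 e)) \<and>
     (\<forall>d1 d2. polyhedral_metric Spherical K d1 \<and> polyhedral_metric Spherical K d2 \<and>
        (\<forall>e \<in> boundary_edges X K f. d1 e = d2 e) \<and>
        (\<forall>e \<in> interior_edges X K f.
            phi_curvature Spherical h K d1 e = phi_curvature Spherical h K d2 e)
        \<longrightarrow> (\<forall>e \<in> edges K. d1 e = d2 e))"
proof -
  have X: "compact_surface X" "surface_boundary X \<noteq> {}" and tr: "triangulation_of X K f"
    using assms(1) by (auto simp: bordered_triangulated_surface_def)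
  have K: "simplicial_complex K" and dim: "\<forall>c\<in>K. \<exists>t\<in>triangles K. c \<subseteq> t" and f: "homeomorphic_map (top_of_set (\<Union>K)) X f"
    using tr by (auto simp: triangulation_of_def)
  have img: "f ` \<Union>K = topspace X" using homeomorphic_imp_surjective_map[OF f] by simp
  have manifold: "surface (\<Union>K)"
    unfolding surface_def
  proof
    fix x assume x: "x \<in> \<Union>K"
    then have "f x \<in> topspace X" using img by blast
    then obtain U \<kappa> where \<kappa>: "f x \<in> U" "half_plane_chart X U \<kappa>" using X(1) unfolding compact_surface_def by meson
    obtain V \<gamma> where "surface_chart (\<Union>K) {x \<in> \<Union>K. f x \<in> U} V (\<kappa> \<circ> f) \<gamma>"
      by (rule surface_chart_of_half_plane_chart[OF f \<kappa>(2)])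
    then show "\<exists>N V k \<gamma>. surface_chart (\<Union>K) N V k \<gamma> \<and> x \<in> N" using x \<kappa>(1) by blast
  qed
  have conn: "connected (\<Union>K)"
    using assms(2) homeomorphic_connected_space[of "top_of_set (\<Union>K)" X] f
    by (auto simp: homeomorphic_space connectedin_topspace[symmetric] connectedin_iff_connected simp del: connectedin_topspace)
  obtain y where y: "y \<in> surface_boundary X" using X(2) by blast
  then obtain U \<kappa> where "y \<in> U" "half_plane_chart X U \<kappa>" by (auto simp: surface_boundary_def)
  then have "y \<in> topspace X" by (auto simp: half_plane_chart_def dest: openin_subset)
  then obtain x0 where x0: "x0 \<in> \<Union>K" "y = f x0" using img by blast
  have "boundary_point (\<Union>K) x0" using surface_boundary_iff[OF f x0(1)] y x0(2) by simp
  then obtain e0 where e0: "e0 \<in> edges K" "\<forall>z\<in>e0. boundary_point (\<Union>K) z"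
    using exists_boundary_edge[OF K dim manifold] by blast
  have "e0 \<subseteq> \<Union>K" using e0(1) by (auto simp: edges_def)
  then have e0_bd: "e0 \<in> boundary_edges X K f"
    using e0 surface_boundary_iff[OF f] by (auto simp: boundary_edges_def)
  have int: "e \<in> interior_edges X K f" if "e \<in> edges K" "e \<notin> boundary_edges X K f" for e
    using that by (simp add: interior_edges_def)
  have E: "d1 e = d2 e"
    if d: "polyhedral_metric Euclidean K d1" "polyhedral_metric Euclidean K d2"
      and b: "\<forall>e \<in> boundary_edges X K f. d1 e = d2 e"
      and c: "(\<forall>e \<in> interior_edges X K f. phi_curvature Euclidean h K d1 e = phi_curvature Euclidean h K d2 e) \<or>
         (\<forall>e \<in> interior_edges X K f. psi_curvature Euclidean h K d1 e = psi_curvature Euclidean h K d2 e)"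
      and e: "e \<in> edges K" for d1 d2 e
  proof (rule euclidean_rigidity[OF K dim manifold conn d _ e0(1) _ e])
    show "(\<forall>e\<in>edges K. d1 e = d2 e \<or> phi_curvature Euclidean h K d1 e = phi_curvature Euclidean h K d2 e) \<or>
       (\<forall>e\<in>edges K. d1 e = d2 e \<or> psi_curvature Euclidean h K d1 e = psi_curvature Euclidean h K d2 e)"
      using b c int by meson
    show "d1 e0 = d2 e0" using b e0_bd by blast
  qed
  have H: "d1 e = d2 e"
    if d: "polyhedral_metric Hyperbolic K d1" "polyhedral_metric Hyperbolic K d2"
      and b: "\<forall>e \<in> boundary_edges X K f. d1 e = d2 e"
      and c: "\<forall>e \<in> interior_edges X K f. psi_curvature Hyperbolic h K d1 e = psi_curvature Hyperbolic h K d2 e"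
      and e: "e \<in> edges K" for d1 d2 e
    by (rule hyperbolic_rigidity[OF K dim d _ e, where h = h]) (use b c int in meson)
  have S: "d1 e = d2 e"
    if d: "polyhedral_metric Spherical K d1" "polyhedral_metric Spherical K d2"
      and b: "\<forall>e \<in> boundary_edges X K f. d1 e = d2 e"
      and c: "\<forall>e \<in> interior_edges X K f. phi_curvature Spherical h K d1 e = phi_curvature Spherical h K d2 e"
      and e: "e \<in> edges K" for d1 d2 e
    by (rule spherical_rigidity[OF K dim d _ e, where h = h]) (use b c int in meson)
  show ?thesis
    by (intro conjI allI impI ballI; elim conjE) (rule E H S; assumption)+
qed

end
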